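(* Let $\chi\in C_c^\infty(\mathbb{R}^d)$ with $\mathbf 1_{B(0,1)}\le\chi\le\mathbf 1_{B(0,2)}$ and let $(q(x,\cdot))_{x\in\mathbb{R}^d}$ be a family of continuous negative definite functions of the form $$q(x,\xi)=q(x,0)-ib(x)\cdot\xi+\int_{y\ne0}\big(1-e^{iy\cdot\xi}+iy\cdot\xi\,\chi(y)\big)\,\nu(x,dy)$$ (no diffusion part). Suppose $q$ is locally bounded, i.e. for every compact $K\subseteq\mathbb{R}^d$ there is $c>0$ with $|q(x,\xi)|\le c(1+|\xi|^2)$ for $x\in K$, $\xi\in\mathbb{R}^d$. Then the following are equivalent: (i) $x\mapsto q(x,\xi)-q(x,0)$ is continuous for all $\xi\in\mathbb{R}^d$; (ii) $x\mapsto q(x,\xi)-q(x,0)$ is continuous for all $\xi$, and $\lim_{|\xi|\to0}\sup_{x\in K}|q(x,\xi)-q(x,0)|=0$ for every compact $K$; (iii) all of: (a) $x\mapsto b(x)$ is continuous; (b) $x\mapsto\nu(x,\cdot)$ is vaguely continuous on $\mathbb{R}^d\setminus\{0\}$, i.e. $\int f(y)\nu(z,dy)\to\int f(y)\nu(x,dy)$ as $z\to x$ for all $f\in C_c(\mathbb{R}^d\setminus\{0\})$ and $x\in\mathbb{R}^d$; (c) $\lim_{R\to\infty}\sup_{x\in K}\nu(x,B(0,R)^c)=0$ for every compact $K$; (d) $\lim_{r\to0}\sup_{x\in K}\int_{|y|\le r}|y|^2\nu(x,dy)=0$ for every compact $K$; (iv) the pseudo-differential operator $f\mapsto-\int e^{ix\cdot\xi}(q(x,\xi)-q(x,0))\hat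 f(\xi)d\xi$ maps $C_c^\infty(\mathbb{R}^d)$ into $C(\mathbb{R}^d)$.
   Context: $\hat f(\xi)=(2\pi)^{-d}\int e^{-ix\cdot\xi}f(x)dx$. For each $x$, $b(x)\in\mathbb{R}^d$ and $\nu(x,\cdot)$ is a measure on $\mathbb{R}^d\setminus\{0\}$ with $\int\min\{|y|^2,1\}\nu(x,dy)<\infty$; $q(x,0)\ge0$. *)

theory Defs
  imports "HOL-Analysis.Analysis"
begin

coinductive smooth_fun :: "('a::euclidean_space \<Rightarrow> 'b::real_normed_vector) \<Rightarrow> bool" where
  "continuous_on UNIV f \<Longrightarrow> (\<forall>x. f differentiable (at x)) \<Longrightarrow>
   (\<forall>i\<in>Basis. smooth_fun (\<lambda>x. frechet_derivative f (at x) i)) \<Longrightarrow> smooth_fun f"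

definition compact_support :: "('a::euclidean_space \<Rightarrow> 'b::zero) \<Rightarrow> bool" where
  "compact_support f \<longleftrightarrow> (\<exists>K. compact K \<and> (\<forall>x. x \<notin> K \<longrightarrow> f x = 0))"

definition Cc_infty :: "('a::euclidean_space \<Rightarrow> 'b::real_normed_vector) \<Rightarrow> bool" where
  "Cc_infty f \<longleftrightarrow> smooth_fun f \<and> compact_support f"

definition Cc_punctured :: "('a::euclidean_space \<Rightarrow> real) \<Rightarrow> bool" where
  "Cc_punctured f \<longleftrightarrow> continuous_on UNIV f \<and>
     (\<exists>K. compact K \<and> 0 \<notin> K \<and> (\<forall>x. x \<notin> K \<longrightarrow> f x = 0))"

definition fourier :: "('a::euclidean_space \<Rightarrow> complex) \<Rightarrow> 'a \<Rightarrow> complex" where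
  "fourier f \<xi> = complex_of_real ((2 * pi) powr (- real DIM('a))) *
     (LINT x|lborel. exp (- \<i> * complex_of_real (x \<bullet> \<xi>)) * f x)"

definition lk_symbol :: "('a::euclidean_space \<Rightarrow> real) \<Rightarrow> ('a \<Rightarrow> real) \<Rightarrow> ('a \<Rightarrow> 'a)
    \<Rightarrow> ('a \<Rightarrow> 'a measure) \<Rightarrow> 'a \<Rightarrow> 'a \<Rightarrow> complex" where
  "lk_symbol chi q0 b \<nu> x \<xi> = complex_of_real (q0 x) - \<i> * complex_of_real (b x \<bullet> \<xi>) +
     (LINT y|\<nu> x. 1 - exp (\<i> * complex_of_real (y \<bullet> \<xi>))
                 + \<i> * complex_of_real ((y \<bullet> \<xi>) * chi y))"

definition pdo :: "('a::euclidean_space \<Rightarrow> 'a \<Rightarrow> complex) \<Rightarrow> ('a \<Rightarrow> complex) \<Rightarrow> 'a \<Rightarrow> complex" where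
  "pdo q f x = - (LINT \<xi>|lborel. exp (\<i> * complex_of_real (x \<bullet> \<xi>)) * (q x \<xi> - q x 0) * fourier f \<xi>)"

end

theory Submission
  imports Defs "HOL-Probability.Probability"
begin

text \<open>
  Write p(x, \<xi>) = q(x, \<xi>) - q(x, 0). Averaging p over an even kernel k with Fourier transform K gives
  \<integral> (p(x, \<eta> + s \<xi>) - p(x, \<eta>)) k(\<xi>) d\<xi> = \<integral> exp(i y \<eta>) (K(0) - K(s y)) \<nu>(x, dy): drift and compensator
  cancel, and only integrable functions of the Levy measure remain.

  (i) implies (iii): for the Gaussian kernel and \<eta> = 0 the right-hand side is
  G(s, x) = \<integral> (1 - exp(- s^2 |y|^2 / 2)) \<nu>(x, dy), which is continuous in x by dominated convergence. As
  s \<rightarrow> 0, G(s, x) decreases to 0, and as s \<rightarrow> \<infinity> so does G(s, x) / s^2 along powers of 2; Dini's theorem makes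
  both limits locally uniform, which is (c) and (d). For general \<eta> one obtains convergence of
  the Fourier transforms of the finite measures (1 - exp(- |y|^2 / 2)) \<nu>(x, dy), hence vague convergence;
  continuity of the drift follows by subtraction. Conversely (iii) yields (i) and (ii) by cutting the
  Levy-Khintchine integral off near 0 and near infinity.

  (iv) implies (i): freezing the exponential at a limit point x, continuity of the images of test functions says that
  \<integral> p(z, \<xi>) f^(\<xi>) d\<xi> \<rightarrow> \<integral> p(x, \<xi>) f^(\<xi>) d\<xi> as z \<rightarrow> x for all test functions f, where f^ is the
  Fourier transform of f. Products of two such transforms are admissible as well, in particular
  rescaled translates of k = |\<chi>^|^2, a nonnegative even kernel. By the averaging identity the error of
  replacing p(z, \<eta>) K(0) by its k-average at scale s is at most \<integral> p(z, s \<xi>) k(\<xi>) d\<xi>, which converges as z \<rightarrow> x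
  to a quantity that vanishes as s \<rightarrow> 0.
\<close>

section \<open>Smooth functions and Fourier transforms\<close>

text \<open>The obstacle is that \<open>\<nu> x\<close> may have infinite mass near 0, and that the
  only control on p is a bound c (1 + |\<xi>|^2), uniform for x in a compact set. A convergent
  sequence together with its limit is compact, so this bound dominates p along the sequence, and any
  kernel integrable against 1 + |\<xi>|^2 may be integrated against p under a pointwise limit. This
  is where the weight in all integrability lemmas comes from. Two kernels are needed. The Gaussian
  has an explicit transform, and 1 - exp(- s^2 |y|^2 / 2) is comparable to min(s^2 |y|^2, 1), so
  tails and small jumps can be read off from G. But it is not the Fourier transform of a compactly
  supported function, so (iv) cannot be applied to it directly; there |\<chi>^|^2 takes over, with
  \<chi> as the test function at hand. Its nonnegativity gives K(0) - K(s y) \<ge> 0, which allows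
  the phase exp(i y \<eta>) to be dropped from the error. The resulting error bound is itself an
  average that converges in z; this replaces an equicontinuity estimate for p(z, .) at \<eta>. In
  (iii) the drift has to come last: it is isolated only once (b), (c), (d) have made the integral
  part continuous.\<close>

lemma smooth_fun_continuous: "smooth_fun f \<Longrightarrow> continuous_on UNIV f"
  by (erule smooth_fun.cases) auto

lemma smooth_fun_differentiable: "smooth_fun f \<Longrightarrow> f differentiable (at x)"
  by (erule smooth_fun.cases) auto

lemma smooth_fun_has_derivative:
  "smooth_fun f \<Longrightarrow> (f has_derivative frechet_derivative f (at x)) (at x)"
  using smooth_fun_differentiable frechet_derivative_works by blast

lemma smooth_fun_partial:
  "smooth_fun f \<Longrightarrow> i \<in> Basis \<Longrightarrow> smooth_fun (\<lambda>x. frechet_derivative f (at x) i)"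
  by (erule smooth_fun.cases) auto

text \<open>Coinduction for an indexed family that contains the partial derivatives of its members.
  Suitable indices absorb the extra terms that differentiation creates, so each closure property
  below reduces to one derivative computation.\<close>

lemma smooth_fun_family:
  assumes "P w"
    and step: "\<And>w. P w \<Longrightarrow> \<exists>D D'. (\<forall>x. (F w has_derivative D x) (at x)) \<and>
      (\<forall>i\<in>Basis. P (D' i) \<and> (\<forall>x. D x i = F (D' i) x))"
  shows "smooth_fun (F w)"
  using \<open>P w\<close>
proof (coinduction arbitrary: w rule: smooth_fun.coinduct)
  case smooth_fun
  obtain D D' where D: "\<And>x. (F w has_derivative D x) (at x)"
    "\<And>i. i \<in> Basis \<Longrightarrow> P (D' i)" "\<And>i x. i \<in> Basis \<Longrightarrow> D x i = F (D' i) x"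
    using step[OF smooth_fun] by blast
  have "frechet_derivative (F w) (at x) = D x" for x
    using frechet_derivative_at[OF D(1)] by (rule sym)
  then have "(\<lambda>x. frechet_derivative (F w) (at x) i) = F (D' i)" if "i \<in> Basis" for i
    using D(3)[OF that] by auto
  moreover have "continuous_on UNIV (F w)"
    using D(1) has_derivative_continuous_on[of UNIV "F w" D] by auto
  ultimately show ?case
    using D(1,2) by (auto simp: differentiable_def)
qed

lemma smooth_fun_bounded_linear:
  assumes L: "bounded_linear L" and "smooth_fun f"
  shows "smooth_fun (\<lambda>x. L (f x))"
proof (rule smooth_fun_family[where F="\<lambda>f x. L (f x)" and P=smooth_fun])
  fix f :: "'c \<Rightarrow> 'a" assume f: "smooth_fun f"
  have "((\<lambda>x. L (f x)) has_derivative (\<lambda>h. L (frechet_derivative f (at x) h))) (at x)" for x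
    using bounded_linear.has_derivative[OF L smooth_fun_has_derivative[OF f]] .
  then show "\<exists>D D'. (\<forall>x. ((\<lambda>x. L (f x)) has_derivative D x) (at x)) \<and>
      (\<forall>i\<in>Basis. smooth_fun (D' i) \<and> (\<forall>x. D x i = L (D' i x)))"
    using smooth_fun_partial[OF f]
    by (intro exI[of _ "\<lambda>x h. L (frechet_derivative f (at x) h)"]
        exI[of _ "\<lambda>i x. frechet_derivative f (at x) i"]) simp
qed fact

lemma smooth_fun_add:
  fixes f :: "'a::euclidean_space \<Rightarrow> 'b::real_normed_vector"
  assumes "smooth_fun f" and "smooth_fun g"
  shows "smooth_fun (\<lambda>x. f x + g x)"
proof -
  have "smooth_fun ((\<lambda>(f, g) x. f x + g x) (f, g))"
  proof (rule smooth_fun_family[where P="\<lambda>(f, g). smooth_fun f \<and> smooth_fun g"])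
    fix w :: "('a \<Rightarrow> 'b) \<times> ('a \<Rightarrow> 'b)" assume "case w of (f, g) \<Rightarrow> smooth_fun f \<and> smooth_fun g"
    then obtain f g where w: "w = (f, g)" and f: "smooth_fun f" and g: "smooth_fun g"
      by (cases w) auto
    let ?D = "\<lambda>x h. frechet_derivative f (at x) h + frechet_derivative g (at x) h"
    let ?D' = "\<lambda>i. (\<lambda>x. frechet_derivative f (at x) i, \<lambda>x. frechet_derivative g (at x) i)"
    have "((\<lambda>x. f x + g x) has_derivative ?D x) (at x)" for x
      by (intro has_derivative_add smooth_fun_has_derivative f g)
    then show "\<exists>D D'. (\<forall>x. ((case w of (f, g) \<Rightarrow> \<lambda>x. f x + g x) has_derivative D x) (at x)) \<and>
        (\<forall>i\<in>Basis. (case D' i of (f, g) \<Rightarrow> smooth_fun f \<and> smooth_fun g) \<and>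
          (\<forall>x. D x i = (case D' i of (f, g) \<Rightarrow> \<lambda>x. f x + g x) x))"
      using smooth_fun_partial[OF f] smooth_fun_partial[OF g]
      by (intro exI[of _ ?D] exI[of _ ?D']) (simp add: w)
  qed (use assms in simp)
  then show ?thesis by simp
qed

lemma smooth_fun_affine:
  fixes f :: "'a::euclidean_space \<Rightarrow> 'b::real_normed_vector"
  assumes "smooth_fun f"
  shows "smooth_fun (\<lambda>x. f (c *\<^sub>R x + z))"
proof (rule smooth_fun_family[where F="\<lambda>f x. f (c *\<^sub>R x + z)" and P=smooth_fun])
  fix f :: "'a \<Rightarrow> 'b" assume f: "smooth_fun f"
  let ?D = "\<lambda>x h. frechet_derivative f (at (c *\<^sub>R x + z)) (c *\<^sub>R h)"
  \<comment> \<open>The chain-rule factor \<open>c\<close> goes into the new outer function, so the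
    inner affine map stays the same for all derivatives.\<close>
  let ?D' = "\<lambda>i y. c *\<^sub>R frechet_derivative f (at y) i"
  have "((\<lambda>x. f (c *\<^sub>R x + z)) has_derivative ?D x) (at x)" for x
    by (rule has_derivative_compose[where f="\<lambda>x. c *\<^sub>R x + z" and g=f, OF _ smooth_fun_has_derivative[OF f]])
      (auto intro!: derivative_eq_intros)
  moreover have "?D x i = ?D' i (c *\<^sub>R x + z)" for x i
    using linear_frechet_derivative[OF smooth_fun_differentiable[OF f]]
    by (simp add: linear_cmul)
  moreover have "smooth_fun (?D' i)" if "i \<in> Basis" for i
    by (intro smooth_fun_bounded_linear[OF bounded_linear_scaleR_right] smooth_fun_partial f that)
  ultimately show "\<exists>D D'. (\<forall>x. ((\<lambda>x. f (c *\<^sub>R x + z)) has_derivative D x) (at x)) \<and>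
      (\<forall>i\<in>Basis. smooth_fun (D' i) \<and> (\<forall>x. D x i = D' i (c *\<^sub>R x + z)))"
    by (intro exI[of _ ?D] exI[of _ ?D']) simp
qed fact

lemma has_derivative_iexp_mult:
  fixes f :: "'a::euclidean_space \<Rightarrow> complex"
  assumes f: "smooth_fun f"
  shows "((\<lambda>x. iexp (x \<bullet> \<eta>) * f x) has_derivative
    (\<lambda>h. iexp (x \<bullet> \<eta>) * (\<i> * (h \<bullet> \<eta>) * f x + frechet_derivative f (at x) h))) (at x)"
proof -
  have "((\<lambda>x. \<i> * complex_of_real (x \<bullet> \<eta>)) has_derivative (\<lambda>h. \<i> * complex_of_real (h \<bullet> \<eta>))) (at x)"
    by (auto intro!: derivative_eq_intros)
  then have "((\<lambda>x. iexp (x \<bullet> \<eta>)) has_derivative (\<lambda>h. iexp (x \<bullet> \<eta>) * (\<i> * (h \<bullet> \<eta>)))) (at x)"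
    by (rule has_derivative_compose[OF _ DERIV_exp[THEN has_field_derivative_imp_has_derivative]])
  from has_derivative_mult[OF this smooth_fun_has_derivative[OF f]] show ?thesis
    by (rule has_derivative_eq_rhs) (auto simp: algebra_simps)
qed

lemma smooth_fun_iexp_mult:
  fixes f :: "'a::euclidean_space \<Rightarrow> complex"
  assumes "smooth_fun f"
  shows "smooth_fun (\<lambda>x. iexp (x \<bullet> \<eta>) * f x)"
proof (rule smooth_fun_family[where F="\<lambda>f x. iexp (x \<bullet> \<eta>) * f x" and P=smooth_fun])
  fix f :: "'a \<Rightarrow> complex" assume f: "smooth_fun f"
  let ?D = "\<lambda>x h. iexp (x \<bullet> \<eta>) * (\<i> * (h \<bullet> \<eta>) * f x + frechet_derivative f (at x) h)"
  \<comment> \<open>Both terms of the product rule carry the same exponential, so the derivative is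
    again that exponential times a smooth function; a general product rule is avoided.\<close>
  let ?D' = "\<lambda>i x. \<i> * (i \<bullet> \<eta>) * f x + frechet_derivative f (at x) i"
  have "((\<lambda>x. iexp (x \<bullet> \<eta>) * f x) has_derivative ?D x) (at x)" for x
    by (rule has_derivative_iexp_mult[OF f])
  moreover have "smooth_fun (?D' i)" if "i \<in> Basis" for i
    by (intro smooth_fun_add smooth_fun_bounded_linear[OF bounded_linear_mult_right] 
        smooth_fun_partial f that)
  ultimately show "\<exists>D D'. (\<forall>x. ((\<lambda>x. iexp (x \<bullet> \<eta>) * f x) has_derivative D x) (at x)) \<and>
      (\<forall>i\<in>Basis. smooth_fun (D' i) \<and> (\<forall>x. D x i = iexp (x \<bullet> \<eta>) * D' i x))"
    by (intro exI[of _ ?D] exI[of _ ?D']) simp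
qed fact

section \<open>Closure properties of test functions, and integrals over Lebesgue measure\<close>

lemma Cc_infty_bounded_linear:
  "bounded_linear L \<Longrightarrow> Cc_infty f \<Longrightarrow> Cc_infty (\<lambda>x. L (f x))"
  unfolding Cc_infty_def compact_support_def
  by (auto intro: smooth_fun_bounded_linear simp: linear_simps)

lemma Cc_infty_add:
  assumes "Cc_infty f" and "Cc_infty g" shows "Cc_infty (\<lambda>x. f x + g x)"
proof -
  obtain K L where K: "compact K" "\<And>x. x \<notin> K \<Longrightarrow> f x = 0" and L: "compact L" "\<And>x. x \<notin> L \<Longrightarrow> g x = 0"
    using assms unfolding Cc_infty_def compact_support_def by metis
  have "compact_support (\<lambda>x. f x + g x)"
    unfolding compact_support_def using K L by (intro exI[of _ "K \<union> L"]) (auto intro: compact_Un)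
  then show ?thesis
    using assms smooth_fun_add unfolding Cc_infty_def by blast
qed

lemma Cc_infty_affine:
  assumes f: "Cc_infty f" and "c \<noteq> 0" shows "Cc_infty (\<lambda>x. f (c *\<^sub>R x + z))"
proof -
  obtain K where K: "compact K" "\<And>x. x \<notin> K \<Longrightarrow> f x = 0"
    using f unfolding Cc_infty_def compact_support_def by metis
  let ?L = "(\<lambda>y. (1 / c) *\<^sub>R y - (1 / c) *\<^sub>R z) ` K"
  have "compact ?L"
    by (intro compact_continuous_image continuous_intros K(1))
  moreover have "f (c *\<^sub>R x + z) = 0" if "x \<notin> ?L" for x
  proof (rule K(2))
    show "c *\<^sub>R x + z \<notin> K"
      using that \<open>c \<noteq> 0\<close> by (force simp: image_iff algebra_simps)
  qed
  ultimately have "compact_support (\<lambda>x. f (c *\<^sub>R x + z))"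
    unfolding compact_support_def by blast
  then show ?thesis
    using f smooth_fun_affine unfolding Cc_infty_def by blast
qed

lemma Cc_infty_iexp_mult:
  "Cc_infty f \<Longrightarrow> Cc_infty (\<lambda>x. iexp (x \<bullet> \<eta>) * f x)"
  unfolding Cc_infty_def compact_support_def
  by (auto intro: smooth_fun_iexp_mult)

lemma Cc_infty_partial:
  assumes f: "Cc_infty f" and i: "i \<in> Basis"
  shows "Cc_infty (\<lambda>x. frechet_derivative f (at x) i)"
proof -
  obtain K where K: "compact K" "\<And>x. x \<notin> K \<Longrightarrow> f x = 0"
    using f unfolding Cc_infty_def compact_support_def by metis
  have "frechet_derivative f (at x) i = 0" if "x \<notin> K" for x
  proof -
    have "((\<lambda>_. 0) has_derivative (\<lambda>_. 0)) (at x)" by simp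
    then have "(f has_derivative (\<lambda>_. 0)) (at x)"
      by (rule has_derivative_transform_within_open[of _ _ _ _ "- K"])
        (use K that compact_imp_closed in auto)
    then show ?thesis
      using frechet_derivative_at[of f "\<lambda>_. 0" x] by (metis (full_types))
  qed
  then have "compact_support (\<lambda>x. frechet_derivative f (at x) i)"
    unfolding compact_support_def using K(1) by blast
  then show ?thesis
    using f i smooth_fun_partial unfolding Cc_infty_def by blast
qed

lemma Cc_infty_continuous: "Cc_infty f \<Longrightarrow> continuous_on UNIV f"
  unfolding Cc_infty_def by (blast intro: smooth_fun_continuous)

lemma compact_support_bounded:
  fixes f :: "'a::euclidean_space \<Rightarrow> 'b::real_normed_vector"
  assumes "continuous_on UNIV f" and "compact_support f"
  obtains B where "B > 0" and "\<And>x. norm (f x) \<le> B"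
proof -
  obtain K where K: "compact K" "\<And>x. x \<notin> K \<Longrightarrow> f x = 0"
    using assms unfolding compact_support_def by metis
  have "bounded (f ` K)"
    using compact_continuous_image[OF continuous_on_subset[OF assms(1)] K(1)] compact_imp_bounded
    by simp
  then obtain B where "B > 0" "\<And>x. x \<in> K \<Longrightarrow> norm (f x) \<le> B"
    unfolding bounded_pos by auto
  then show thesis
    using that[of B] K(2) by (metis less_eq_real_def norm_zero)
qed

lemma integrable_compact_support:
  fixes f :: "'a::euclidean_space \<Rightarrow> 'b::{banach,second_countable_topology}"
  assumes "continuous_on UNIV f" and "compact_support f"
  shows "integrable lborel f"
proof -
  obtain K where K: "compact K" "\<And>x. x \<notin> K \<Longrightarrow> f x = 0"
    using assms unfolding compact_support_def by metis
  have "(\<lambda>x. indicator K x *\<^sub>R f x) = f"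
    using K(2) by (auto simp: indicator_def)
  then show ?thesis
    using borel_integrable_compact[OF K(1) continuous_on_subset[OF assms(1)]] by simp
qed

lemma Cc_infty_integrable:
  fixes f :: "'a::euclidean_space \<Rightarrow> 'b::{banach,second_countable_topology}"
  shows "Cc_infty f \<Longrightarrow> integrable lborel f"
  using Cc_infty_continuous integrable_compact_support unfolding Cc_infty_def by blast

text \<open>Free of hypotheses on \<open>f\<close>: when \<open>f\<close> is not measurable, neither
  is the rescaled function, and both Bochner integrals are 0 by convention.\<close>

lemma integral_lborel_affine:
  fixes f :: "'a::euclidean_space \<Rightarrow> 'b::{banach,second_countable_topology}"
  assumes "c \<noteq> 0"
  shows "integral\<^sup>L lborel f = \<bar>c\<bar> ^ DIM('a) *\<^sub>R (LINT x|lborel. f (t + c *\<^sub>R x))"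
proof (cases "f \<in> borel_measurable borel")
  case [measurable]: True
  show ?thesis
    by (subst lborel_affine[OF assms, of t])
      (simp add: integral_density integral_distr)
next
  case False
  have "(\<lambda>x. f (t + c *\<^sub>R x)) \<notin> borel_measurable borel"
  proof
    assume "(\<lambda>x. f (t + c *\<^sub>R x)) \<in> borel_measurable borel"
    then have "(\<lambda>x. f (t + c *\<^sub>R x)) \<circ> (\<lambda>y. (1 / c) *\<^sub>R (y - t)) \<in> borel_measurable borel"
      by (intro measurable_comp[of _ borel borel]) auto
    then show False
      using False assms by (simp add: o_def)
  qed
  then have "\<not> integrable lborel f" "\<not> integrable lborel (\<lambda>x. f (t + c *\<^sub>R x))"
    using False borel_measurable_integrable by fastforce+
  then show ?thesis
    by (simp add: not_integrable_integral_eq)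
qed

lemma integral_lborel_translate:
  fixes f :: "'a::euclidean_space \<Rightarrow> 'b::{banach,second_countable_topology}"
  shows "(LINT x|lborel. f (x + t)) = integral\<^sup>L lborel f"
  using integral_lborel_affine[of 1 f t] by (simp add: add.commute)

lemma integral_lborel_uminus:
  fixes f :: "'a::euclidean_space \<Rightarrow> 'b::{banach,second_countable_topology}"
  shows "(LINT x|lborel. f (- x)) = integral\<^sup>L lborel f"
  using integral_lborel_affine[of "-1" f 0] by simp

text \<open>By translation invariance every difference quotient of \<open>f\<close> has integral 0,
  and the quotients converge dominatedly to the partial derivative. This is the integration by parts
  behind the decay of Fourier transforms.\<close>

lemma integral_partial_eq_0:
  fixes f :: "'a::euclidean_space \<Rightarrow> 'b::euclidean_space"
  assumes f: "Cc_infty f" and i: "i \<in> Basis"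
  shows "(LINT x|lborel. frechet_derivative f (at x) i) = 0"
proof -
  let ?D = "\<lambda>x. frechet_derivative f (at x)"
  let ?t = "\<lambda>n. 1 / real (Suc n)"
  have sm: "smooth_fun f" using f by (simp add: Cc_infty_def)
  note cont = Cc_infty_continuous[OF f] and contD = Cc_infty_continuous[OF Cc_infty_partial[OF f i]]
  have [measurable]: "f \<in> borel_measurable borel" "(\<lambda>x. ?D x i) \<in> borel_measurable borel"
    using cont contD by (auto intro: borel_measurable_continuous_onI)
  have D: "(f has_derivative ?D x) (at x)" for x
    by (rule smooth_fun_has_derivative[OF sm])
  have lin: "?D x (c *\<^sub>R i) = c *\<^sub>R ?D x i" for x c
    using linear_frechet_derivative[OF smooth_fun_differentiable[OF sm]] by (simp add: linear_cmul)
  obtain B where B: "B > 0" "\<And>x. norm (?D x i) \<le> B"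
    using compact_support_bounded[OF contD] Cc_infty_partial[OF f i] unfolding Cc_infty_def by blast
  obtain K where K: "compact K" "\<And>x. x \<notin> K \<Longrightarrow> f x = 0"
    using f unfolding Cc_infty_def compact_support_def by metis
  obtain R where R: "\<And>x. x \<in> K \<Longrightarrow> norm x \<le> R"
    using compact_imp_bounded[OF K(1)] unfolding bounded_iff by blast
  have inc: "((\<lambda>s. f (x + s *\<^sub>R i)) has_derivative (\<lambda>h. h *\<^sub>R ?D (x + s *\<^sub>R i) i)) (at s)" for x s
  proof -
    have "((\<lambda>s. f (x + s *\<^sub>R i)) has_derivative (\<lambda>h. ?D (x + s *\<^sub>R i) (h *\<^sub>R i))) (at s)"
      by (rule has_derivative_compose[where f="\<lambda>s. x + s *\<^sub>R i" and g=f, OF _ D])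
        (auto intro!: derivative_eq_intros)
    then show ?thesis by (simp add: lin)
  qed
  have "(\<lambda>n. LINT x|lborel. (f (x + ?t n *\<^sub>R i) - f x) /\<^sub>R ?t n) \<longlonglongrightarrow> (LINT x|lborel. ?D x i)"
  \<comment> \<open>The increments \<open>?t n\<close> are at most 1, so all quotients vanish
    outside the support radius enlarged by 1; inside, the mean value theorem bounds them by
    \<open>B\<close>.\<close>
  proof (rule integral_dominated_convergence[where w="\<lambda>x. B * indicator (cball 0 (R + 1)) x"])
    show "integrable lborel (\<lambda>x. B * indicator (cball 0 (R + 1)) x :: real)"
      by (intro integrable_mult_right integrable_real_indicator) (auto simp: emeasure_bounded_finite[simplified])
    show "AE x in lborel. (\<lambda>n. (f (x + ?t n *\<^sub>R i) - f x) /\<^sub>R ?t n) \<longlonglongrightarrow> ?D x i"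
    proof (rule AE_I2)
      fix x
      have lim: "(\<lambda>h. norm (f (x + h *\<^sub>R i) - f x - h *\<^sub>R ?D x i) / norm h) \<midarrow>0\<rightarrow> 0"
        using inc[of x 0] by (simp add: has_derivative_at)
      have eq: "norm (f (x + h *\<^sub>R i) - f x - h *\<^sub>R ?D x i) / norm h =
          norm ((f (x + h *\<^sub>R i) - f x) /\<^sub>R h - ?D x i)" if "h \<noteq> 0" for h
      proof -
        have "(f (x + h *\<^sub>R i) - f x) /\<^sub>R h - ?D x i = (f (x + h *\<^sub>R i) - f x - h *\<^sub>R ?D x i) /\<^sub>R h"
          using that by (simp add: scaleR_diff_right)
        then show ?thesis by (simp add: divide_inverse mult.commute)
      qed
      have "(\<lambda>h. norm ((f (x + h *\<^sub>R i) - f x) /\<^sub>R h - ?D x i)) \<midarrow>0\<rightarrow> 0"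
        using eq by (intro Lim_transform_eventually[OF lim])
          (auto simp only: eventually_at_filter intro!: always_eventually)
      then have "(\<lambda>h. (f (x + h *\<^sub>R i) - f x) /\<^sub>R h) \<midarrow>0\<rightarrow> ?D x i"
        by (rule LIM_zero_cancel[OF tendsto_norm_zero_cancel])
      then show "(\<lambda>n. (f (x + ?t n *\<^sub>R i) - f x) /\<^sub>R ?t n) \<longlonglongrightarrow> ?D x i"
        by (rule filterlim_compose)
          (use LIMSEQ_inverse_real_of_nat in \<open>simp add: filterlim_at inverse_eq_divide del: of_nat_Suc\<close>)
    qed
    show "AE x in lborel. norm ((f (x + ?t n *\<^sub>R i) - f x) /\<^sub>R ?t n) \<le> B * indicator (cball 0 (R + 1)) x" for n
    proof (rule AE_I2)
      fix x
      have t: "0 < ?t n" "?t n \<le> 1" by auto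
      show "norm ((f (x + ?t n *\<^sub>R i) - f x) /\<^sub>R ?t n) \<le> B * indicator (cball 0 (R + 1)) x"
      proof (cases "norm x \<le> R + 1")
        case True
        have "continuous_on {0..?t n} (\<lambda>s. f (x + s *\<^sub>R i))"
          by (intro continuous_on_compose2[OF cont] continuous_intros) auto
        from mvt_general[OF t(1) this inc] obtain s where
          s: "norm (f (x + ?t n *\<^sub>R i) - f x) \<le> norm (?t n *\<^sub>R ?D (x + s *\<^sub>R i) i)"
          by auto
        also have "\<dots> \<le> ?t n * B"
          using B(2)[of "x + s *\<^sub>R i"] t by (simp add: divide_right_mono)
        finally have "inverse (?t n) * norm (f (x + ?t n *\<^sub>R i) - f x) \<le> B"
          using t by (simp add: field_simps)
        then show ?thesis
          using True t unfolding norm_scaleR by simp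
      next
        case False
        have "norm (x + ?t n *\<^sub>R i) \<ge> norm x - norm (?t n *\<^sub>R i)" 
          using norm_diff_ineq by blast
        moreover have "norm (?t n *\<^sub>R i) \<le> 1"
          using i by simp
        ultimately have "norm (x + ?t n *\<^sub>R i) > R"
          using False by linarith
        then have "f (x + ?t n *\<^sub>R i) = 0" "f x = 0"
          using False R[of x] R[of "x + ?t n *\<^sub>R i"] K(2) by (fastforce simp del: of_nat_Suc)+
        then show ?thesis
          using False by simp
      qed
    qed
  qed auto
  moreover have "(LINT x|lborel. (f (x + ?t n *\<^sub>R i) - f x) /\<^sub>R ?t n) = 0" for n
  proof -
    have int: "integrable lborel f" "integrable lborel (\<lambda>x. f (x + ?t n *\<^sub>R i))"
      using Cc_infty_integrable[OF f] Cc_infty_integrable[OF Cc_infty_affine[OF f, of 1 "?t n *\<^sub>R i"]] by simp_all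
    then show ?thesis
      by (simp add: integral_lborel_translate)
  qed
  ultimately show ?thesis
    by (simp add: LIMSEQ_const_iff)
qed

section \<open>Fourier transforms of test functions and their decay\<close>

lemma fourier_integrable:
  assumes "Cc_infty f"
  shows "integrable lborel (\<lambda>x. exp (- \<i> * complex_of_real (x \<bullet> \<xi>)) * f x)"
  using Cc_infty_integrable[OF Cc_infty_iexp_mult[OF assms, of "- \<xi>"]] by simp

text \<open>The integral of the partial derivative of exp(- i x \<xi>) f(x) vanishes; the product
  rule splits it into the two sides.\<close>

lemma fourier_partial:
  assumes f: "Cc_infty f" and i: "i \<in> Basis"
  shows "fourier (\<lambda>x. frechet_derivative f (at x) i) \<xi> = \<i> * (\<xi> \<bullet> i) * fourier f \<xi>"
proof -
  let ?e = "\<lambda>x. exp (- \<i> * complex_of_real (x \<bullet> \<xi>))"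
  let ?g = "\<lambda>x. iexp (x \<bullet> (- \<xi>)) * f x"
  have sm: "smooth_fun f" using f by (simp add: Cc_infty_def)
  have "frechet_derivative ?g (at x) i = ?e x * frechet_derivative f (at x) i - \<i> * (\<xi> \<bullet> i) * (?e x * f x)" for x
    using frechet_derivative_at[OF has_derivative_iexp_mult[OF sm, of "- \<xi>" x], symmetric]
    by (simp add: algebra_simps inner_commute)
  then have "0 = (LINT x|lborel. ?e x * frechet_derivative f (at x) i - \<i> * (\<xi> \<bullet> i) * (?e x * f x))"
    using integral_partial_eq_0[OF Cc_infty_iexp_mult[OF f, of "- \<xi>"] i] by simp
  also have "\<dots> = (LINT x|lborel. ?e x * frechet_derivative f (at x) i) - \<i> * (\<xi> \<bullet> i) * (LINT x|lborel. ?e x * f x)"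
    using fourier_integrable[OF f] fourier_integrable[OF Cc_infty_partial[OF f i]]
    by (subst Bochner_Integration.integral_diff) auto
  finally show ?thesis
    unfolding fourier_def by simp
qed

lemma fourier_bounded:
  fixes f :: "'a::euclidean_space \<Rightarrow> complex"
  assumes "Cc_infty f"
  shows "cmod (fourier f \<xi>) \<le> (2 * pi) powr (- real DIM('a)) * (LINT x|lborel. cmod (f x))"
proof -
  have "cmod (LINT x|lborel. exp (- \<i> * complex_of_real (x \<bullet> \<xi>)) * f x) \<le>
      (LINT x|lborel. cmod (exp (- \<i> * complex_of_real (x \<bullet> \<xi>)) * f x))"
    by simp
  also have "\<dots> = (LINT x|lborel. cmod (f x))"
    by (simp add: norm_mult)
  finally show ?thesis
    unfolding fourier_def by (simp add: norm_mult mult_left_mono)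
qed

lemma fourier_add:
  assumes "Cc_infty f" and "Cc_infty g"
  shows "fourier (\<lambda>x. f x + g x) \<xi> = fourier f \<xi> + fourier g \<xi>"
  unfolding fourier_def
  using fourier_integrable[OF assms(1)] fourier_integrable[OF assms(2)]
  by (simp add: distrib_left)

lemma fourier_uminus: "fourier (\<lambda>x. - f x) \<xi> = - fourier f \<xi>"
  unfolding fourier_def by simp

text \<open>The factor is the symbol of 1 minus the second derivative in direction \<open>i\<close>,
  so \<open>g\<close> is \<open>f\<close> minus that second derivative.\<close>

lemma fourier_multiplier:
  assumes f: "Cc_infty f" and i: "i \<in> Basis"
  shows "\<exists>g. Cc_infty g \<and> (\<forall>\<xi>. fourier g \<xi> = complex_of_real (1 + (\<xi> \<bullet> i)\<^sup>2) * fourier f \<xi>)"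
proof -
  let ?d = "\<lambda>x. frechet_derivative f (at x) i"
  let ?dd = "\<lambda>x. frechet_derivative ?d (at x) i"
  have d: "Cc_infty ?d" and dd: "Cc_infty ?dd"
    using Cc_infty_partial f i by blast+
  have ndd: "Cc_infty (\<lambda>x. - ?dd x)"
    using Cc_infty_bounded_linear[OF bounded_linear_minus[OF bounded_linear_ident] dd] .
  have "fourier (\<lambda>x. f x + - ?dd x) \<xi> = complex_of_real (1 + (\<xi> \<bullet> i)\<^sup>2) * fourier f \<xi>" for \<xi>
    unfolding fourier_add[OF f ndd] fourier_uminus fourier_partial[OF d i] fourier_partial[OF f i]
    by (simp add: algebra_simps power2_eq_square)
  then show ?thesis
    using Cc_infty_add[OF f ndd] by blast
qed

text \<open>The multiplier is applied twice per coordinate. One of the two resulting products will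
  absorb the weight 1 + |\<xi>|^2, and the reciprocal of the other is integrable.\<close>

lemma fourier_decay:
  fixes f :: "'a::euclidean_space \<Rightarrow> complex"
  assumes f: "Cc_infty f"
  obtains C where "\<And>\<xi>. cmod (fourier f \<xi>) * (\<Prod>i\<in>Basis. (1 + (\<xi> \<bullet> i)\<^sup>2)\<^sup>2) \<le> C"
proof -
  have "\<exists>g. Cc_infty g \<and> (\<forall>\<xi>. fourier g \<xi> = complex_of_real (\<Prod>i\<in>S. (1 + (\<xi> \<bullet> i)\<^sup>2)\<^sup>2) * fourier f \<xi>)"
    if "S \<subseteq> Basis" for S :: "'a set"
    using finite_subset[OF that finite_Basis] that
  proof (induction S rule: finite_induct)
    case empty
    then show ?case using f by auto
  next
    case (insert i S)
    then obtain g where g: "Cc_infty g"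
      "\<And>\<xi>. fourier g \<xi> = complex_of_real (\<Prod>i\<in>S. (1 + (\<xi> \<bullet> i)\<^sup>2)\<^sup>2) * fourier f \<xi>"
      by auto
    have i: "i \<in> Basis" using insert by auto
    obtain g1 where g1: "Cc_infty g1" "\<And>\<xi>. fourier g1 \<xi> = complex_of_real (1 + (\<xi> \<bullet> i)\<^sup>2) * fourier g \<xi>"
      using fourier_multiplier[OF g(1) i] by auto
    obtain g2 where g2: "Cc_infty g2" "\<And>\<xi>. fourier g2 \<xi> = complex_of_real (1 + (\<xi> \<bullet> i)\<^sup>2) * fourier g1 \<xi>"
      using fourier_multiplier[OF g1(1) i] by auto
    show ?case
      using insert.hyps g2 by (intro exI[of _ g2]) (simp add: g1(2) g(2) power2_eq_square)
  qed
  then obtain g where g: "Cc_infty g"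
    "\<And>\<xi>. fourier g \<xi> = complex_of_real (\<Prod>i\<in>Basis. (1 + (\<xi> \<bullet> i)\<^sup>2)\<^sup>2) * fourier f \<xi>"
    by blast
  have "cmod (fourier f \<xi>) * (\<Prod>i\<in>Basis. (1 + (\<xi> \<bullet> i)\<^sup>2)\<^sup>2) = cmod (fourier g \<xi>)" for \<xi>
    unfolding g(2) norm_mult norm_of_real by (simp add: prod_nonneg)
  then show thesis
    using that fourier_bounded[OF g(1)] by metis
qed

text \<open>Turns the radial weight into a product over coordinates, so that integrability reduces
  to dimension one.\<close>

lemma one_plus_norm_le_prod:
  fixes \<xi> :: "'a::euclidean_space"
  shows "1 + (norm \<xi>)\<^sup>2 \<le> (\<Prod>i\<in>Basis. 1 + (\<xi> \<bullet> i)\<^sup>2)"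
proof -
  have "1 + (\<Sum>i\<in>S. (\<xi> \<bullet> i)\<^sup>2) \<le> (\<Prod>i\<in>S. 1 + (\<xi> \<bullet> i)\<^sup>2)" if "finite S" for S :: "'a set"
    using that
  proof (induction S rule: finite_induct)
    case (insert i S)
    have "1 + (\<Sum>i\<in>insert i S. (\<xi> \<bullet> i)\<^sup>2) \<le> (1 + (\<xi> \<bullet> i)\<^sup>2) * (1 + (\<Sum>i\<in>S. (\<xi> \<bullet> i)\<^sup>2))"
      using insert.hyps by (simp add: algebra_simps sum_nonneg)
    also have "\<dots> \<le> (1 + (\<xi> \<bullet> i)\<^sup>2) * (\<Prod>i\<in>S. 1 + (\<xi> \<bullet> i)\<^sup>2)"
      using insert.IH by (intro mult_left_mono) auto
    finally show ?case using insert.hyps by simp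
  qed simp
  moreover have "(norm \<xi>)\<^sup>2 = (\<Sum>i\<in>Basis. (\<xi> \<bullet> i)\<^sup>2)"
    unfolding power2_norm_eq_inner by (subst euclidean_inner) (simp add: power2_eq_square)
  ultimately show ?thesis
    by simp
qed

lemma
  fixes u :: "'a::euclidean_space \<Rightarrow> real \<Rightarrow> 'b::{real_normed_field,banach,second_countable_topology}"
  assumes "\<And>i. i \<in> Basis \<Longrightarrow> integrable lborel (u i)"
  shows integrable_prod_Basis: "integrable lborel (\<lambda>x::'a. \<Prod>i\<in>Basis. u i (x \<bullet> i))"
    and integral_prod_Basis: "(LINT x|lborel. (\<Prod>i\<in>Basis. u i (x \<bullet> i))) = (\<Prod>i\<in>Basis. integral\<^sup>L lborel (u i))"
proof -
  interpret product_sigma_finite "\<lambda>_::'a. lborel :: real measure" ..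
  have [measurable]: "u i \<in> borel_measurable borel" if "i \<in> Basis" for i
    using borel_measurable_integrable[OF assms[OF that]] by simp
  have m: "(\<lambda>x::'a. \<Prod>i\<in>Basis. u i (x \<bullet> i)) \<in> borel_measurable borel"
    by measurable
  have eq: "(\<Prod>i\<in>Basis. u i ((\<Sum>j\<in>Basis. f j *\<^sub>R j) \<bullet> i)) = (\<Prod>i\<in>Basis. u i (f i))" for f :: "'a \<Rightarrow> real"
    by (intro prod.cong refl) simp
  show "integrable lborel (\<lambda>x::'a. \<Prod>i\<in>Basis. u i (x \<bullet> i))"
    by (subst lborel_eq, subst integrable_distr_eq[OF _ m])
       (simp_all add: eq product_integrable_prod assms)
  show "(LINT x|lborel. (\<Prod>i\<in>Basis. u i (x \<bullet> i))) = (\<Prod>i\<in>Basis. integral\<^sup>L lborel (u i))"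
    by (subst lborel_eq, subst integral_distr[OF _ m])
       (simp_all add: eq product_integral_prod assms)
qed

lemma borel_measurable_fourier:
  fixes f :: "'a::euclidean_space \<Rightarrow> complex"
  assumes "Cc_infty f"
  shows "fourier f \<in> borel_measurable borel"
proof -
  have [measurable]: "f \<in> borel_measurable borel"
    using Cc_infty_continuous[OF assms] by (rule borel_measurable_continuous_onI)
  show ?thesis
    unfolding fourier_def by measurable
qed

text \<open>The weight is the growth bound of p, so this is what makes the integral defining the
  operator converge, with an integrable bound that is uniform for x in a compact set.\<close>

lemma integrable_fourier_weighted:
  fixes f :: "'a::euclidean_space \<Rightarrow> complex"
  assumes f: "Cc_infty f"
  shows "integrable lborel (\<lambda>\<xi>. (1 + (norm \<xi>)\<^sup>2) * cmod (fourier f \<xi>))"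
proof -
  note [measurable] = borel_measurable_fourier[OF f]
  obtain C where C: "\<And>\<xi>. cmod (fourier f \<xi>) * (\<Prod>i\<in>Basis. (1 + (\<xi> \<bullet> i)\<^sup>2)\<^sup>2) \<le> C"
    using fourier_decay[OF f] by blast
  have 1: "integrable lborel (\<lambda>t::real. 1 / (1 + t\<^sup>2))"
    using integrable_inverse_1_plus_square by (simp add: set_integrable_def field_simps)
  have "integrable lborel (\<lambda>\<xi>::'a. C * (\<Prod>i\<in>Basis. 1 / (1 + (\<xi> \<bullet> i)\<^sup>2)))"
    by (intro integrable_mult_right integrable_prod_Basis[where u="\<lambda>_ t. 1 / (1 + t\<^sup>2)"] 1)
  then show ?thesis
  proof (rule Bochner_Integration.integrable_bound)
    have "norm ((1 + (norm \<xi>)\<^sup>2) * cmod (fourier f \<xi>)) \<le> norm (C * (\<Prod>i\<in>Basis. 1 / (1 + (\<xi> \<bullet> i)\<^sup>2)))"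
      for \<xi> :: 'a
    proof -
      let ?P = "\<Prod>i\<in>Basis. 1 + (\<xi> \<bullet> i)\<^sup>2"
      have P: "?P > 0" by (intro prod_pos) (auto intro: add_pos_nonneg)
      have "cmod (fourier f \<xi>) * ?P\<^sup>2 \<le> C"
        using C[of \<xi>] by (simp add: prod_power_distrib)
      then have "cmod (fourier f \<xi>) * ?P \<le> C / ?P"
        using P by (simp add: field_simps power2_eq_square)
      moreover have "(1 + (norm \<xi>)\<^sup>2) * cmod (fourier f \<xi>) \<le> cmod (fourier f \<xi>) * ?P"
        using mult_left_mono[OF one_plus_norm_le_prod[of \<xi>], of "cmod (fourier f \<xi>)"] by (simp add: mult.commute)
      ultimately have "(1 + (norm \<xi>)\<^sup>2) * cmod (fourier f \<xi>) \<le> C / ?P" by linarith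
      then show ?thesis
        using P order_trans[OF _ divide_right_mono[OF abs_ge_self[of C], of ?P]]
        by (simp add: prod_dividef abs_mult)
    qed
    then show "AE \<xi> in lborel. norm ((1 + (norm \<xi>)\<^sup>2) * cmod (fourier f \<xi>)) \<le> norm (C * (\<Prod>i\<in>Basis. 1 / (1 + (\<xi> \<bullet> i)\<^sup>2)))"
      by simp
  qed measurable
qed

section \<open>The standard Gaussian density and its Fourier transform\<close>

definition std_gauss :: "'a::euclidean_space \<Rightarrow> real" where
  "std_gauss x = (\<Prod>i\<in>Basis. std_normal_density (x \<bullet> i))"

text \<open>The defining product form serves integration coordinate by coordinate; this radial form
  serves symmetry and shows that the density is its own transform up to a constant.\<close>

lemma std_gauss_eq:
  fixes x :: "'a::euclidean_space"
  shows "std_gauss x = (1 / sqrt (2 * pi)) ^ DIM('a) * exp (- (norm x)\<^sup>2 / 2)"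
proof -
  have "(norm x)\<^sup>2 = (\<Sum>i\<in>Basis. (x \<bullet> i)\<^sup>2)"
    unfolding power2_norm_eq_inner by (subst euclidean_inner) (simp add: power2_eq_square)
  then show ?thesis
    unfolding std_gauss_def std_normal_density_def prod.distrib
    by (simp add: exp_sum[symmetric] sum_negf sum_divide_distrib)
qed

lemma std_gauss_nonneg: "std_gauss x \<ge> 0"
  by (simp add: std_gauss_eq)

lemma std_gauss_uminus: "std_gauss (- x) = std_gauss x"
  by (simp add: std_gauss_eq)

lemma std_gauss_measurable [measurable]: "std_gauss \<in> borel_measurable borel"
  unfolding std_gauss_def[abs_def] by measurable

lemma integrable_std_gauss_weighted:
  "integrable lborel (\<lambda>\<xi>::'a::euclidean_space. (1 + (norm \<xi>)\<^sup>2) * std_gauss \<xi>)"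
proof -
  have "integrable lborel (\<lambda>t. std_normal_density t * t^0 + std_normal_density t * t\<^sup>2)"
    by (intro Bochner_Integration.integrable_add integrable_std_normal_moment)
  then have 1: "integrable lborel (\<lambda>t. (1 + t\<^sup>2) * std_normal_density t)"
    by (simp add: algebra_simps)
  have "integrable lborel (\<lambda>\<xi>::'a. \<Prod>i\<in>Basis. (1 + (\<xi> \<bullet> i)\<^sup>2) * std_normal_density (\<xi> \<bullet> i))"
    by (intro integrable_prod_Basis[where u="\<lambda>_ t. (1 + t\<^sup>2) * std_normal_density t"] 1)
  then show ?thesis
  proof (rule Bochner_Integration.integrable_bound)
    have norm_mono: "a \<le> b \<Longrightarrow> 0 \<le> a \<Longrightarrow> norm a \<le> norm b" for a b :: real
      by simp
    have "(1 + (norm \<xi>)\<^sup>2) * std_gauss \<xi> \<le> (\<Prod>i\<in>Basis. (1 + (\<xi> \<bullet> i)\<^sup>2) * std_normal_density (\<xi> \<bullet> i))" for \<xi> :: 'a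
      unfolding prod.distrib std_gauss_def[symmetric]
      by (intro mult_right_mono one_plus_norm_le_prod std_gauss_nonneg)
    then have "norm ((1 + (norm \<xi>)\<^sup>2) * std_gauss \<xi>) \<le>
        norm (\<Prod>i\<in>Basis. (1 + (\<xi> \<bullet> i)\<^sup>2) * std_normal_density (\<xi> \<bullet> i))" for \<xi> :: 'a
      by (rule norm_mono) (simp add: std_gauss_nonneg)
    then show "AE \<xi> in (lborel :: 'a measure). norm ((1 + (norm \<xi>)\<^sup>2) * std_gauss \<xi>) \<le>
        norm (\<Prod>i\<in>Basis. (1 + (\<xi> \<bullet> i)\<^sup>2) * std_normal_density (\<xi> \<bullet> i))"
      by simp
  qed measurable
qed

lemma integral_iexp_std_gauss:
  fixes y :: "'a::euclidean_space"
  shows "(LINT \<xi>|lborel. iexp (y \<bullet> \<xi>) * std_gauss \<xi>) = exp (- (norm y)\<^sup>2 / 2)"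
proof -
  have 1: "(LINT t|lborel. iexp (s * t) * std_normal_density t) = exp (- s\<^sup>2 / 2)" for s
    using fun_cong[OF char_std_normal_distribution, of s]
    by (simp add: char_def integral_density scaleR_conv_of_real mult.commute)
  have i: "integrable lborel (\<lambda>t. iexp (s * t) * std_normal_density t)" for s
    by (rule Bochner_Integration.integrable_bound[OF integrable_normal_density[of 1 0]]) 
      (auto simp: norm_mult)
  have "iexp (y \<bullet> \<xi>) * std_gauss \<xi> = (\<Prod>i\<in>Basis. iexp ((y \<bullet> i) * (\<xi> \<bullet> i)) * std_normal_density (\<xi> \<bullet> i))" for \<xi>
    unfolding prod.distrib std_gauss_def
    by (subst euclidean_inner) (simp add: exp_sum[symmetric] sum_distrib_left)
  then have "(LINT \<xi>|lborel. iexp (y \<bullet> \<xi>) * std_gauss \<xi>) = (\<Prod>i\<in>Basis. exp (- (y \<bullet> i)\<^sup>2 / 2))"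
    using integral_prod_Basis[where u="\<lambda>i t. iexp ((y \<bullet> i) * t) * std_normal_density t", OF i]
    by (simp only: 1 of_real_prod)
  moreover have "(norm y)\<^sup>2 = (\<Sum>i\<in>Basis. (y \<bullet> i)\<^sup>2)"
    unfolding power2_norm_eq_inner by (subst euclidean_inner) (simp add: power2_eq_square)
  ultimately show ?thesis
    by (simp add: exp_sum[symmetric] sum_negf sum_divide_distrib)
qed

section \<open>Levy measures and averaged exponents\<close>

definition lk_integrand :: "('a::euclidean_space \<Rightarrow> real) \<Rightarrow> 'a \<Rightarrow> 'a \<Rightarrow> complex" where
  "lk_integrand chi \<xi> y = 1 - iexp (y \<bullet> \<xi>) + \<i> * complex_of_real ((y \<bullet> \<xi>) * chi y)"

definition lk_exponent ::
    "('a::euclidean_space \<Rightarrow> real) \<Rightarrow> 'a \<Rightarrow> 'a measure \<Rightarrow> 'a \<Rightarrow> complex" where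
  "lk_exponent chi \<beta> N \<xi> = - \<i> * complex_of_real (\<beta> \<bullet> \<xi>) + (LINT y|N. lk_integrand chi \<xi> y)"

lemma lk_integrand_0 [simp]: "lk_integrand chi 0 y = 0"
  by (simp add: lk_integrand_def)

lemma lk_exponent_0 [simp]: "lk_exponent chi \<beta> N 0 = 0"
  by (simp add: lk_exponent_def)

lemma lk_symbol_diff:
  "lk_symbol chi q0 b \<nu> x \<xi> - lk_symbol chi q0 b \<nu> x 0 = lk_exponent chi (b x) (\<nu> x) \<xi>"
  by (simp add: lk_symbol_def lk_exponent_def lk_integrand_def)

locale truncation =
  fixes chi :: "'a::euclidean_space \<Rightarrow> real"
  assumes chi_continuous: "continuous_on UNIV chi"
    and chi_bounds: "indicator (ball 0 1) y \<le> chi y" "chi y \<le> indicator (ball 0 2) y"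
begin

lemma chi_measurable [measurable]: "chi \<in> borel_measurable borel"
  using chi_continuous by (rule borel_measurable_continuous_onI)

lemma chi_eq_1: "norm y < 1 \<Longrightarrow> chi y = 1"
  using chi_bounds[of y] by (auto simp: indicator_def split: if_splits)

lemma chi_eq_0: "norm y \<ge> 2 \<Longrightarrow> chi y = 0"
  using chi_bounds[of y] by (auto simp: indicator_def split: if_splits)

lemma chi_nonneg: "0 \<le> chi y" and chi_le_1: "chi y \<le> 1"
  using chi_bounds[of y] by (auto simp: indicator_def of_bool_def split: if_splits)

lemma norm_mult_chi_le: "norm y * chi y \<le> 2"
proof (cases "norm y \<ge> 2")
  case False
  then show ?thesis
    using mult_mono[of "norm y" 2 "chi y" 1] chi_nonneg chi_le_1 by simp
qed (simp add: chi_eq_0)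

lemma lk_integrand_measurable [measurable]:
  "(\<lambda>(\<xi>, y). lk_integrand chi \<xi> y) \<in> borel_measurable (borel \<Otimes>\<^sub>M borel)"
  unfolding lk_integrand_def by measurable

lemma lk_integrand_continuous: "continuous_on UNIV (lk_integrand chi \<xi>)"
  unfolding lk_integrand_def by (intro continuous_intros chi_continuous)

text \<open>Inside the unit ball the truncation is 1, so the integrand is minus the Taylor remainder
  of the exponential after the linear term.\<close>

lemma lk_integrand_small: 
  assumes "norm y < 1"
  shows "cmod (lk_integrand chi \<xi> y) \<le> (norm y)\<^sup>2 * (norm \<xi>)\<^sup>2 / 2"
proof -
  have "lk_integrand chi \<xi> y = - (iexp (y \<bullet> \<xi>) - (\<Sum>k\<le>1. (\<i> * (y \<bullet> \<xi>)) ^ k / fact k))"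
    using chi_eq_1[OF assms] by (simp add: lk_integrand_def)
  then have "cmod (lk_integrand chi \<xi> y) \<le> \<bar>y \<bullet> \<xi>\<bar>\<^sup>2 / 2"
    using iexp_approx1[of "y \<bullet> \<xi>" 1] by (simp add: norm_minus_commute numeral_2_eq_2)
  also have "\<bar>y \<bullet> \<xi>\<bar>\<^sup>2 \<le> (norm y * norm \<xi>)\<^sup>2"
    by (intro power_mono Cauchy_Schwarz_ineq2) auto
  finally show ?thesis
    by (simp add: power_mult_distrib)
qed

text \<open>The 2 is the radius of the ball outside which \<open>chi\<close> vanishes.\<close>

lemma lk_integrand_compensator: "cmod (\<i> * complex_of_real ((y \<bullet> \<xi>) * chi y)) \<le> 2 * norm \<xi>"
proof -
  have "cmod (\<i> * complex_of_real ((y \<bullet> \<xi>) * chi y)) = \<bar>y \<bullet> \<xi>\<bar> * chi y"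
    using chi_nonneg by (simp add: norm_mult abs_mult)
  also have "\<dots> \<le> norm y * norm \<xi> * chi y"
    by (intro mult_right_mono Cauchy_Schwarz_ineq2 chi_nonneg)
  also have "\<dots> \<le> 2 * norm \<xi>"
    using mult_right_mono[OF norm_mult_chi_le[of y], of "norm \<xi>"] by (simp add: mult_ac)
  finally show ?thesis .
qed

lemma lk_integrand_large: "cmod (lk_integrand chi \<xi> y) \<le> 2 + 2 * norm \<xi>"
proof -
  have "cmod (1 - iexp (y \<bullet> \<xi>)) \<le> 2"
    using norm_triangle_ineq4[of 1 "iexp (y \<bullet> \<xi>)"] by simp
  then show ?thesis
    using norm_triangle_ineq[of "1 - iexp (y \<bullet> \<xi>)" "\<i> * complex_of_real ((y \<bullet> \<xi>) * chi y)"]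
      lk_integrand_compensator[of y \<xi>]
    unfolding lk_integrand_def by linarith
qed

text \<open>The constant 3 covers both regimes: the factor 1/2 from the Taylor bound for small
  \<open>y\<close>, and 2 + 2t \<le> 3 (1 + t^2) for the rest, which follows from 2t \<le> 1 +
  t^2.\<close>

lemma lk_integrand_bound:
  "cmod (lk_integrand chi \<xi> y) \<le> 3 * (1 + (norm \<xi>)\<^sup>2) * min ((norm y)\<^sup>2) 1"
proof (cases "norm y < 1")
  case True
  then have "(norm y)\<^sup>2 \<le> 1"
    by (simp add: power_le_one)
  moreover have "(norm y)\<^sup>2 * (norm \<xi>)\<^sup>2 / 2 \<le> 3 * (1 + (norm \<xi>)\<^sup>2) * (norm y)\<^sup>2"
    using zero_le_power2[of "norm y"] mult_nonneg_nonneg[OF zero_le_power2[of "norm y"] zero_le_power2[of "norm \<xi>"]]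
    by (simp add: algebra_simps)
  ultimately show ?thesis
    using lk_integrand_small[OF True, of \<xi>] by (simp add: min_def)
next
  case False
  then have "1 \<le> (norm y)\<^sup>2"
    by (simp add: one_le_power)
  moreover have "2 + 2 * t \<le> 3 * (1 + t\<^sup>2)" for t :: real
  proof -
    have "0 \<le> t\<^sup>2" "2 * t \<le> 1 + t\<^sup>2"
      using sum_squares_bound[of 1 t] by simp_all
    then have "2 * t \<le> 1 + 3 * t\<^sup>2"
      by linarith
    then show ?thesis by simp
  qed
  ultimately show ?thesis
    using order_trans[OF lk_integrand_large[of \<xi> y]] by (simp add: min_def)
qed

end

text \<open>A measure on the punctured space is encoded as a Borel measure on the whole space that
  does not charge the origin.\<close>

locale levy_measure =
  fixes N :: "'a::euclidean_space measure"
  assumes sets_N [measurable_cong, simp]: "sets N = sets borel"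
    and emeasure_N_0: "emeasure N {0} = 0"
    and levy_finite: "(\<integral>\<^sup>+ y. ennreal (min ((norm y)\<^sup>2) 1) \<partial>N) < \<infinity>"
begin

lemma space_N [simp]: "space N = UNIV"
  using sets_eq_imp_space_eq[OF sets_N] by simp

lemma integrable_min: "integrable N (\<lambda>y. min ((norm y)\<^sup>2) 1)"
  using levy_finite by (intro integrableI_bounded) auto

lemma integrable_levy:
  fixes h :: "'a \<Rightarrow> 'b::{banach,second_countable_topology}"
  assumes [measurable]: "h \<in> borel_measurable borel" and "\<And>y. norm (h y) \<le> C * min ((norm y)\<^sup>2) 1"
  shows "integrable N h"
proof (rule Bochner_Integration.integrable_bound[OF integrable_mult_right[OF integrable_min, of C]])
  have "norm (h y) \<le> norm (C * min ((norm y)\<^sup>2) 1)" for y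
    using assms(2)[of y] by simp
  then show "AE y in N. norm (h y) \<le> norm (C * min ((norm y)\<^sup>2) 1)"
    by simp
qed measurable

lemma emeasure_far_finite:
  assumes "c > 0"
  shows "emeasure N {y. c \<le> norm y} < \<infinity>"
proof -
  have "integrable N (\<lambda>y. indicator {y. c \<le> norm y} y :: real)"
  proof (rule integrable_levy[where C="max 1 (1 / c\<^sup>2)"])
    fix y :: 'a
    show "norm (indicator {y. c \<le> norm y} y :: real) \<le> max 1 (1 / c\<^sup>2) * min ((norm y)\<^sup>2) 1"
    proof (cases "c \<le> norm y")
      case True
      have "1 \<le> max 1 (1 / c\<^sup>2) * (norm y)\<^sup>2"
      proof -
        have "1 = 1 / c\<^sup>2 * c\<^sup>2" using assms by simp
        also have "\<dots> \<le> max 1 (1 / c\<^sup>2) * (norm y)\<^sup>2"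
          using assms True by (intro mult_mono power_mono) auto
        finally show ?thesis .
      qed
      then show ?thesis using True by (simp add: min_def)
    qed simp
  qed simp
  then show ?thesis
    by (simp add: integrable_indicator_iff less_top)
qed

text \<open>Needed for Fubini. Complements of balls around 0 have finite mass and exhaust the
  punctured space; the origin is added as a separate null set.\<close>

sublocale sigma_finite_measure N
proof
  let ?A = "insert {0} (range (\<lambda>n. {y. 1 / real (Suc n) \<le> norm y}))"
  have "\<exists>n. 1 / real (Suc n) \<le> norm y" if "y \<noteq> 0" for y :: 'a
    using reals_Archimedean[of "norm y"] that by (auto simp: inverse_eq_divide intro: less_imp_le)
  then have "\<Union>?A = space N"
    by (auto simp del: of_nat_Suc)
  moreover have "\<forall>a\<in>?A. emeasure N a \<noteq> \<infinity>"
    using emeasure_far_finite[of "1 / real (Suc _)"] by (auto simp: emeasure_N_0 less_top simp del: of_nat_Suc)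
  ultimately show "\<exists>A. countable A \<and> A \<subseteq> sets N \<and> \<Union>A = space N \<and> (\<forall>a\<in>A. emeasure N a \<noteq> \<infinity>)"
    by (intro exI[of _ ?A]) auto
qed

end

locale levy_truncation = truncation chi + levy_measure N
  for chi :: "'a::euclidean_space \<Rightarrow> real" and N :: "'a measure"
begin

lemma lk_integrand_measurable' [measurable]: "lk_integrand chi \<xi> \<in> borel_measurable borel"
  using lk_integrand_continuous by (rule borel_measurable_continuous_onI)

lemma integrable_lk_integrand: "integrable N (lk_integrand chi \<xi>)"
  by (rule integrable_levy[OF _ lk_integrand_bound]) measurable

lemma lk_exponent_measurable [measurable]: "lk_exponent chi \<beta> N \<in> borel_measurable borel"
  unfolding lk_exponent_def[abs_def] by measurable

text \<open>Makes averages of p(x, s \<xi>) vanish as s \<rightarrow> 0 for a fixed x; only this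
  pointwise statement is needed in the passage from the operator to the symbol.\<close>

lemma lk_exponent_continuous_at_0: "(lk_exponent chi \<beta> N \<longlongrightarrow> 0) (at 0)"
proof (rule tendsto_at_iff_sequentially[THEN iffD2], intro allI impI)
  fix X :: "nat \<Rightarrow> 'a" assume "X \<longlonglongrightarrow> 0"
  then obtain B where B: "\<And>n. norm (X n) \<le> B"
    by (meson Bseq_def convergent_imp_Bseq convergentI)
  have "(\<lambda>n. LINT y|N. lk_integrand chi (X n) y) \<longlonglongrightarrow> (LINT y|N. lk_integrand chi 0 y)"
  proof (rule integral_dominated_convergence[where w="\<lambda>y. 3 * (1 + B\<^sup>2) * min ((norm y)\<^sup>2) 1"])
    show "AE y in N. (\<lambda>n. lk_integrand chi (X n) y) \<longlonglongrightarrow> lk_integrand chi 0 y"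
      unfolding lk_integrand_def by (intro AE_I2 tendsto_intros \<open>X \<longlonglongrightarrow> 0\<close>)
    have "cmod (lk_integrand chi (X n) y) \<le> 3 * (1 + B\<^sup>2) * min ((norm y)\<^sup>2) 1" for n y
      using B[of n] by (intro order_trans[OF lk_integrand_bound] mult_mono add_mono power_mono) auto
    then show "AE y in N. cmod (lk_integrand chi (X n) y) \<le> 3 * (1 + B\<^sup>2) * min ((norm y)\<^sup>2) 1" for n
      by simp
  qed (auto intro: integrable_min)
  moreover have "(\<lambda>n. - \<i> * complex_of_real (\<beta> \<bullet> X n)) \<longlonglongrightarrow> - \<i> * complex_of_real (\<beta> \<bullet> 0)"
    by (intro tendsto_intros \<open>X \<longlonglongrightarrow> 0\<close>)
  ultimately have "(\<lambda>n. - \<i> * complex_of_real (\<beta> \<bullet> X n) + (LINT y|N. lk_integrand chi (X n) y)) \<longlonglongrightarrow> 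
      - \<i> * complex_of_real (\<beta> \<bullet> 0) + (LINT y|N. lk_integrand chi 0 y)"
    by (rule tendsto_add[rotated])
  then show "(lk_exponent chi \<beta> N \<circ> X) \<longlonglongrightarrow> 0"
    by (simp add: o_def lk_exponent_def)
qed

end

text \<open>Each condition has its task: evenness cancels terms linear in \<xi>, nonnegativity makes
  the transform largest at 0, and the weight matches the quadratic growth of the exponent.\<close>

locale even_kernel =
  fixes k :: "'a::euclidean_space \<Rightarrow> real"
  assumes k_measurable [measurable]: "k \<in> borel_measurable borel"
    and k_even: "k (- \<xi>) = k \<xi>"
    and k_nonneg: "0 \<le> k \<xi>"
    and k_integrable: "integrable lborel (\<lambda>\<xi>. (1 + (norm \<xi>)\<^sup>2) * k \<xi>)"
begin

definition transform :: "'a \<Rightarrow> complex" where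
  "transform y = (LINT \<xi>|lborel. iexp (y \<bullet> \<xi>) * k \<xi>)"

lemma integrable_kernel_mult:
  fixes h :: "'a \<Rightarrow> complex"
  assumes [measurable]: "h \<in> borel_measurable borel" and h: "\<And>\<xi>. cmod (h \<xi>) \<le> C * (1 + (norm \<xi>)\<^sup>2)"
  shows "integrable lborel (\<lambda>\<xi>. h \<xi> * k \<xi>)"
proof (rule Bochner_Integration.integrable_bound[OF integrable_mult_right[OF k_integrable, of C]])
  have "norm (h \<xi> * k \<xi>) \<le> norm (C * ((1 + (norm \<xi>)\<^sup>2) * k \<xi>))" for \<xi>
    using mult_right_mono[OF h[of \<xi>] k_nonneg[of \<xi>]] abs_ge_self[of "C * ((1 + (norm \<xi>)\<^sup>2) * k \<xi>)"]
    by (simp only: norm_mult norm_of_real real_norm_def abs_of_nonneg[OF k_nonneg] mult.assoc)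
  then show "AE \<xi> in lborel. norm (h \<xi> * k \<xi>) \<le> norm (C * ((1 + (norm \<xi>)\<^sup>2) * k \<xi>))"
    by simp
qed measurable

lemma norm_le_one_plus_square: "norm \<xi> \<le> 1 + (norm \<xi>)\<^sup>2" for \<xi> :: 'a
  using sum_squares_bound[of 1 "norm \<xi>"] norm_ge_zero[of \<xi>]
  by (simp del: norm_ge_zero)

lemma integrable_kernel_iexp: "integrable lborel (\<lambda>\<xi>. iexp (y \<bullet> \<xi>) * k \<xi>)"
  by (rule integrable_kernel_mult[where C=1]) auto

lemma integrable_kernel_inner: "integrable lborel (\<lambda>\<xi>. complex_of_real (y \<bullet> \<xi>) * k \<xi>)"
proof (rule integrable_kernel_mult[where C="norm y"])
  fix \<xi>
  show "cmod (complex_of_real (y \<bullet> \<xi>)) \<le> norm y * (1 + (norm \<xi>)\<^sup>2)"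
    using Cauchy_Schwarz_ineq2[of y \<xi>] mult_left_mono[OF norm_le_one_plus_square[of \<xi>], of "norm y"] by simp
qed simp

text \<open>An odd integrand. This cancellation removes both the drift and the compensator, neither
  of which could be controlled separately.\<close>

lemma integral_kernel_inner: "(LINT \<xi>|lborel. complex_of_real (y \<bullet> \<xi>) * k \<xi>) = 0"
  using integral_lborel_uminus[of "\<lambda>\<xi>. complex_of_real (y \<bullet> \<xi>) * k \<xi>"] by (simp add: k_even)

text \<open>The difference of the two integrands is exp(i y \<eta>) (1 - exp(i s y \<xi>)) plus a
  term linear in \<xi>, and the latter averages to 0.\<close>

lemma integral_kernel_lk_integrand:
  "(LINT \<xi>|lborel. (lk_integrand chi (\<eta> + s *\<^sub>R \<xi>) y - lk_integrand chi \<eta> y) * k \<xi>) =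
    iexp (y \<bullet> \<eta>) * (transform 0 - transform (s *\<^sub>R y))"
proof -
  have "(lk_integrand chi (\<eta> + s *\<^sub>R \<xi>) y - lk_integrand chi \<eta> y) * k \<xi> =
      iexp (y \<bullet> \<eta>) * (iexp (0 \<bullet> \<xi>) * k \<xi> - iexp ((s *\<^sub>R y) \<bullet> \<xi>) * k \<xi>) +
      \<i> * complex_of_real (s * chi y) * (complex_of_real (y \<bullet> \<xi>) * k \<xi>)" for \<xi>
    unfolding lk_integrand_def
    by (simp add: algebra_simps inner_add_right exp_add)
  then show ?thesis
    unfolding transform_def
    using integrable_kernel_iexp[of 0] integrable_kernel_iexp[of "s *\<^sub>R y"]
      integrable_kernel_inner[of y] integral_kernel_inner[of y]
    by (simp del: inner_zero_left inner_scaleR_left)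
qed

end

context levy_truncation
begin

lemma integral_kernel_lk_exponent:
  assumes "even_kernel k"
  shows "(LINT \<xi>|lborel. (lk_exponent chi \<beta> N (\<eta> + s *\<^sub>R \<xi>) - lk_exponent chi \<beta> N \<eta>) * k \<xi>) =
    (LINT y|N. iexp (y \<bullet> \<eta>) * (even_kernel.transform k 0 - even_kernel.transform k (s *\<^sub>R y)))"
proof -
  interpret even_kernel k by fact
  interpret pair_sigma_finite lborel N ..
  let ?H = "\<lambda>\<xi> y. (lk_integrand chi (\<eta> + s *\<^sub>R \<xi>) y - lk_integrand chi \<eta> y) * k \<xi>"
  \<comment> \<open>\<open>A\<close> comes from |\<eta> + s \<xi>|^2 \<le> 2 |\<eta>|^2 + 2 s^2
    |\<xi>|^2 and \<open>lk_integrand_bound\<close> at the two frequencies. The dominating function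
    \<open>w\<close> then separates into a factor in \<xi> and a factor in y.\<close>
  define A where "A = 3 * (2 + 3 * (norm \<eta>)\<^sup>2 + 2 * s\<^sup>2)"
  define w where "w = (\<lambda>(\<xi>, y). (A * ((1 + (norm \<xi>)\<^sup>2) * k \<xi>)) * min ((norm (y::'a))\<^sup>2) 1)"
  have w: "integrable (lborel \<Otimes>\<^sub>M N) w"
  proof (rule Fubini_integrable)
    show "w \<in> borel_measurable (lborel \<Otimes>\<^sub>M N)"
      unfolding w_def by measurable
    have "(LINT y|N. norm (w (\<xi>, y))) = \<bar>A\<bar> * ((1 + (norm \<xi>)\<^sup>2) * k \<xi>) * (LINT y|N. min ((norm y)\<^sup>2) 1)" for \<xi>
      by (simp add: w_def abs_mult k_nonneg min_def del: mult.assoc)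
    then show "integrable lborel (\<lambda>\<xi>. LINT y|N. norm (w (\<xi>, y)))"
      by (simp add: k_integrable del: mult.assoc)
    show "AE \<xi> in lborel. integrable N (\<lambda>y. w (\<xi>, y))"
      by (simp add: w_def integrable_min)
  qed
  have bound: "norm (?H \<xi> y) \<le> w (\<xi>, y)" for \<xi> y
  proof -
    have "(norm (\<eta> + s *\<^sub>R \<xi>))\<^sup>2 \<le> (norm \<eta> + norm (s *\<^sub>R \<xi>))\<^sup>2"
      by (intro power_mono norm_triangle_ineq) auto
    also have "\<dots> \<le> 2 * (norm \<eta>)\<^sup>2 + 2 * s\<^sup>2 * (norm \<xi>)\<^sup>2"
      using zero_le_power2[of "norm \<eta> - norm (s *\<^sub>R \<xi>)"]
      unfolding power2_diff power2_sum by (simp add: power_mult_distrib)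
    finally have "(1 + (norm (\<eta> + s *\<^sub>R \<xi>))\<^sup>2) + (1 + (norm \<eta>)\<^sup>2) \<le> 2 + 3 * (norm \<eta>)\<^sup>2 + 2 * s\<^sup>2 * (norm \<xi>)\<^sup>2"
      by simp
    also have "\<dots> \<le> (2 + 3 * (norm \<eta>)\<^sup>2 + 2 * s\<^sup>2) * (1 + (norm \<xi>)\<^sup>2)"
      by (simp add: algebra_simps)
    finally have *: "3 * (1 + (norm (\<eta> + s *\<^sub>R \<xi>))\<^sup>2) + 3 * (1 + (norm \<eta>)\<^sup>2) \<le> A * (1 + (norm \<xi>)\<^sup>2)"
      unfolding A_def by (simp add: algebra_simps)
    have "cmod (lk_integrand chi (\<eta> + s *\<^sub>R \<xi>) y - lk_integrand chi \<eta> y) \<le>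
      3 * (1 + (norm (\<eta> + s *\<^sub>R \<xi>))\<^sup>2) * min ((norm y)\<^sup>2) 1 + 3 * (1 + (norm \<eta>)\<^sup>2) * min ((norm y)\<^sup>2) 1"
      by (intro order_trans[OF norm_triangle_ineq4] add_mono lk_integrand_bound)
    also have "\<dots> \<le> A * (1 + (norm \<xi>)\<^sup>2) * min ((norm y)\<^sup>2) 1"
      using mult_right_mono[OF *, of "min ((norm y)\<^sup>2) 1"] by (simp add: distrib_right)
    finally have "cmod (lk_integrand chi (\<eta> + s *\<^sub>R \<xi>) y - lk_integrand chi \<eta> y) * k \<xi> \<le>
        A * (1 + (norm \<xi>)\<^sup>2) * min ((norm y)\<^sup>2) 1 * k \<xi>"
      by (rule mult_right_mono[OF _ k_nonneg])
    then show ?thesis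
      by (simp add: w_def norm_mult k_nonneg mult_ac)
  qed
  have H: "integrable (lborel \<Otimes>\<^sub>M N) (\<lambda>(\<xi>, y). ?H \<xi> y)"
  proof (rule Bochner_Integration.integrable_bound[OF w])
    show "AE p in lborel \<Otimes>\<^sub>M N. norm (case p of (\<xi>, y) \<Rightarrow> ?H \<xi> y) \<le> norm (w p)"
      using bound by (intro AE_I2) (auto intro: order_trans[OF _ abs_ge_self] simp del: norm_mult)
  qed measurable
  \<comment> \<open>The drift enters the difference only through \<beta> \<bullet> \<xi>, which is
    odd in \<xi>.\<close>
  have "(lk_exponent chi \<beta> N (\<eta> + s *\<^sub>R \<xi>) - lk_exponent chi \<beta> N \<eta>) * k \<xi> =
      - \<i> * complex_of_real s * (complex_of_real (\<beta> \<bullet> \<xi>) * k \<xi>) + (LINT y|N. ?H \<xi> y)" for \<xi>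
    using integrable_lk_integrand
    by (simp add: lk_exponent_def algebra_simps inner_add_right)
  then have "(LINT \<xi>|lborel. (lk_exponent chi \<beta> N (\<eta> + s *\<^sub>R \<xi>) - lk_exponent chi \<beta> N \<eta>) * k \<xi>) =
      (LINT \<xi>|lborel. LINT y|N. ?H \<xi> y)"
    using integrable_kernel_inner[of \<beta>] integral_kernel_inner[of \<beta>] integrable_fst[OF H] by simp
  also have "\<dots> = (LINT y|N. LINT \<xi>|lborel. ?H \<xi> y)"
    by (rule Fubini_integral[OF H, symmetric])
  finally show ?thesis
    by (simp add: integral_kernel_lk_integrand)
qed

end

section \<open>Gaussian averages as a gauge of large and small jumps\<close>

lemma even_kernel_std_gauss: "even_kernel std_gauss"
  by unfold_locales (auto simp: std_gauss_uminus std_gauss_nonneg integrable_std_gauss_weighted)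

lemma transform_std_gauss: "even_kernel.transform std_gauss y = exp (- (norm y)\<^sup>2 / 2)"
  by (simp add: even_kernel.transform_def[OF even_kernel_std_gauss] integral_iexp_std_gauss)

definition gauss_functional :: "'a::euclidean_space measure \<Rightarrow> real \<Rightarrow> real" where
  "gauss_functional N s = (LINT y|N. 1 - exp (- (s\<^sup>2 * (norm y)\<^sup>2 / 2)))"

lemma one_minus_exp_ge: 
  fixes t :: real
  assumes "0 \<le> t" shows "min t 1 / 2 \<le> 1 - exp (- t)"
proof -
  have "exp (- t) \<le> 1 / (1 + t)"
    using exp_ge_add_one_self[of t] assms by (simp add: exp_minus field_simps)
  moreover have "min t 1 / 2 \<le> t / (1 + t)"
    using assms by (auto simp: min_def field_simps mult_left_le)
  moreover have "t / (1 + t) = 1 - 1 / (1 + t)"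
    using assms by (simp add: field_simps)
  ultimately show ?thesis by linarith
qed

lemma one_minus_exp_le: "0 \<le> t \<Longrightarrow> 1 - exp (- t) \<le> min t (1::real)"
  using exp_ge_add_one_self[of "- t"] by (simp add: min_def)

text \<open>With \<open>gauss_integrand_le\<close> this makes the Gaussian integrand comparable to
  min(s^2 |y|^2, 1). The 4 is the source of every factor 4 and every \<open>\<epsilon> / 4\<close>
  in the tail and small-jump estimates.\<close>

lemma gauss_integrand_ge: 
  "min (s\<^sup>2 * (norm y)\<^sup>2) 1 / 4 \<le> 1 - exp (- (s\<^sup>2 * (norm y)\<^sup>2 / 2))"
proof -
  have "min u 1 / 4 \<le> min (u / 2) 1 / 2" if "u \<ge> 0" for u :: real
    using that by (simp add: min_def)
  from order_trans[OF this one_minus_exp_ge] show ?thesis by simp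
qed

lemma gauss_integrand_le: 
  "1 - exp (- (s\<^sup>2 * (norm y)\<^sup>2 / 2)) \<le> min (s\<^sup>2 * (norm y)\<^sup>2) 1"
proof -
  have "min (u / 2) 1 \<le> min u 1" if "u \<ge> 0" for u :: real
    using that by (simp add: min_def)
  from order_trans[OF one_minus_exp_le this] show ?thesis by simp
qed

lemma gauss_integrand_nonneg: "0 \<le> 1 - exp (- (s\<^sup>2 * (norm y)\<^sup>2 / 2))" for s :: real
  by simp

context levy_truncation
begin

lemma integrable_gauss: "integrable N (\<lambda>y. 1 - exp (- (s\<^sup>2 * (norm y)\<^sup>2 / 2)))"
proof (rule integrable_levy[where C="max 1 (s\<^sup>2)"])
  fix y :: 'a
  have "min (s\<^sup>2 * (norm y)\<^sup>2) 1 \<le> max 1 (s\<^sup>2) * min ((norm y)\<^sup>2) 1"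
  proof (cases "(norm y)\<^sup>2 \<le> 1")
    case True
    then show ?thesis
      by (intro min.coboundedI1) (simp add: min_def mult_right_mono)
  next
    case False
    then show ?thesis
      by (intro min.coboundedI2) (simp add: min_def)
  qed
  then show "norm (1 - exp (- (s\<^sup>2 * (norm y)\<^sup>2 / 2))) \<le> max 1 (s\<^sup>2) * min ((norm y)\<^sup>2) 1"
    using order_trans[OF gauss_integrand_le[of s y]] gauss_integrand_nonneg[of s y] by simp
qed measurable

text \<open>The averaging identity at \<eta> = 0, where the subtracted exponent vanishes. The drift
  \<beta> is arbitrary because it cancels. Read from left to right, it transfers bounds and
  continuity of p to the Levy measure.\<close>

lemma gauss_functional_eq:
  "complex_of_real (gauss_functional N s) = (LINT \<xi>|lborel. lk_exponent chi \<beta> N (s *\<^sub>R \<xi>) * std_gauss \<xi>)"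
  using integral_kernel_lk_exponent[OF even_kernel_std_gauss, of \<beta> 0 s]
  by (simp add: transform_std_gauss gauss_functional_def power_mult_distrib
      flip: integral_complex_of_real)

lemma nn_integral_gauss:
  "(\<integral>\<^sup>+ y. ennreal (1 - exp (- (s\<^sup>2 * (norm y)\<^sup>2 / 2))) \<partial>N) = ennreal (gauss_functional N s)"
  unfolding gauss_functional_def
  by (intro nn_integral_eq_integral integrable_gauss AE_I2 gauss_integrand_nonneg)

lemma integral_min_le_gauss: "(LINT y|N. min ((norm y)\<^sup>2) 1) \<le> 4 * gauss_functional N 1"
proof -
  have "(LINT y|N. min ((norm y)\<^sup>2) 1) \<le> (LINT y|N. 4 * (1 - exp (- (1\<^sup>2 * (norm y)\<^sup>2 / 2))))"
    using gauss_integrand_ge[of 1]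
    by (intro integral_mono integrable_mult_right integrable_gauss integrable_min) (simp add: field_simps)
  then show ?thesis
    by (simp only: gauss_functional_def integral_mult_right_zero)
qed

text \<open>Off the ball s |y| \<ge> 1, so the minimum in \<open>gauss_integrand_ge\<close> equals
  1.\<close>

lemma emeasure_far_le_gauss:
  assumes "s > 0" and "1 \<le> s * R"
  shows "emeasure N (- ball 0 R) \<le> ennreal (4 * gauss_functional N s)"
proof -
  have "emeasure N (- ball 0 R) = (\<integral>\<^sup>+ y. indicator (- ball 0 R) y \<partial>N)"
    by (simp add: nn_integral_indicator)
  also have "\<dots> \<le> (\<integral>\<^sup>+ y. 4 * ennreal (1 - exp (- (s\<^sup>2 * (norm y)\<^sup>2 / 2))) \<partial>N)"
  proof (rule nn_integral_mono)
    fix y :: 'a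
    show "indicator (- ball 0 R) y \<le> 4 * ennreal (1 - exp (- (s\<^sup>2 * (norm y)\<^sup>2 / 2)))"
    proof (cases "y \<in> ball 0 R")
      case False
      then have "1 \<le> s * norm y"
        using assms order_trans[OF assms(2) mult_left_mono[of R "norm y" s]] by simp
      then have "1 \<le> s\<^sup>2 * (norm y)\<^sup>2"
        using one_le_power[of "s * norm y" 2] by (simp add: power_mult_distrib)
      then have "1 \<le> 4 * (1 - exp (- (s\<^sup>2 * (norm y)\<^sup>2 / 2)))"
        using gauss_integrand_ge[of s y] by (simp add: min_def split: if_splits)
      then have "ennreal 1 \<le> ennreal (4 * (1 - exp (- (s\<^sup>2 * (norm y)\<^sup>2 / 2))))"
        by (rule ennreal_leI)
      then show ?thesis
        by (subst (asm) ennreal_mult) (auto simp: indicator_def)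
    qed simp
  qed
  also have "\<dots> = 4 * ennreal (gauss_functional N s)"
    by (simp add: nn_integral_cmult nn_integral_gauss)
  also have "\<dots> = ennreal (4 * gauss_functional N s)"
    by (subst ennreal_mult) (auto simp: gauss_functional_def)
  finally show ?thesis .
qed

text \<open>On the ball s |y| \<le> 1, so the minimum in \<open>gauss_integrand_ge\<close> equals
  s^2 |y|^2.\<close>

lemma nn_integral_near_le_gauss:
  assumes "s > 0" and "s * r \<le> 1"
  shows "(\<integral>\<^sup>+ y. ennreal ((norm y)\<^sup>2) * indicator (cball 0 r) y \<partial>N) \<le> ennreal (4 * (gauss_functional N s / s\<^sup>2))"
proof -
  have "(\<integral>\<^sup>+ y. ennreal ((norm y)\<^sup>2) * indicator (cball 0 r) y \<partial>N) \<le>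
      (\<integral>\<^sup>+ y. ennreal (4 / s\<^sup>2) * ennreal (1 - exp (- (s\<^sup>2 * (norm y)\<^sup>2 / 2))) \<partial>N)"
  proof (rule nn_integral_mono)
    fix y :: 'a
    show "ennreal ((norm y)\<^sup>2) * indicator (cball 0 r) y \<le> 
        ennreal (4 / s\<^sup>2) * ennreal (1 - exp (- (s\<^sup>2 * (norm y)\<^sup>2 / 2)))"
    proof (cases "y \<in> cball 0 r")
      case True
      then have "s * norm y \<le> 1"
        using assms order_trans[OF mult_left_mono[of "norm y" r s] assms(2)] by simp
      then have "s\<^sup>2 * (norm y)\<^sup>2 \<le> 1"
        using power_le_one[of "s * norm y" 2] assms by (simp add: power_mult_distrib)
      then have "s\<^sup>2 * (norm y)\<^sup>2 \<le> 4 * (1 - exp (- (s\<^sup>2 * (norm y)\<^sup>2 / 2)))"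
        using gauss_integrand_ge[of s y] by (simp add: min_def split: if_splits)
      then have "(norm y)\<^sup>2 \<le> 4 / s\<^sup>2 * (1 - exp (- (s\<^sup>2 * (norm y)\<^sup>2 / 2)))"
        using assms by (simp add: field_simps)
      then have "ennreal ((norm y)\<^sup>2) \<le> ennreal (4 / s\<^sup>2 * (1 - exp (- (s\<^sup>2 * (norm y)\<^sup>2 / 2))))"
        by (rule ennreal_leI)
      then show ?thesis
        using True by (subst (asm) ennreal_mult) auto
    qed simp
  qed
  also have "\<dots> = ennreal (4 / s\<^sup>2) * ennreal (gauss_functional N s)"
    by (simp add: nn_integral_cmult nn_integral_gauss)
  also have "\<dots> = ennreal (4 * (gauss_functional N s / s\<^sup>2))"
    by (subst ennreal_mult[symmetric]) (auto simp: gauss_functional_def)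
  finally show ?thesis .
qed

lemma gauss_functional_mono: "\<bar>s\<bar> \<le> \<bar>t\<bar> \<Longrightarrow> gauss_functional N s \<le> gauss_functional N t"
  unfolding gauss_functional_def
  by (intro integral_mono integrable_gauss) (auto simp: abs_le_square_iff mult_right_mono)

text \<open>Doubling \<open>s\<close> raises z = exp(- s^2 |y|^2 / 2) to the fourth power, and 1 -
  z^4 \<le> 4 (1 - z) on [0, 1]. Hence G(s) / s^2 decreases along powers of 2, the monotonicity that
  Dini's theorem requires.\<close>

lemma gauss_functional_double: "gauss_functional N (2 * s) \<le> 4 * gauss_functional N s"
proof -
  have "1 - exp (- ((2 * s)\<^sup>2 * (norm y)\<^sup>2 / 2)) \<le> 4 * (1 - exp (- (s\<^sup>2 * (norm y)\<^sup>2 / 2)))" for y :: 'a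
  proof -
    define z where "z = exp (- (s\<^sup>2 * (norm y)\<^sup>2 / 2))"
    have z: "0 \<le> z" "z \<le> 1" by (auto simp: z_def)
    have "exp (- ((2 * s)\<^sup>2 * (norm y)\<^sup>2 / 2)) = z ^ 4"
      unfolding z_def by (simp flip: exp_of_nat_mult add: power_mult_distrib)
    moreover have "1 - z ^ 4 = (1 - z) * (1 + z + z\<^sup>2 + z ^ 3)"
      by (simp add: algebra_simps power_numeral_reduce)
    moreover have "\<dots> \<le> (1 - z) * (1 + 1 + 1 + 1)"
      using z by (intro mult_left_mono add_mono power_le_one) auto
    ultimately show ?thesis
      by (simp add: z_def)
  qed
  then have "gauss_functional N (2 * s) \<le> (LINT y|N. 4 * (1 - exp (- (s\<^sup>2 * (norm y)\<^sup>2 / 2))))"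
    unfolding gauss_functional_def
    by (intro integral_mono integrable_gauss integrable_mult_right)
  then show ?thesis
    by (simp only: gauss_functional_def integral_mult_right_zero)
qed

lemma gauss_functional_tendsto_0: "(\<lambda>n. gauss_functional N (1 / 2 ^ n)) \<longlonglongrightarrow> 0"
proof -
  have "(\<lambda>n. LINT y|N. 1 - exp (- ((1 / 2 ^ n)\<^sup>2 * (norm y)\<^sup>2 / 2))) \<longlonglongrightarrow> (LINT y|N. 0)"
  proof (rule integral_dominated_convergence[where w="\<lambda>y. min ((norm y)\<^sup>2) 1"])
    have "(\<lambda>n. 1 - exp (- ((1 / 2 ^ n)\<^sup>2 * (norm y)\<^sup>2 / 2))) \<longlonglongrightarrow> 1 - exp (- (0\<^sup>2 * (norm y)\<^sup>2 / 2))" for y :: 'a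
      by (intro tendsto_intros LIMSEQ_divide_realpow_zero) auto
    then show "AE y in N. (\<lambda>n. 1 - exp (- ((1 / 2 ^ n)\<^sup>2 * (norm y)\<^sup>2 / 2))) \<longlonglongrightarrow> 0"
      by simp
    fix n :: nat
    have "norm (1 - exp (- ((1 / 2 ^ n)\<^sup>2 * (norm y)\<^sup>2 / 2))) \<le> min ((norm y)\<^sup>2) 1" for y :: 'a
    proof -
      have "(1 / 2 ^ n :: real)\<^sup>2 \<le> 1"
        by (intro power_le_one) auto
      then have "(1 / 2 ^ n)\<^sup>2 * (norm y)\<^sup>2 \<le> (norm y)\<^sup>2"
        using mult_right_mono[of "(1 / 2 ^ n :: real)\<^sup>2" 1 "(norm y)\<^sup>2"] by simp
      then show ?thesis
        using gauss_integrand_le[of "1 / 2 ^ n" y] gauss_integrand_nonneg[of "1 / 2 ^ n" y] by simp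
    qed
    then show "AE y in N. norm (1 - exp (- ((1 / 2 ^ n)\<^sup>2 * (norm y)\<^sup>2 / 2))) \<le> min ((norm y)\<^sup>2) 1"
      by simp
  qed (auto intro: integrable_min)
  then show ?thesis
    by (simp add: gauss_functional_def)
qed

text \<open>The limit vanishes because the exponent has no Gaussian part.\<close>

lemma gauss_functional_scaled_tendsto_0: "(\<lambda>n. gauss_functional N (2 ^ n) / (2 ^ n)\<^sup>2) \<longlonglongrightarrow> 0"
proof -
  have "(\<lambda>n. LINT y|N. (1 - exp (- ((2 ^ n)\<^sup>2 * (norm y)\<^sup>2 / 2))) / (2 ^ n)\<^sup>2) \<longlonglongrightarrow> (LINT y|N. 0)"
  proof (rule integral_dominated_convergence[where w="\<lambda>y. min ((norm y)\<^sup>2) 1"])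
    have lim: "(\<lambda>n. 1 / (2 ^ n)\<^sup>2 :: real) \<longlonglongrightarrow> 0"
      using LIMSEQ_divide_realpow_zero[of 4 1] by (simp add: power2_eq_square flip: power_mult_distrib)
    have "(\<lambda>n. (1 - exp (- ((2 ^ n)\<^sup>2 * (norm y)\<^sup>2 / 2))) / (2 ^ n)\<^sup>2) \<longlonglongrightarrow> 0" for y :: 'a
    proof (rule tendsto_sandwich[OF _ _ tendsto_const lim])
      show "\<forall>\<^sub>F n in sequentially. 0 \<le> (1 - exp (- ((2 ^ n)\<^sup>2 * (norm y)\<^sup>2 / 2))) / (2 ^ n)\<^sup>2"
        by (auto intro!: always_eventually divide_nonneg_nonneg)
      show "\<forall>\<^sub>F n in sequentially. (1 - exp (- ((2 ^ n)\<^sup>2 * (norm y)\<^sup>2 / 2))) / (2 ^ n)\<^sup>2 \<le> 1 / (2 ^ n)\<^sup>2"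
        by (auto intro!: always_eventually divide_right_mono)
    qed
    then show "AE y in N. (\<lambda>n. (1 - exp (- ((2 ^ n)\<^sup>2 * (norm y)\<^sup>2 / 2))) / (2 ^ n)\<^sup>2) \<longlonglongrightarrow> 0"
      by simp
    fix n :: nat
    have "norm ((1 - exp (- ((2 ^ n)\<^sup>2 * (norm y)\<^sup>2 / 2))) / (2 ^ n)\<^sup>2) \<le> min ((norm y)\<^sup>2) 1" for y :: 'a
    proof -
      have "1 \<le> (2 ^ n :: real)\<^sup>2"
        by (intro one_le_power) auto
      moreover have "1 - exp (- ((2 ^ n)\<^sup>2 * (norm y)\<^sup>2 / 2)) \<le> (2 ^ n)\<^sup>2 * (norm y)\<^sup>2"
        "1 - exp (- ((2 ^ n)\<^sup>2 * (norm y)\<^sup>2 / 2)) \<le> 1"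
        using gauss_integrand_le[of "2 ^ n" y] by auto
      ultimately have "1 - exp (- ((2 ^ n)\<^sup>2 * (norm y)\<^sup>2 / 2)) \<le> (norm y)\<^sup>2 * (2 ^ n)\<^sup>2"
        "1 - exp (- ((2 ^ n)\<^sup>2 * (norm y)\<^sup>2 / 2)) \<le> (2 ^ n)\<^sup>2"
        by (simp_all only: mult.commute order_trans)
      then show ?thesis
        using gauss_integrand_nonneg[of "2 ^ n" y] by (simp add: divide_le_eq)
    qed
    then show "AE y in N. norm ((1 - exp (- ((2 ^ n)\<^sup>2 * (norm y)\<^sup>2 / 2))) / (2 ^ n)\<^sup>2) \<le> min ((norm y)\<^sup>2) 1"
      by simp
  qed (auto intro: integrable_min)
  then show ?thesis
    by (simp add: gauss_functional_def)
qed

end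

section \<open>Locally bounded families\<close>

text \<open>The non-strict bound is preserved by suprema, so limits of \<open>SUP x\<in>K\<close>
  can be proved and used pointwise in \<open>x\<close>.\<close>

lemma tendsto_0_ennreal_iff:
  fixes f :: "'a \<Rightarrow> ennreal"
  shows "(f \<longlongrightarrow> 0) F \<longleftrightarrow> (\<forall>\<epsilon>>0. \<forall>\<^sub>F x in F. f x \<le> ennreal \<epsilon>)"
proof
  assume "(f \<longlongrightarrow> 0) F"
  then show "\<forall>\<epsilon>>0. \<forall>\<^sub>F x in F. f x \<le> ennreal \<epsilon>"
    by (auto dest!: order_tendstoD(2)[of _ _ _ "ennreal _"] elim: eventually_mono)
next
  assume *: "\<forall>\<epsilon>>0. \<forall>\<^sub>F x in F. f x \<le> ennreal \<epsilon>"
  show "(f \<longlongrightarrow> 0) F"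
  proof (rule order_tendstoI)
    fix a :: ennreal assume "0 < a"
    then obtain y where y: "0 < y" "y < a" using dense by blast
    then obtain r where r: "y = ennreal r" "r > 0" by (cases y) auto
    show "\<forall>\<^sub>F x in F. f x < a"
      using *[rule_format, OF r(2)] by eventually_elim (use y r in auto)
  qed simp
qed

text \<open>If \<open>f\<close> is not integrable its integral is 0 by convention, so a bound by an
  integrable \<open>g\<close> suffices.\<close>

lemma norm_integral_le:
  fixes f :: "'a \<Rightarrow> 'b::{banach,second_countable_topology}"
  assumes "integrable M g" and "\<And>x. norm (f x) \<le> g x"
  shows "norm (integral\<^sup>L M f) \<le> integral\<^sup>L M g"
  using integral_norm_bound[of M f] integral_mono'[OF assms(1), of "\<lambda>x. norm (f x)"] assms(2)
    order_trans[OF norm_ge_zero assms(2)]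
  by (meson order_trans)

text \<open>Otherwise the superlevel sets at height \<epsilon> are nonempty, compact and nested; at
  a common point the limit could not be 0.\<close>

lemma Dini_0:
  fixes f :: "nat \<Rightarrow> 'a::heine_borel \<Rightarrow> real"
  assumes K: "compact K" and cont: "\<And>n. continuous_on K (f n)"
    and dec: "\<And>n x. x \<in> K \<Longrightarrow> f (Suc n) x \<le> f n x"
    and lim: "\<And>x. x \<in> K \<Longrightarrow> (\<lambda>n. f n x) \<longlonglongrightarrow> 0" and "\<epsilon> > 0"
  shows "\<exists>n. \<forall>x\<in>K. f n x < \<epsilon>"
proof (rule ccontr)
  assume "\<not> ?thesis"
  then have ne: "{x \<in> K. \<epsilon> \<le> f n x} \<noteq> {}" for n
    by (auto simp: not_less)
  have c: "compact {x \<in> K. \<epsilon> \<le> f n x}" for n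
  proof -
    have "closedin (top_of_set K) {x \<in> K. f n x \<in> {\<epsilon>..}}"
      by (rule continuous_closedin_preimage[OF cont, unfolded vimage_def Int_def, simplified]) auto
    then show ?thesis
      using closedin_compact[OF K] by simp
  qed
  have mono: "f n x \<le> f m x" if "m \<le> n" "x \<in> K" for m n x
    using that(1) by (rule lift_Suc_antimono_le[of "\<lambda>n. f n x", rotated]) (rule dec[OF that(2)])
  have "\<Inter>(range (\<lambda>n. {x \<in> K. \<epsilon> \<le> f n x})) \<noteq> {}"
    by (rule compact_nest[OF c ne]) (use mono order_trans in blast)
  then obtain x where x: "x \<in> K" "\<And>n. \<epsilon> \<le> f n x" by auto
  then show False
    using LIMSEQ_le_const[OF lim[OF x(1)], of \<epsilon>] \<open>\<epsilon> > 0\<close> by auto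
qed

locale levy_family = truncation chi for chi :: "'a::euclidean_space \<Rightarrow> real" +
  fixes b :: "'a \<Rightarrow> 'a" and \<nu> :: "'a \<Rightarrow> 'a measure"
  assumes levy: "levy_measure (\<nu> x)"
    and locally_bounded: "compact K \<Longrightarrow>
      \<exists>c>0. \<forall>x\<in>K. \<forall>\<xi>. cmod (lk_exponent chi (b x) (\<nu> x) \<xi>) \<le> c * (1 + (norm \<xi>)\<^sup>2)"
begin

abbreviation p :: "'a \<Rightarrow> 'a \<Rightarrow> complex" where
  "p x \<equiv> lk_exponent chi (b x) (\<nu> x)"

lemma levy_truncation_nu: "levy_truncation chi (\<nu> x)"
  using levy truncation_axioms by (simp add: levy_truncation_def)

lemma p_measurable [measurable]: "p x \<in> borel_measurable borel"
  by (rule levy_truncation.lk_exponent_measurable[OF levy_truncation_nu])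

lemma affine_weight_le:
  fixes \<eta> \<xi> :: 'a
  shows "1 + (norm (\<eta> + s *\<^sub>R \<xi>))\<^sup>2 \<le> (1 + 2 * (norm \<eta>)\<^sup>2 + 2 * s\<^sup>2) * (1 + (norm \<xi>)\<^sup>2)"
proof -
  have "(norm (\<eta> + s *\<^sub>R \<xi>))\<^sup>2 \<le> (norm \<eta> + norm (s *\<^sub>R \<xi>))\<^sup>2"
    by (intro power_mono norm_triangle_ineq) auto
  also have "\<dots> \<le> 2 * (norm \<eta>)\<^sup>2 + 2 * s\<^sup>2 * (norm \<xi>)\<^sup>2"
    using zero_le_power2[of "norm \<eta> - norm (s *\<^sub>R \<xi>)"]
    unfolding power2_diff power2_sum by (simp add: power_mult_distrib)
  also have "1 + \<dots> \<le> (1 + 2 * (norm \<eta>)\<^sup>2 + 2 * s\<^sup>2) * (1 + (norm \<xi>)\<^sup>2)"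
    by (simp add: algebra_simps)
  finally show ?thesis by simp
qed

lemma p_affine_bound:
  assumes "compact K"
  obtains c where "c > 0" "\<And>x \<xi>. x \<in> K \<Longrightarrow> cmod (p x (\<eta> + s *\<^sub>R \<xi>)) \<le> c * (1 + (norm \<xi>)\<^sup>2)"
proof -
  obtain c where c: "c > 0" "\<And>x \<xi>. x \<in> K \<Longrightarrow> cmod (p x \<xi>) \<le> c * (1 + (norm \<xi>)\<^sup>2)"
    using locally_bounded[OF assms] by blast
  let ?A = "1 + 2 * (norm \<eta>)\<^sup>2 + 2 * s\<^sup>2"
  have "cmod (p x (\<eta> + s *\<^sub>R \<xi>)) \<le> c * ?A * (1 + (norm \<xi>)\<^sup>2)" if "x \<in> K" for x \<xi>
    using order_trans[OF c(2)[OF that, of "\<eta> + s *\<^sub>R \<xi>"] mult_left_mono[OF affine_weight_le[of \<eta> s \<xi>], of c]] c(1)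
    by (simp add: mult.assoc)
  moreover have "c * ?A > 0"
    using c(1) by (intro mult_pos_pos add_pos_nonneg) auto
  ultimately show thesis
    using that by blast
qed

text \<open>The sequence with its limit is compact, so one quadratic bound serves all
  \<open>p (X n)\<close>. The limit \<open>L\<close> is left general in order to cover the case
  where \<open>g n\<close> tends to 0 while convergence of \<open>p (X n)\<close> is still
  unknown.\<close>

lemma integral_p_dominated_convergence:
  assumes X: "X \<longlonglongrightarrow> x"
    and lim: "\<And>\<xi>. (\<lambda>n. p (X n) (\<eta> + s *\<^sub>R \<xi>) * g n \<xi>) \<longlonglongrightarrow> L \<xi>"
    and [measurable]: "\<And>n. g n \<in> borel_measurable borel" "L \<in> borel_measurable borel"
    and w: "integrable lborel (\<lambda>\<xi>. (1 + (norm \<xi>)\<^sup>2) * w \<xi>)" and gw: "\<And>n \<xi>. cmod (g n \<xi>) \<le> w \<xi>"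
  shows "(\<lambda>n. LINT \<xi>|lborel. p (X n) (\<eta> + s *\<^sub>R \<xi>) * g n \<xi>) \<longlonglongrightarrow> (LINT \<xi>|lborel. L \<xi>)"
proof -
  obtain c where c: "c > 0" "\<And>y \<xi>. y \<in> insert x (range X) \<Longrightarrow> cmod (p y (\<eta> + s *\<^sub>R \<xi>)) \<le> c * (1 + (norm \<xi>)\<^sup>2)"
    using p_affine_bound[OF compact_sequence_with_limit[OF X]] by metis
  show ?thesis
  proof (rule integral_dominated_convergence[where w="\<lambda>\<xi>. c * ((1 + (norm \<xi>)\<^sup>2) * w \<xi>)"])
    show "AE \<xi> in lborel. (\<lambda>n. p (X n) (\<eta> + s *\<^sub>R \<xi>) * g n \<xi>) \<longlonglongrightarrow> L \<xi>"
      by (intro AE_I2 lim)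
    have "cmod (p (X n) (\<eta> + s *\<^sub>R \<xi>) * g n \<xi>) \<le> c * (1 + (norm \<xi>)\<^sup>2) * w \<xi>" for n \<xi>
      unfolding norm_mult using c(1) by (intro mult_mono c(2) gw) auto
    then show "AE \<xi> in lborel. cmod (p (X n) (\<eta> + s *\<^sub>R \<xi>) * g n \<xi>) \<le> c * ((1 + (norm \<xi>)\<^sup>2) * w \<xi>)" for n
      by (simp add: mult.assoc)
  qed (use w in auto)
qed

lemma integral_p_tendsto:
  assumes "X \<longlonglongrightarrow> x"
    and p: "\<And>\<xi>. (\<lambda>n. p (X n) \<xi>) \<longlonglongrightarrow> p x \<xi>"
    and g: "\<And>\<xi>. (\<lambda>n. g n \<xi>) \<longlonglongrightarrow> g' \<xi>"
    and [measurable]: "\<And>n. g n \<in> borel_measurable borel" "g' \<in> borel_measurable borel"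
    and "integrable lborel (\<lambda>\<xi>. (1 + (norm \<xi>)\<^sup>2) * w \<xi>)" and "\<And>n \<xi>. cmod (g n \<xi>) \<le> w \<xi>"
  shows "(\<lambda>n. LINT \<xi>|lborel. p (X n) (\<eta> + s *\<^sub>R \<xi>) * g n \<xi>) \<longlonglongrightarrow> (LINT \<xi>|lborel. p x (\<eta> + s *\<^sub>R \<xi>) * g' \<xi>)"
  by (rule integral_p_dominated_convergence[OF assms(1) tendsto_mult[OF p g] assms(4) _ assms(6,7)]) measurable

text \<open>The integral is at most 4 G(1, x), and G(1, x) is a Gaussian average of p, hence bounded
  by the local growth constant.\<close>

lemma uniform_levy_bound:
  assumes "compact K"
  obtains M where "M > 0" "\<And>x. x \<in> K \<Longrightarrow> (LINT y|\<nu> x. min ((norm y)\<^sup>2) 1) \<le> M"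
proof -
  obtain c where c: "c > 0" "\<And>x \<xi>. x \<in> K \<Longrightarrow> cmod (p x \<xi>) \<le> c * (1 + (norm \<xi>)\<^sup>2)"
    using locally_bounded[OF assms] by blast
  let ?I = "LINT \<xi>|lborel. (1 + (norm (\<xi>::'a))\<^sup>2) * std_gauss \<xi>"
  have "(LINT y|\<nu> x. min ((norm y)\<^sup>2) 1) \<le> 4 * (c * ?I)" if "x \<in> K" for x
  proof -
    interpret levy_truncation chi "\<nu> x" by (rule levy_truncation_nu)
    have "cmod (complex_of_real (gauss_functional (\<nu> x) 1)) \<le> (LINT \<xi>|lborel. c * ((1 + (norm (\<xi>::'a))\<^sup>2) * std_gauss \<xi>))"
      unfolding gauss_functional_eq[where \<beta>="b x"]
    proof (rule norm_integral_le)
      fix \<xi> :: 'a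
      show "cmod (p x (1 *\<^sub>R \<xi>) * complex_of_real (std_gauss \<xi>)) \<le> c * ((1 + (norm \<xi>)\<^sup>2) * std_gauss \<xi>)"
        using mult_right_mono[OF c(2)[OF that, of \<xi>] std_gauss_nonneg[of \<xi>]]
        by (simp add: norm_mult std_gauss_nonneg mult.assoc)
    qed (intro integrable_mult_right integrable_std_gauss_weighted)
    then show ?thesis
      using integral_min_le_gauss by simp
  qed
  then show thesis
    by (intro that[of "max 1 (4 * (c * ?I))"]) (auto intro: max.coboundedI2)
qed

lemma gauss_functional_continuous:
  assumes "\<And>\<xi>. continuous_on UNIV (\<lambda>x. p x \<xi>)"
  shows "continuous_on UNIV (\<lambda>x. gauss_functional (\<nu> x) s)"
proof (clarsimp simp: continuous_on_sequentially)
  fix X :: "nat \<Rightarrow> 'a" and x assume X: "X \<longlonglongrightarrow> x"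
  have "(\<lambda>n. LINT \<xi>|lborel. p (X n) (0 + s *\<^sub>R \<xi>) * std_gauss \<xi>) \<longlonglongrightarrow> (LINT \<xi>|lborel. p x (0 + s *\<^sub>R \<xi>) * std_gauss \<xi>)"
  proof (rule integral_p_tendsto[where w=std_gauss, OF X])
    show "(\<lambda>n. p (X n) \<xi>) \<longlonglongrightarrow> p x \<xi>" for \<xi>
      using assms[of \<xi>] X by (auto simp: continuous_on_sequentially o_def)
  qed (auto simp: integrable_std_gauss_weighted std_gauss_nonneg)
  then have "(\<lambda>n. complex_of_real (gauss_functional (\<nu> (X n)) s)) \<longlonglongrightarrow> complex_of_real (gauss_functional (\<nu> x) s)"
    using levy_truncation.gauss_functional_eq[OF levy_truncation_nu, of _ s "b _"] by simp
  then show "((\<lambda>x. gauss_functional (\<nu> x) s) \<circ> X) \<longlonglongrightarrow> gauss_functional (\<nu> x) s"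
    by (simp add: o_def tendsto_of_real_iff)
qed

text \<open>Dini's theorem for the scales 1 / 2^n; a radius R \<ge> 2^n then satisfies the
  requirement 1 \<le> s R of \<open>emeasure_far_le_gauss\<close>.\<close>

lemma continuous_imp_tight:
  assumes cont: "\<And>\<xi>. continuous_on UNIV (\<lambda>x. p x \<xi>)" and K: "compact K"
  shows "((\<lambda>R. SUP x\<in>K. emeasure (\<nu> x) (- ball 0 R)) \<longlongrightarrow> 0) at_top"
  unfolding tendsto_0_ennreal_iff
proof (intro allI impI)
  fix \<epsilon> :: real assume "\<epsilon> > 0"
  have "\<exists>n. \<forall>x\<in>K. gauss_functional (\<nu> x) (1 / 2 ^ n) < \<epsilon> / 4"
  proof (rule Dini_0[OF K])
    show "continuous_on K (\<lambda>x. gauss_functional (\<nu> x) (1 / 2 ^ n))" for n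
      using gauss_functional_continuous[OF cont] continuous_on_subset by blast
    show "gauss_functional (\<nu> x) (1 / 2 ^ Suc n) \<le> gauss_functional (\<nu> x) (1 / 2 ^ n)" for n x
      by (rule levy_truncation.gauss_functional_mono[OF levy_truncation_nu]) (simp add: field_simps)
    show "(\<lambda>n. gauss_functional (\<nu> x) (1 / 2 ^ n)) \<longlonglongrightarrow> 0" for x
      by (rule levy_truncation.gauss_functional_tendsto_0[OF levy_truncation_nu])
  qed (use \<open>\<epsilon> > 0\<close> in simp)
  then obtain n where n: "\<And>x. x \<in> K \<Longrightarrow> gauss_functional (\<nu> x) (1 / 2 ^ n) < \<epsilon> / 4" by blast
  have "emeasure (\<nu> x) (- ball 0 R) \<le> ennreal \<epsilon>" if "x \<in> K" "R \<ge> 2 ^ n" for x R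
  proof -
    have "emeasure (\<nu> x) (- ball 0 R) \<le> ennreal (4 * gauss_functional (\<nu> x) (1 / 2 ^ n))"
      by (rule levy_truncation.emeasure_far_le_gauss[OF levy_truncation_nu]) (use that in \<open>auto simp: field_simps\<close>)
    also have "\<dots> \<le> ennreal \<epsilon>"
      using n[OF that(1)] by (intro ennreal_leI) linarith
    finally show ?thesis .
  qed
  then show "\<forall>\<^sub>F R in at_top. (SUP x\<in>K. emeasure (\<nu> x) (- ball 0 R)) \<le> ennreal \<epsilon>"
    unfolding eventually_at_top_linorder by (auto intro!: exI[of _ "2 ^ n"] SUP_least)
qed

text \<open>Dini's theorem for the quotients G(2^n, x) / 4^n, which decrease by
  \<open>gauss_functional_double\<close>; r < 1 / 2^n gives the requirement s r \<le> 1 of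
  \<open>nn_integral_near_le_gauss\<close>.\<close>

lemma continuous_imp_no_gaussian_limit:
  assumes cont: "\<And>\<xi>. continuous_on UNIV (\<lambda>x. p x \<xi>)" and K: "compact K"
  shows "((\<lambda>r. SUP x\<in>K. \<integral>\<^sup>+ y. ennreal ((norm y)\<^sup>2) * indicator (cball 0 r) y \<partial>\<nu> x) \<longlongrightarrow> 0) (at_right 0)"
  unfolding tendsto_0_ennreal_iff
proof (intro allI impI)
  fix \<epsilon> :: real assume "\<epsilon> > 0"
  have "\<exists>n. \<forall>x\<in>K. gauss_functional (\<nu> x) (2 ^ n) / (2 ^ n)\<^sup>2 < \<epsilon> / 4"
  proof (rule Dini_0[OF K])
    show "continuous_on K (\<lambda>x. gauss_functional (\<nu> x) (2 ^ n) / (2 ^ n)\<^sup>2)" for n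
      by (intro continuous_on_divide continuous_on_const continuous_on_subset[OF gauss_functional_continuous[OF cont]]) auto
    show "gauss_functional (\<nu> x) (2 ^ Suc n) / (2 ^ Suc n)\<^sup>2 \<le> gauss_functional (\<nu> x) (2 ^ n) / (2 ^ n)\<^sup>2" for n x
      using levy_truncation.gauss_functional_double[OF levy_truncation_nu, of x "2 ^ n"] by (simp add: field_simps)
    show "(\<lambda>n. gauss_functional (\<nu> x) (2 ^ n) / (2 ^ n)\<^sup>2) \<longlonglongrightarrow> 0" for x
      by (rule levy_truncation.gauss_functional_scaled_tendsto_0[OF levy_truncation_nu])
  qed (use \<open>\<epsilon> > 0\<close> in simp)
  then obtain n where n: "\<And>x. x \<in> K \<Longrightarrow> gauss_functional (\<nu> x) (2 ^ n) / (2 ^ n)\<^sup>2 < \<epsilon> / 4" by blast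
  have "(\<integral>\<^sup>+ y. ennreal ((norm y)\<^sup>2) * indicator (cball 0 r) y \<partial>\<nu> x) \<le> ennreal \<epsilon>"
    if "x \<in> K" "r < 1 / 2 ^ n" for x r
  proof -
    have "(\<integral>\<^sup>+ y. ennreal ((norm y)\<^sup>2) * indicator (cball 0 r) y \<partial>\<nu> x) \<le>
        ennreal (4 * (gauss_functional (\<nu> x) (2 ^ n) / (2 ^ n)\<^sup>2))"
      by (rule levy_truncation.nn_integral_near_le_gauss[OF levy_truncation_nu]) (use that in \<open>auto simp: field_simps\<close>)
    also have "\<dots> \<le> ennreal \<epsilon>"
      using n[OF that(1)] by (intro ennreal_leI) linarith
    finally show ?thesis .
  qed
  then show "\<forall>\<^sub>F r in at_right 0. (SUP x\<in>K. \<integral>\<^sup>+ y. ennreal ((norm y)\<^sup>2) * indicator (cball 0 r) y \<partial>\<nu> x) \<le> ennreal \<epsilon>"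
    unfolding eventually_at_right_field by (intro exI[of _ "1 / 2 ^ n"]) (auto intro!: SUP_least)
qed

end

section \<open>Vague convergence\<close>

lemma compact_support_uniformly_continuous:
  fixes F :: "'a::euclidean_space \<Rightarrow> 'b::real_normed_vector"
  assumes cont: "continuous_on UNIV F" and "compact_support F"
  shows "uniformly_continuous_on UNIV F"
proof -
  obtain K where K: "compact K" "\<And>x. x \<notin> K \<Longrightarrow> F x = 0"
    using assms unfolding compact_support_def by metis
  obtain R where R: "\<And>x. x \<in> K \<Longrightarrow> norm x \<le> R"
    using compact_imp_bounded[OF K(1)] unfolding bounded_iff by blast
  have F0: "F x = 0" if "norm x > R" for x
    using K(2)[of x] R[of x] that by fastforce
  have uc: "uniformly_continuous_on (cball 0 (R + 1)) F"
    using compact_uniformly_continuous[OF continuous_on_subset[OF cont]] by auto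
  show ?thesis
  proof (unfold uniformly_continuous_on_def, intro allI impI)
    fix e :: real assume "0 < e"
    then obtain d where d: "d > 0" 
      "\<And>x x'. x \<in> cball 0 (R + 1) \<Longrightarrow> x' \<in> cball 0 (R + 1) \<Longrightarrow> dist x' x < d \<Longrightarrow> dist (F x') (F x) < e"
      using uc unfolding uniformly_continuous_on_def by metis
    \<comment> \<open>Points closer than 1 either both lie in the ball of radius R + 1, or both lie
      where \<open>F\<close> vanishes.\<close>
    have "dist (F x') (F x) < e" if "dist x' x < min d 1" for x x'
    proof (cases "norm x \<le> R + 1 \<and> norm x' \<le> R + 1")
      case True
      then show ?thesis using d(2)[of x x'] that by simp
    next
      case False
      have "norm x \<le> norm x' + dist x' x" "norm x' \<le> norm x + dist x' x"
        using norm_triangle_sub[of x x'] norm_triangle_sub[of x' x] by (auto simp: dist_norm norm_minus_commute)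
      then have "norm x > R" "norm x' > R"
        using False that by auto
      then show ?thesis
        using F0 \<open>0 < e\<close> by simp
    qed
    then show "\<exists>d>0. \<forall>x\<in>UNIV. \<forall>x'\<in>UNIV. dist x' x < d \<longrightarrow> dist (F x') (F x) < e"
      using d(1) by (intro exI[of _ "min d 1"]) auto
  qed
qed

lemma integrable_std_gauss: "integrable lborel (std_gauss :: 'a::euclidean_space \<Rightarrow> real)"
  by (rule Bochner_Integration.integrable_bound[OF integrable_std_gauss_weighted])
    (auto simp: std_gauss_nonneg mult_left_le_one_le abs_mult distrib_right)

lemma integral_std_gauss: "(LINT u|lborel. std_gauss (u :: 'a::euclidean_space)) = 1"
proof -
  have "complex_of_real (LINT u|lborel. std_gauss (u :: 'a)) = 1"
    using integral_iexp_std_gauss[of "0::'a"] by simp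
  then show ?thesis
    by (simp only: of_real_eq_1_iff)
qed

text \<open>The approximant is the convolution with a narrow Gaussian, whose own Fourier
  representation yields the one of the convolution.\<close>

lemma compact_support_approx_fourier:
  fixes F :: "'a::euclidean_space \<Rightarrow> complex"
  assumes cont: "continuous_on UNIV F" and supp: "compact_support F" and "\<delta> > 0"
  obtains s w where "integrable lborel w"
    and "\<And>y. cmod (F y - (LINT \<zeta>|lborel. iexp (s * (y \<bullet> \<zeta>)) * w \<zeta>)) \<le> \<delta>"
proof -
  obtain B where B: "B > 0" "\<And>x. cmod (F x) \<le> B"
    using compact_support_bounded[OF cont supp] by blast
  have [measurable]: "F \<in> borel_measurable borel"
    using cont by (rule borel_measurable_continuous_onI)
  have intF: "integrable lborel F"
    by (rule integrable_compact_support[OF cont supp])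
  obtain d where d: "d > 0" "\<And>x x'. norm (x' - x) < d \<Longrightarrow> cmod (F x' - F x) < \<delta> / 2"
    using compact_support_uniformly_continuous[OF cont supp] \<open>\<delta> > 0\<close>
    unfolding uniformly_continuous_on_def dist_norm by (metis UNIV_I half_gt_zero)
  define m where "m = (LINT u|lborel. (1 + (norm (u::'a))\<^sup>2) * std_gauss u)"
  have m: "m \<ge> 0"
    unfolding m_def by (simp add: std_gauss_nonneg)
  \<comment> \<open>The width \<open>e\<close> makes the quadratic error term 2 B e^2 m / d^2 at
    most \<delta> / 2; m + 1 keeps the denominator positive.\<close>
  define e where "e = sqrt (\<delta> / 2 / (2 * B / d\<^sup>2 * (m + 1)))"
  have e2: "e\<^sup>2 = \<delta> / 2 / (2 * B / d\<^sup>2 * (m + 1))"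
    unfolding e_def using \<open>\<delta> > 0\<close> B(1) d(1) m by (intro real_sqrt_pow2) (auto intro!: divide_nonneg_pos mult_nonneg_nonneg)
  have e: "e > 0"
    unfolding e_def using \<open>\<delta> > 0\<close> B(1) d(1) m by (auto intro!: divide_pos_pos mult_pos_pos)
  have e2m: "2 * B / d\<^sup>2 * e\<^sup>2 * m \<le> \<delta> / 2"
  proof -
    have "2 * B / d\<^sup>2 * e\<^sup>2 * m \<le> 2 * B / d\<^sup>2 * e\<^sup>2 * (m + 1)"
      using B(1) by (intro mult_left_mono) auto
    also have "\<dots> = \<delta> / 2"
    proof -
      have "2 * B / d\<^sup>2 * (m + 1) \<noteq> 0"
        using B(1) d(1) m by simp
      moreover have "c \<noteq> 0 \<Longrightarrow> \<delta> / 2 / c * c = \<delta> / 2" for c :: real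
        by simp
      ultimately have "\<delta> / 2 / (2 * B / d\<^sup>2 * (m + 1)) * (2 * B / d\<^sup>2 * (m + 1)) = \<delta> / 2"
        by blast
      then show ?thesis
        unfolding e2 by (simp only: mult_ac)
    qed
    finally show ?thesis .
  qed
  \<comment> \<open>Uniform continuity is turned into a bound by a constant plus a quadratic term,
    so the Gaussian tail is paid for by its second moment and the integral need not be
    split.\<close>
  have quad: "cmod (F x' - F x) \<le> \<delta> / 2 + 2 * B / d\<^sup>2 * (norm (x' - x))\<^sup>2" for x x'
  proof (cases "norm (x' - x) < d")
    case True
    then show ?thesis
      using d(2)[of x' x] B(1) by (intro order_trans[OF less_imp_le[OF d(2)[OF True]]]) simp
  next
    case False
    have "cmod (F x' - F x) \<le> 2 * B"
      using norm_triangle_ineq4[of "F x'" "F x"] B(2)[of x] B(2)[of x'] by simp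
    also have "\<dots> \<le> 2 * B / d\<^sup>2 * (norm (x' - x))\<^sup>2"
      using False d(1) B(1) power_mono[of d "norm (x' - x)" 2] by (simp add: field_simps)
    finally show ?thesis
      using \<open>\<delta> > 0\<close> by simp
  qed
  define G where "G = (\<lambda>y. LINT u|lborel. F (y + e *\<^sub>R u) * std_gauss u)"
  have intG: "integrable lborel (\<lambda>u. F (y + e *\<^sub>R u) * std_gauss u)" for y
    by (rule Bochner_Integration.integrable_bound[OF integrable_mult_right[OF integrable_std_gauss, of B]])
      (use B(1) in \<open>auto simp: norm_mult std_gauss_nonneg intro!: mult_right_mono B(2)\<close>)
  have close: "cmod (F y - G y) \<le> \<delta>" for y
  proof -
    have "F y - G y = (LINT u|lborel. F y * std_gauss u - F (y + e *\<^sub>R u) * std_gauss u)"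
      unfolding G_def using intG[of y] integrable_std_gauss integral_std_gauss
      by (subst Bochner_Integration.integral_diff) auto
    also have "cmod \<dots> \<le> (LINT u|lborel. \<delta> / 2 * std_gauss u + 2 * B / d\<^sup>2 * e\<^sup>2 * ((1 + (norm (u::'a))\<^sup>2) * std_gauss u))"
    proof (rule norm_integral_le)
      show "integrable lborel (\<lambda>u::'a. \<delta> / 2 * std_gauss u + 2 * B / d\<^sup>2 * e\<^sup>2 * ((1 + (norm u)\<^sup>2) * std_gauss u))"
        by (intro Bochner_Integration.integrable_add integrable_mult_right integrable_std_gauss integrable_std_gauss_weighted)
      fix u :: 'a
      have "cmod (F y * std_gauss u - F (y + e *\<^sub>R u) * std_gauss u) = cmod (F (y + e *\<^sub>R u) - F y) * std_gauss u"
        by (simp add: norm_mult std_gauss_nonneg norm_minus_commute flip: left_diff_distrib)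
      also have "\<dots> \<le> (\<delta> / 2 + 2 * B / d\<^sup>2 * (norm (e *\<^sub>R u))\<^sup>2) * std_gauss u"
        using quad[of "y + e *\<^sub>R u" y] by (intro mult_right_mono std_gauss_nonneg) simp
      also have "\<dots> \<le> (\<delta> / 2 + 2 * B / d\<^sup>2 * e\<^sup>2 * (1 + (norm u)\<^sup>2)) * std_gauss u"
      proof -
        have "(norm (e *\<^sub>R u))\<^sup>2 \<le> e\<^sup>2 * (1 + (norm u)\<^sup>2)"
          by (simp add: power_mult_distrib mult_left_mono)
        then have "2 * B / d\<^sup>2 * (norm (e *\<^sub>R u))\<^sup>2 \<le> 2 * B / d\<^sup>2 * (e\<^sup>2 * (1 + (norm u)\<^sup>2))"
          using B(1) by (intro mult_left_mono) auto
        then show ?thesis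
          by (intro mult_right_mono std_gauss_nonneg add_left_mono) (simp only: mult.assoc)
      qed
      finally show "cmod (F y * std_gauss u - F (y + e *\<^sub>R u) * std_gauss u) \<le>
          \<delta> / 2 * std_gauss u + 2 * B / d\<^sup>2 * e\<^sup>2 * ((1 + (norm u)\<^sup>2) * std_gauss u)"
        by (simp only: distrib_right mult.assoc)
    qed
    also have "\<dots> = \<delta> / 2 + 2 * B / d\<^sup>2 * e\<^sup>2 * m"
      unfolding m_def
      by (subst Bochner_Integration.integral_add)
        (auto simp only: integral_mult_right_zero integral_std_gauss mult_1_right
          intro!: integrable_mult_right integrable_std_gauss integrable_std_gauss_weighted)
    also have "\<dots> \<le> \<delta>"
      using e2m by simp
    finally show ?thesis .
  qed
  \<comment> \<open>\<open>C\<close> is the factor by which the Gaussian density differs from its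
    own transform. Accordingly \<open>w\<close> is a Gaussian times the unnormalised Fourier
    transform of \<open>F\<close> at \<zeta> / e, with \<open>C\<close> and the Jacobian of the
    rescaling in front.\<close>
  define C where "C = (1 / sqrt (2 * pi)) ^ DIM('a)"
  define w where "w = (\<lambda>\<zeta>. (C / e ^ DIM('a)) * (LINT z|lborel. iexp (- ((1 / e) * (z \<bullet> \<zeta>))) * F z) * std_gauss \<zeta>)"
  have w_meas: "w \<in> borel_measurable borel"
    unfolding w_def by measurable
  have w: "integrable lborel w"
  proof (rule Bochner_Integration.integrable_bound[OF integrable_mult_right[OF integrable_std_gauss, of "\<bar>C / e ^ DIM('a)\<bar> * (LINT z|lborel. cmod (F z))"]])
    have "cmod (LINT z|lborel. iexp (- ((1 / e) * (z \<bullet> \<zeta>))) * F z) \<le> (LINT z|lborel. cmod (F z))" for \<zeta>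
      by (rule norm_integral_le) (auto simp: intF norm_mult)
    then have "norm (w \<zeta>) \<le> norm (\<bar>C / e ^ DIM('a)\<bar> * (LINT z|lborel. cmod (F z)) * std_gauss \<zeta>)" for \<zeta>
      unfolding w_def norm_mult norm_of_real
      by (intro mult_right_mono mult_mono) (auto intro: order_trans[OF _ abs_ge_self])
    then show "AE \<zeta> in lborel. norm (w \<zeta>) \<le> norm (\<bar>C / e ^ DIM('a)\<bar> * (LINT z|lborel. cmod (F z)) * std_gauss \<zeta>)"
      by simp
  qed (use w_meas in simp)
  have "G y = (LINT \<zeta>|lborel. iexp ((1 / e) * (y \<bullet> \<zeta>)) * w \<zeta>)" for y
  proof -
    let ?h = "\<lambda>z \<zeta>. F z * (iexp ((1 / e) * ((y - z) \<bullet> \<zeta>)) * std_gauss \<zeta>)"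
    have h: "integrable (lborel \<Otimes>\<^sub>M lborel) (\<lambda>(z, \<zeta>). ?h z \<zeta>)"
    proof (rule lborel_pair.Fubini_integrable)
      show "(\<lambda>(z, \<zeta>). ?h z \<zeta>) \<in> borel_measurable (lborel \<Otimes>\<^sub>M lborel)"
        by measurable
      have "(LINT \<zeta>|lborel. norm (?h z \<zeta>)) = cmod (F z)" for z
        by (simp add: norm_mult std_gauss_nonneg integral_std_gauss)
      then show "integrable lborel (\<lambda>z. LINT \<zeta>|lborel. norm (case (z, \<zeta>) of (z, \<zeta>) \<Rightarrow> ?h z \<zeta>))"
        using intF by simp
      have "integrable lborel (?h z)" for z
        by (rule Bochner_Integration.integrable_bound[OF integrable_mult_right[OF integrable_std_gauss, of "cmod (F z)"]])
          (auto simp: norm_mult std_gauss_nonneg)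
      then show "AE z in lborel. integrable lborel (\<lambda>\<zeta>. case (z, \<zeta>) of (z, \<zeta>) \<Rightarrow> ?h z \<zeta>)"
        by simp
    qed
    have gauss: "complex_of_real (std_gauss ((1 / e) *\<^sub>R (z - y))) =
        C * (LINT \<zeta>|lborel. iexp ((1 / e) * ((y - z) \<bullet> \<zeta>)) * std_gauss \<zeta>)" for z
      using integral_iexp_std_gauss[of "(1 / e) *\<^sub>R (y - z)"]
      unfolding std_gauss_eq[of "(1 / e) *\<^sub>R (z - y)"] C_def 
      by (simp add: norm_minus_commute)
    have "(LINT z|lborel. F z * std_gauss ((1 / e) *\<^sub>R (z - y))) = e ^ DIM('a) *\<^sub>R G y"
      using e by (subst integral_lborel_affine[of e _ y]) (auto simp: G_def)
    then have "G y = (1 / e ^ DIM('a)) * (LINT z|lborel. F z * std_gauss ((1 / e) *\<^sub>R (z - y)))"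
      using e by (simp add: scaleR_conv_of_real)
    also have "\<dots> = (C / e ^ DIM('a)) * (LINT z|lborel. LINT \<zeta>|lborel. ?h z \<zeta>)"
    proof -
      define I where "I = (\<lambda>z. LINT \<zeta>|lborel. ?h z \<zeta>)"
      have "F z * std_gauss ((1 / e) *\<^sub>R (z - y)) = C * I z" for z
        unfolding gauss I_def by (simp only: integral_mult_right_zero mult_ac)
      then show ?thesis
        unfolding I_def[symmetric] by simp
    qed
    also have "\<dots> = (C / e ^ DIM('a)) * (LINT \<zeta>|lborel. LINT z|lborel. ?h z \<zeta>)"
      by (subst lborel_pair.Fubini_integral[OF h]) simp
    also have "\<dots> = (LINT \<zeta>|lborel. iexp ((1 / e) * (y \<bullet> \<zeta>)) * w \<zeta>)"
    proof -
      have "(LINT z|lborel. ?h z \<zeta>) = (LINT z|lborel. (iexp ((1 / e) * (y \<bullet> \<zeta>)) * std_gauss \<zeta>) * (iexp (- ((1 / e) * (z \<bullet> \<zeta>))) * F z))" for \<zeta>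
        by (intro Bochner_Integration.integral_cong refl)
          (simp add: inner_diff_left algebra_simps exp_diff exp_minus divide_inverse diff_divide_distrib)
      moreover define J where "J = (\<lambda>\<zeta>. LINT z|lborel. iexp (- ((1 / e) * (z \<bullet> \<zeta>))) * F z)"
      ultimately have "(LINT z|lborel. ?h z \<zeta>) = (iexp ((1 / e) * (y \<bullet> \<zeta>)) * std_gauss \<zeta>) * J \<zeta>" for \<zeta>
        by (simp only: integral_mult_right_zero)
      moreover have "w \<zeta> = (C / e ^ DIM('a)) * J \<zeta> * std_gauss \<zeta>" for \<zeta>
        by (simp only: w_def J_def)
      ultimately have "(C / e ^ DIM('a)) * (LINT z|lborel. ?h z \<zeta>) = iexp ((1 / e) * (y \<bullet> \<zeta>)) * w \<zeta>" for \<zeta>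
        by (simp only: mult_ac)
      then show ?thesis
        by (simp only: integral_mult_right_zero[symmetric])
    qed
    finally show ?thesis .
  qed
  then show thesis
    using that[OF w, of "1 / e"] close by simp
qed

context levy_truncation
begin

text \<open>The averaging identity at scale 1, read backwards: it expresses the Fourier transform of
  a finite measure through the exponent alone.\<close>

lemma integral_iexp_gauss_integrand:
  "(LINT y|N. iexp (y \<bullet> \<eta>) * complex_of_real (1 - exp (- ((norm y)\<^sup>2 / 2)))) =
    (LINT \<xi>|lborel. (lk_exponent chi \<beta> N (\<eta> + 1 *\<^sub>R \<xi>) - lk_exponent chi \<beta> N \<eta>) * std_gauss \<xi>)"
  unfolding integral_kernel_lk_exponent[OF even_kernel_std_gauss] by (simp add: transform_std_gauss)

text \<open>Fubini: testing the finite measure with a superposition of exponentials is integrating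
  its Fourier transform against the weights.\<close>

lemma integral_fourier_gauss_integrand:
  assumes w: "integrable lborel w"
  shows "(LINT y|N. (LINT \<zeta>|lborel. iexp (s * (y \<bullet> \<zeta>)) * w \<zeta>) * complex_of_real (1 - exp (- ((norm y)\<^sup>2 / 2)))) =
    (LINT \<zeta>|lborel. w \<zeta> * (LINT y|N. iexp (y \<bullet> (s *\<^sub>R \<zeta>)) * complex_of_real (1 - exp (- ((norm y)\<^sup>2 / 2)))))"
proof -
  interpret pair_sigma_finite lborel N ..
  have [measurable]: "w \<in> borel_measurable borel"
    using borel_measurable_integrable[OF w] by simp
  let ?E = "\<lambda>y::'a. 1 - exp (- ((norm y)\<^sup>2 / 2))"
  have E: "integrable N ?E"
    using integrable_gauss[of 1] by simp
  let ?h = "\<lambda>\<zeta> y. w \<zeta> * (iexp (y \<bullet> (s *\<^sub>R \<zeta>)) * complex_of_real (?E y))"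
  have h: "integrable (lborel \<Otimes>\<^sub>M N) (\<lambda>(\<zeta>, y). ?h \<zeta> y)"
  proof (rule Fubini_integrable)
    show "(\<lambda>(\<zeta>, y). ?h \<zeta> y) \<in> borel_measurable (lborel \<Otimes>\<^sub>M N)"
      by measurable
    have n: "norm (?h \<zeta> y) = cmod (w \<zeta>) * ?E y" for \<zeta> y
      by (simp add: norm_mult del: of_real_diff)
    have "(LINT y|N. norm (?h \<zeta> y)) = cmod (w \<zeta>) * (LINT y|N. ?E y)" for \<zeta>
      unfolding n by (rule integral_mult_right_zero)
    then show "integrable lborel (\<lambda>\<zeta>. LINT y|N. norm (case (\<zeta>, y) of (\<zeta>, y) \<Rightarrow> ?h \<zeta> y))"
      using w by simp
    have "integrable N (?h \<zeta>)" for \<zeta>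
    proof (rule Bochner_Integration.integrable_bound[OF integrable_mult_right[OF E, of "cmod (w \<zeta>)"]])
      show "AE y in N. norm (?h \<zeta> y) \<le> norm (cmod (w \<zeta>) * ?E y)"
        unfolding n real_norm_def by (intro AE_I2 abs_ge_self)
    qed measurable
    then show "AE \<zeta> in lborel. integrable N (\<lambda>y. case (\<zeta>, y) of (\<zeta>, y) \<Rightarrow> ?h \<zeta> y)"
      by simp
  qed
  have "(LINT y|N. (LINT \<zeta>|lborel. iexp (s * (y \<bullet> \<zeta>)) * w \<zeta>) * complex_of_real (?E y)) =
      (LINT y|N. LINT \<zeta>|lborel. ?h \<zeta> y)"
  proof (intro Bochner_Integration.integral_cong refl)
    fix y
    have "(LINT \<zeta>|lborel. ?h \<zeta> y) = (LINT \<zeta>|lborel. iexp (s * (y \<bullet> \<zeta>)) * w \<zeta> * complex_of_real (?E y))"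
      by (intro Bochner_Integration.integral_cong refl) (simp only: inner_scaleR_right mult_ac)
    then show "(LINT \<zeta>|lborel. iexp (s * (y \<bullet> \<zeta>)) * w \<zeta>) * complex_of_real (?E y) = (LINT \<zeta>|lborel. ?h \<zeta> y)"
      by (simp only: integral_mult_left_zero)
  qed
  also have "\<dots> = (LINT \<zeta>|lborel. LINT y|N. ?h \<zeta> y)"
    by (rule Fubini_integral[OF h])
  also have "\<dots> = (LINT \<zeta>|lborel. w \<zeta> * (LINT y|N. iexp (y \<bullet> (s *\<^sub>R \<zeta>)) * complex_of_real (?E y)))"
    by (simp only: integral_mult_right_zero)
  finally show ?thesis .
qed

end

context levy_family
begin

lemma integral_iexp_gauss_tendsto:
  assumes cont: "\<And>\<xi>. continuous_on UNIV (\<lambda>x. p x \<xi>)" and X: "X \<longlonglongrightarrow> x"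
  shows "(\<lambda>n. LINT y|\<nu> (X n). iexp (y \<bullet> \<eta>) * complex_of_real (1 - exp (- ((norm y)\<^sup>2 / 2)))) \<longlonglongrightarrow>
    (LINT y|\<nu> x. iexp (y \<bullet> \<eta>) * complex_of_real (1 - exp (- ((norm y)\<^sup>2 / 2))))"
proof -
  have p: "(\<lambda>n. p (X n) \<xi>) \<longlonglongrightarrow> p x \<xi>" for \<xi>
    using cont[of \<xi>] X by (auto simp: continuous_on_sequentially o_def)
  have 1: "(\<lambda>n. LINT \<xi>|lborel. p (X n) (\<eta> + 1 *\<^sub>R \<xi>) * std_gauss \<xi>) \<longlonglongrightarrow> (LINT \<xi>|lborel. p x (\<eta> + 1 *\<^sub>R \<xi>) * std_gauss \<xi>)"
    by (rule integral_p_tendsto[where w=std_gauss, OF X p])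
      (auto simp: integrable_std_gauss_weighted std_gauss_nonneg)
  have int: "integrable lborel (\<lambda>\<xi>. p z (\<eta> + 1 *\<^sub>R \<xi>) * std_gauss \<xi>)" for z
  proof -
    obtain c where "\<And>x \<xi>. x \<in> {z} \<Longrightarrow> cmod (p x (\<eta> + 1 *\<^sub>R \<xi>)) \<le> c * (1 + (norm \<xi>)\<^sup>2)"
      using p_affine_bound[OF compact_sing, of z \<eta> 1] by metis
    then show ?thesis
      by (intro even_kernel.integrable_kernel_mult[OF even_kernel_std_gauss]) auto
  qed
  have eq: "(LINT y|\<nu> z. iexp (y \<bullet> \<eta>) * complex_of_real (1 - exp (- ((norm y)\<^sup>2 / 2)))) =
      (LINT \<xi>|lborel. p z (\<eta> + 1 *\<^sub>R \<xi>) * std_gauss \<xi>) - p z \<eta>" for z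
  proof -
    have "(LINT \<xi>|lborel. (p z (\<eta> + 1 *\<^sub>R \<xi>) - p z \<eta>) * std_gauss \<xi>) =
        (LINT \<xi>|lborel. p z (\<eta> + 1 *\<^sub>R \<xi>) * std_gauss \<xi>) - (LINT \<xi>|lborel. p z \<eta> * complex_of_real (std_gauss (\<xi>::'a)))"
      unfolding left_diff_distrib using int[of z] integrable_std_gauss
      by (intro Bochner_Integration.integral_diff) auto
    then show ?thesis
      unfolding levy_truncation.integral_iexp_gauss_integrand[OF levy_truncation_nu, of z \<eta> "b z"]
      by (simp add: integral_std_gauss)
  qed
  show ?thesis
    unfolding eq by (intro tendsto_diff 1 p)
qed

text \<open>A test function vanishing near 0 is a compactly supported \<open>F\<close> times the
  Gaussian integrand \<open>?E\<close>, so only the finite measures with density \<open>?E\<close>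
  matter. Their masses are bounded along the sequence, hence uniform approximation of
  \<open>F\<close> by superpositions of exponentials suffices, and for these the transforms
  converge.\<close>

lemma continuous_imp_vague:
  assumes cont: "\<And>\<xi>. continuous_on UNIV (\<lambda>x. p x \<xi>)" and f: "Cc_punctured f"
  shows "((\<lambda>z. LINT y|\<nu> z. f y) \<longlongrightarrow> (LINT y|\<nu> x. f y)) (at x)"
proof (rule tendsto_at_iff_sequentially[THEN iffD2], intro allI impI)
  fix X assume X: "X \<longlonglongrightarrow> x"
  let ?E = "\<lambda>y::'a. 1 - exp (- ((norm y)\<^sup>2 / 2))"
  have contE: "continuous_on UNIV ?E"
    by (intro continuous_intros) auto
  have E: "integrable (\<nu> z) ?E" for z
    using levy_truncation.integrable_gauss[OF levy_truncation_nu, of z 1] by simp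
  obtain K where K: "compact K" "0 \<notin> K" "\<And>y. y \<notin> K \<Longrightarrow> f y = 0" and fc: "continuous_on UNIV f"
    using f unfolding Cc_punctured_def by blast
  obtain m where m: "m > 0" "\<And>y. y \<in> K \<Longrightarrow> ?E y \<ge> m"
  proof (cases "K = {}")
    case True
    then show thesis using that[of 1] by simp
  next
    case False
    obtain y0 where y0: "y0 \<in> K" "\<And>y. y \<in> K \<Longrightarrow> ?E y0 \<le> ?E y"
      using continuous_attains_inf[OF K(1) False continuous_on_subset[OF contE]] by auto
    show thesis
      by (rule that[of "?E y0"]) (use y0 K(2) in auto)
  qed
  \<comment> \<open>Since \<open>?E\<close> vanishes at 0, the quotient is taken with
    \<open>max m\<close>; this changes nothing on the support of \<open>f\<close> and keeps
    \<open>F\<close> continuous everywhere.\<close>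
  define F where "F = (\<lambda>y. complex_of_real (f y / max m (?E y)))"
  have Fc: "continuous_on UNIV F"
    unfolding F_def using m(1)
    by (intro continuous_on_of_real continuous_on_divide fc continuous_on_max continuous_on_const contE) auto
  have Fs: "compact_support F"
    unfolding compact_support_def F_def using K by (intro exI[of _ K]) auto
  have fF: "complex_of_real (f y) = F y * complex_of_real (?E y)" for y
  proof (cases "y \<in> K")
    case True
    then have "max m (?E y) = ?E y" "?E y \<noteq> 0" using m by fastforce+
    then have "f y = f y / max m (?E y) * ?E y" by simp
    then show ?thesis unfolding F_def by (metis of_real_mult)
  qed (simp add: F_def K(3))
  have [measurable]: "F \<in> borel_measurable borel"
    using Fc by (rule borel_measurable_continuous_onI)
  obtain BF where BF: "\<And>y. cmod (F y) \<le> BF"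
    using compact_support_bounded[OF Fc Fs] by blast
  obtain M where M: "M > 0" "\<And>z. z \<in> insert x (range X) \<Longrightarrow> (LINT y|\<nu> z. min ((norm y)\<^sup>2) 1) \<le> M"
    using uniform_levy_bound[OF compact_sequence_with_limit[OF X]] by blast
  have EM: "(LINT y|\<nu> z. ?E y) \<le> M" if "z \<in> insert x (range X)" for z
  proof -
    have "(LINT y|\<nu> z. ?E y) \<le> (LINT y|\<nu> z. min ((norm y)\<^sup>2) 1)"
      using gauss_integrand_le[of 1]
      by (intro integral_mono E levy_measure.integrable_min[OF levy]) simp
    then show ?thesis using M(2)[OF that] by simp
  qed
  have sets: "sets (\<nu> z) = sets borel" for z
    by (rule levy_measure.sets_N[OF levy])
  have "(\<lambda>n. LINT y|\<nu> (X n). F y * complex_of_real (?E y)) \<longlonglongrightarrow> (LINT y|\<nu> x. F y * complex_of_real (?E y))"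
  proof (rule tendstoI)
    fix \<epsilon> :: real assume "\<epsilon> > 0"
    \<comment> \<open>A uniform error \<delta> costs at most \<delta> M = \<epsilon> / 4 after
      integration; it is paid at \<open>X n\<close> and at \<open>x\<close>.\<close>
    define \<delta> where "\<delta> = \<epsilon> / (4 * M)"
    have \<delta>: "\<delta> > 0" "\<delta> * M = \<epsilon> / 4" using \<open>\<epsilon> > 0\<close> M(1) by (auto simp: \<delta>_def)
    obtain s w where w: "integrable lborel w"
      and close: "\<And>y. cmod (F y - (LINT \<zeta>|lborel. iexp (s * (y \<bullet> \<zeta>)) * w \<zeta>)) \<le> \<delta>"
      using compact_support_approx_fourier[OF Fc Fs \<delta>(1)] by blast
    have [measurable]: "w \<in> borel_measurable borel"
      using borel_measurable_integrable[OF w] by simp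
    define W where "W = (\<lambda>y. LINT \<zeta>|lborel. iexp (s * (y \<bullet> \<zeta>)) * w \<zeta>)"
    have [measurable]: "W \<in> borel_measurable borel"
      unfolding W_def by measurable
    have W: "cmod (W y) \<le> (LINT \<zeta>|lborel. cmod (w \<zeta>))" for y
      unfolding W_def by (rule norm_integral_le) (auto simp: w norm_mult)
    have WE: "(\<lambda>n. LINT y|\<nu> (X n). W y * complex_of_real (?E y)) \<longlonglongrightarrow> (LINT y|\<nu> x. W y * complex_of_real (?E y))"
    proof -
      have J: "cmod (LINT y|\<nu> z. iexp (y \<bullet> \<eta>) * complex_of_real (?E y)) \<le> M" if "z \<in> insert x (range X)" for z \<eta>
      proof -
        have "cmod (LINT y|\<nu> z. iexp (y \<bullet> \<eta>) * complex_of_real (?E y)) \<le> (LINT y|\<nu> z. ?E y)"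
          by (rule norm_integral_le[OF E]) (simp add: norm_mult del: of_real_diff)
        then show ?thesis using EM[OF that] by simp
      qed
      have Jm: "(\<lambda>\<zeta>. LINT y|\<nu> z. iexp (y \<bullet> (s *\<^sub>R \<zeta>)) * complex_of_real (?E y)) \<in> borel_measurable borel" for z
      proof -
        interpret levy_truncation chi "\<nu> z" by (rule levy_truncation_nu)
        show ?thesis by measurable
      qed
      have "(\<lambda>n. LINT \<zeta>|lborel. w \<zeta> * (LINT y|\<nu> (X n). iexp (y \<bullet> (s *\<^sub>R \<zeta>)) * complex_of_real (?E y))) \<longlonglongrightarrow>
          (LINT \<zeta>|lborel. w \<zeta> * (LINT y|\<nu> x. iexp (y \<bullet> (s *\<^sub>R \<zeta>)) * complex_of_real (?E y)))"
      proof (rule integral_dominated_convergence[where w="\<lambda>\<zeta>. cmod (w \<zeta>) * M"])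
        show "AE \<zeta> in lborel. (\<lambda>n. w \<zeta> * (LINT y|\<nu> (X n). iexp (y \<bullet> (s *\<^sub>R \<zeta>)) * complex_of_real (?E y))) \<longlonglongrightarrow>
          w \<zeta> * (LINT y|\<nu> x. iexp (y \<bullet> (s *\<^sub>R \<zeta>)) * complex_of_real (?E y))"
          by (intro AE_I2 tendsto_mult tendsto_const integral_iexp_gauss_tendsto cont X)
        show "AE \<zeta> in lborel. cmod (w \<zeta> * (LINT y|\<nu> (X n). iexp (y \<bullet> (s *\<^sub>R \<zeta>)) * complex_of_real (?E y))) \<le> cmod (w \<zeta>) * M" for n
          unfolding norm_mult by (intro AE_I2 mult_left_mono J) auto
      qed (use w Jm in auto)
      then show ?thesis
        unfolding W_def levy_truncation.integral_fourier_gauss_integrand[OF levy_truncation_nu w] .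
    qed
    have FW: "cmod ((LINT y|\<nu> z. F y * complex_of_real (?E y)) - (LINT y|\<nu> z. W y * complex_of_real (?E y))) \<le> \<epsilon> / 4"
      if "z \<in> insert x (range X)" for z
    proof -
      have iF: "integrable (\<nu> z) (\<lambda>y. F y * complex_of_real (?E y))"
        by (rule Bochner_Integration.integrable_bound[OF integrable_mult_right[OF E[of z], where c=BF]])
          (auto simp: norm_mult sets measurable_cong_sets[OF sets refl] simp del: of_real_diff
            intro!: order_trans[OF _ abs_ge_self] mult_right_mono BF)
      have iW: "integrable (\<nu> z) (\<lambda>y. W y * complex_of_real (?E y))"
        by (rule Bochner_Integration.integrable_bound[OF integrable_mult_right[OF E[of z], where c="LINT \<zeta>|lborel. cmod (w \<zeta>)"]])
          (auto simp: norm_mult sets measurable_cong_sets[OF sets refl] simp del: of_real_diff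
            intro!: order_trans[OF _ abs_ge_self] mult_right_mono W)
      have "cmod ((LINT y|\<nu> z. F y * complex_of_real (?E y)) - (LINT y|\<nu> z. W y * complex_of_real (?E y)))
          = cmod (LINT y|\<nu> z. (F y - W y) * complex_of_real (?E y))"
        using iF iW by (simp add: left_diff_distrib del: of_real_diff)
      also have "\<dots> \<le> (LINT y|\<nu> z. \<delta> * ?E y)"
        using close unfolding W_def
        by (intro norm_integral_le integrable_mult_right E) (simp add: norm_mult mult_right_mono del: of_real_diff)
      also have "\<dots> = \<delta> * (LINT y|\<nu> z. ?E y)"
        by (rule integral_mult_right_zero)
      also have "\<dots> \<le> \<delta> * M"
        using \<delta>(1) by (intro mult_left_mono EM that) auto
      finally show ?thesis using \<delta>(2) by simp
    qed
    have "\<forall>\<^sub>F n in sequentially. dist (LINT y|\<nu> (X n). W y * complex_of_real (?E y)) (LINT y|\<nu> x. W y * complex_of_real (?E y)) < \<epsilon> / 4"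
      using WE \<open>\<epsilon> > 0\<close> by (auto dest!: tendstoD[of _ _ _ "\<epsilon> / 4"])
    then show "\<forall>\<^sub>F n in sequentially. dist (LINT y|\<nu> (X n). F y * complex_of_real (?E y)) (LINT y|\<nu> x. F y * complex_of_real (?E y)) < \<epsilon>"
    proof eventually_elim
      case (elim n)
      have "dist a b < \<epsilon>" if "dist a c \<le> \<epsilon> / 4" "dist c d < \<epsilon> / 4" "dist b d \<le> \<epsilon> / 4" for a b c d :: complex
        using that \<open>\<epsilon> > 0\<close> dist_triangle[of a b c] dist_triangle[of c b d] by (simp add: dist_commute)
      from this[OF FW[of "X n", folded dist_norm] elim FW[of x, folded dist_norm]] show ?case
        by simp
    qed
  qed
  then have "(\<lambda>n. complex_of_real (LINT y|\<nu> (X n). f y)) \<longlonglongrightarrow> complex_of_real (LINT y|\<nu> x. f y)"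
    by (simp only: fF[symmetric] integral_complex_of_real)
  then show "((\<lambda>z. LINT y|\<nu> z. f y) \<circ> X) \<longlonglongrightarrow> (LINT y|\<nu> x. f y)"
    by (simp add: o_def tendsto_of_real_iff)
qed

end

section \<open>From vague convergence to continuity of the symbol\<close>

context levy_family
begin

text \<open>The requirement R \<ge> 2 ensures that \<open>chi\<close> vanishes outside the ball of
  radius R, as the estimate for small frequencies needs.\<close>

lemma tight_obtain:
  assumes "((\<lambda>R. SUP x\<in>K. emeasure (\<nu> x) (- ball 0 R)) \<longlongrightarrow> 0) at_top" and "\<epsilon> > 0"
  obtains R where "R \<ge> 2" "\<And>x. x \<in> K \<Longrightarrow> emeasure (\<nu> x) (- ball 0 R) \<le> ennreal \<epsilon>"
proof -
  have "\<forall>\<^sub>F R in at_top. (SUP x\<in>K. emeasure (\<nu> x) (- ball 0 R)) \<le> ennreal \<epsilon> \<and> 2 \<le> R"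
    using assms unfolding tendsto_0_ennreal_iff by (intro eventually_conj eventually_ge_at_top) auto
  then obtain R :: real where "(SUP x\<in>K. emeasure (\<nu> x) (- ball 0 R)) \<le> ennreal \<epsilon>" "2 \<le> R"
    by (metis (mono_tags, lifting) eventually_happens trivial_limit_at_top_linorder)
  then show thesis
    using that by (auto simp: SUP_le_iff)
qed

lemma near_obtain:
  assumes "((\<lambda>r. SUP x\<in>K. \<integral>\<^sup>+ y. ennreal ((norm y)\<^sup>2) * indicator (cball 0 r) y \<partial>\<nu> x) \<longlongrightarrow> 0) (at_right 0)"
    and "\<epsilon> > 0"
  obtains r where "r > 0" "\<And>x. x \<in> K \<Longrightarrow>
    (\<integral>\<^sup>+ y. ennreal ((norm y)\<^sup>2) * indicator (cball 0 r) y \<partial>\<nu> x) \<le> ennreal \<epsilon>"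
proof -
  have "\<forall>\<^sub>F r in at_right 0. (SUP x\<in>K. \<integral>\<^sup>+ y. ennreal ((norm y)\<^sup>2) * indicator (cball 0 r) y \<partial>\<nu> x) \<le> ennreal \<epsilon> \<and> 0 < r"
    using assms unfolding tendsto_0_ennreal_iff by (intro eventually_conj eventually_at_right_less) auto
  then obtain r :: real where "(SUP x\<in>K. \<integral>\<^sup>+ y. ennreal ((norm y)\<^sup>2) * indicator (cball 0 r) y \<partial>\<nu> x) \<le> ennreal \<epsilon>" "0 < r"
    by (metis (mono_tags, lifting) eventually_happens trivial_limit_at_right_real)
  then show thesis
    using that by (auto simp: SUP_le_iff)
qed

text \<open>Cutting \<open>h\<close> off near 0 and near infinity gives a test function for vague
  convergence. What is removed is at most a multiple of |y|^2 near 0 and of the tail mass, both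
  small uniformly on the compact neighbourhood \<open>cball x 1\<close>.\<close>

lemma vague_integral_tendsto:
  fixes h :: "'a \<Rightarrow> real"
  assumes vague: "\<And>f. Cc_punctured f \<Longrightarrow> ((\<lambda>z. LINT y|\<nu> z. f y) \<longlongrightarrow> (LINT y|\<nu> x. f y)) (at x)"
    and tight: "\<And>K. compact K \<Longrightarrow> ((\<lambda>R. SUP x\<in>K. emeasure (\<nu> x) (- ball 0 R)) \<longlongrightarrow> 0) at_top"
    and near: "\<And>K. compact K \<Longrightarrow>
      ((\<lambda>r. SUP x\<in>K. \<integral>\<^sup>+ y. ennreal ((norm y)\<^sup>2) * indicator (cball 0 r) y \<partial>\<nu> x) \<longlongrightarrow> 0) (at_right 0)"
    and hc: "continuous_on UNIV h" and hb: "\<And>y. \<bar>h y\<bar> \<le> C * min ((norm y)\<^sup>2) 1"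
  shows "((\<lambda>z. LINT y|\<nu> z. h y) \<longlongrightarrow> (LINT y|\<nu> x. h y)) (at x)"
proof (rule tendstoI)
  fix \<epsilon> :: real assume "\<epsilon> > 0"
  define C1 where "C1 = \<bar>C\<bar> + 1"
  have C1: "C1 > 0" by (simp add: C1_def)
  have hb1: "\<bar>h y\<bar> \<le> C1 * min ((norm y)\<^sup>2) 1" for y
  proof -
    have "C * min ((norm y)\<^sup>2) 1 \<le> C1 * min ((norm y)\<^sup>2) 1"
      unfolding C1_def by (intro mult_right_mono) auto
    then show ?thesis using hb[of y] by linarith
  qed
  have [measurable]: "h \<in> borel_measurable borel"
    using hc by (rule borel_measurable_continuous_onI)
  define \<delta> where "\<delta> = \<epsilon> / (8 * C1)"
  have \<delta>: "\<delta> > 0" "2 * C1 * \<delta> = \<epsilon> / 4"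
    using \<open>\<epsilon> > 0\<close> C1 by (auto simp: \<delta>_def)
  obtain R where R: "R \<ge> 2" "\<And>z. z \<in> cball x 1 \<Longrightarrow> emeasure (\<nu> z) (- ball 0 R) \<le> ennreal \<delta>"
    using tight_obtain[OF tight[OF compact_cball] \<delta>(1)] by metis
  obtain r where r: "r > 0" "\<And>z. z \<in> cball x 1 \<Longrightarrow>
      (\<integral>\<^sup>+ y. ennreal ((norm y)\<^sup>2) * indicator (cball 0 r) y \<partial>\<nu> z) \<le> ennreal \<delta>"
    using near_obtain[OF near[OF compact_cball] \<delta>(1)] by metis
  \<comment> \<open>The cutoff has linear ramps between r / 2 and r and between R and 2R. No order
    between r and R is presumed: each \<open>y\<close> satisfies |y| \<le> r, or |y| \<ge> R, or
    lies where \<theta> = 1.\<close>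
  define \<theta> :: "'a \<Rightarrow> real" where
    "\<theta> = (\<lambda>y. max 0 (min 1 (min (2 * norm y / r - 1) (2 - norm y / R))))"
  have \<theta>c: "continuous_on UNIV \<theta>"
    unfolding \<theta>_def using r(1) R(1) by (intro continuous_intros) auto
  have [measurable]: "\<theta> \<in> borel_measurable borel"
    using \<theta>c by (rule borel_measurable_continuous_onI)
  have \<theta>01: "0 \<le> \<theta> y" "\<theta> y \<le> 1" for y
    by (auto simp: \<theta>_def)
  have \<theta>1: "\<theta> y = 1" if "r \<le> norm y" "norm y \<le> R" for y
    using that r(1) R(1) by (simp add: \<theta>_def field_simps min_def)
  have \<theta>0: "\<theta> y = 0" if "norm y \<le> r / 2 \<or> 2 * R \<le> norm y" for y
  proof -
    have "2 * norm y / r - 1 \<le> 0 \<or> 2 - norm y / R \<le> 0"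
      using that r(1) R(1) by (auto simp: field_simps)
    then show ?thesis
      unfolding \<theta>_def by (intro max_absorb1) (simp only: min_le_iff_disj, blast)
  qed
  have "Cc_punctured (\<lambda>y. h y * \<theta> y)"
    unfolding Cc_punctured_def
  proof (intro conjI exI[of _ "cball 0 (2 * R) - ball 0 (r / 2)"])
    show "compact (cball 0 (2 * R) - ball (0::'a) (r / 2))"
      by (intro compact_diff) auto
    show "\<forall>y. y \<notin> cball 0 (2 * R) - ball 0 (r / 2) \<longrightarrow> h y * \<theta> y = 0"
      using \<theta>0 by auto
  qed (use r(1) hc \<theta>c in \<open>auto intro: continuous_on_mult\<close>)
  from vague[OF this] have lim: "((\<lambda>z. LINT y|\<nu> z. h y * \<theta> y) \<longlongrightarrow> (LINT y|\<nu> x. h y * \<theta> y)) (at x)" .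
  have diff: "\<bar>(LINT y|\<nu> z. h y) - (LINT y|\<nu> z. h y * \<theta> y)\<bar> \<le> \<epsilon> / 4" if z: "z \<in> cball x 1" for z
  proof -
    interpret levy_measure "\<nu> z" by (rule levy)
    have ih: "integrable (\<nu> z) h" 
      by (rule integrable_levy[OF _ hb1[folded real_norm_def]]) measurable
    have ih\<theta>: "integrable (\<nu> z) (\<lambda>y. h y * \<theta> y)"
    proof (rule integrable_levy)
      show "norm (h y * \<theta> y) \<le> C1 * min ((norm y)\<^sup>2) 1" for y
        using order_trans[OF mult_mono[OF order_refl \<theta>01(2), of "\<bar>h y\<bar>" y]] hb1[of y] \<theta>01(1)[of y]
        by (simp add: abs_mult)
    qed measurable
    have ptw: "ennreal (norm (h y - h y * \<theta> y)) \<le>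
        ennreal C1 * (ennreal ((norm y)\<^sup>2) * indicator (cball 0 r) y + indicator (- ball 0 R) y)" for y
    proof -
      have 1: "norm (h y - h y * \<theta> y) = \<bar>h y\<bar> * (1 - \<theta> y)"
        using \<theta>01(2)[of y] by (simp add: abs_mult flip: right_diff_distrib[of "h y" 1, simplified])
      have 2: "\<bar>h y\<bar> * (1 - \<theta> y) \<le> \<bar>h y\<bar>"
        using \<theta>01(1)[of y] by (simp add: mult_left_le)
      consider "norm y \<le> r" | "norm y \<ge> R" | "r \<le> norm y" "norm y \<le> R" by linarith
      then show ?thesis
      proof cases
        assume y: "norm y \<le> r"
        have "norm (h y - h y * \<theta> y) \<le> C1 * (norm y)\<^sup>2"
          unfolding 1 using 2 hb1[of y] mult_left_mono[OF min.cobounded1[of "(norm y)\<^sup>2" 1], of C1] C1 by linarith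
        then have "ennreal (norm (h y - h y * \<theta> y)) \<le> ennreal C1 * ennreal ((norm y)\<^sup>2)"
          using C1 by (simp add: ennreal_leI flip: ennreal_mult)
        also have "\<dots> \<le> ennreal C1 * (ennreal ((norm y)\<^sup>2) * indicator (cball 0 r) y + indicator (- ball 0 R) y)"
          using y by (intro mult_left_mono) auto
        finally show ?thesis .
      next
        assume y: "norm y \<ge> R"
        have "norm (h y - h y * \<theta> y) \<le> C1"
          unfolding 1 using 2 hb1[of y] mult_left_mono[OF min.cobounded2[of "(norm y)\<^sup>2" 1], of C1] C1 by linarith
        then have "ennreal (norm (h y - h y * \<theta> y)) \<le> ennreal C1 * 1"
          by (simp add: ennreal_leI)
        also have "\<dots> \<le> ennreal C1 * (ennreal ((norm y)\<^sup>2) * indicator (cball 0 r) y + indicator (- ball 0 R) y)"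
          using y by (intro mult_left_mono) auto
        finally show ?thesis .
      qed (simp add: \<theta>1)
    qed
    have "ennreal (norm (LINT y|\<nu> z. h y - h y * \<theta> y)) \<le> (\<integral>\<^sup>+ y. ennreal (norm (h y - h y * \<theta> y)) \<partial>\<nu> z)"
      using ih ih\<theta> by (intro integral_norm_bound_ennreal) auto
    also have "\<dots> \<le> (\<integral>\<^sup>+ y. ennreal C1 * (ennreal ((norm y)\<^sup>2) * indicator (cball 0 r) y + indicator (- ball 0 R) y) \<partial>\<nu> z)"
      by (intro nn_integral_mono ptw)
    also have "\<dots> = ennreal C1 * ((\<integral>\<^sup>+ y. ennreal ((norm y)\<^sup>2) * indicator (cball 0 r) y \<partial>\<nu> z) + emeasure (\<nu> z) (- ball 0 R))"
    proof -
      have far: "(indicator (- ball 0 R) :: 'a \<Rightarrow> ennreal) \<in> borel_measurable (\<nu> z)"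
        by (intro borel_measurable_indicator) simp
      have "(indicator (cball 0 r) :: 'a \<Rightarrow> ennreal) \<in> borel_measurable (\<nu> z)"
        by (intro borel_measurable_indicator) simp
      moreover have "(\<lambda>y. ennreal ((norm y)\<^sup>2)) \<in> borel_measurable (\<nu> z)"
        by measurable
      ultimately have near: "(\<lambda>y. ennreal ((norm y)\<^sup>2) * indicator (cball 0 r) y) \<in> borel_measurable (\<nu> z)"
        by (rule borel_measurable_times_ennreal[rotated])
      show ?thesis
        unfolding nn_integral_cmult[OF borel_measurable_add[OF near far]] nn_integral_add[OF near far]
        by simp
    qed
    also have "\<dots> \<le> ennreal C1 * (ennreal \<delta> + ennreal \<delta>)"
      by (intro mult_left_mono add_mono r(2) R(2) z) auto
    also have "\<dots> = ennreal (\<epsilon> / 4)"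
    proof -
      have "ennreal C1 * (ennreal \<delta> + ennreal \<delta>) = ennreal (C1 * (\<delta> + \<delta>))"
        using C1 \<delta>(1) by (simp add: ennreal_mult del: ennreal_plus flip: ennreal_plus)
      also have "C1 * (\<delta> + \<delta>) = \<epsilon> / 4"
        using \<delta>(2) by (simp add: algebra_simps)
      finally show ?thesis .
    qed
    finally show ?thesis
      using \<open>\<epsilon> > 0\<close> ih ih\<theta> by simp
  qed
  have "\<forall>\<^sub>F z in at x. z \<in> cball x 1"
    using eventually_at_ball'[of 1 x UNIV] by (auto elim: eventually_mono)
  moreover have "\<forall>\<^sub>F z in at x. dist (LINT y|\<nu> z. h y * \<theta> y) (LINT y|\<nu> x. h y * \<theta> y) < \<epsilon> / 4"
    using lim \<open>\<epsilon> > 0\<close> by (auto dest!: tendstoD[of _ _ _ "\<epsilon> / 4"])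
  ultimately show "\<forall>\<^sub>F z in at x. dist (LINT y|\<nu> z. h y) (LINT y|\<nu> x. h y) < \<epsilon>"
  proof eventually_elim
    case (elim z)
    have "\<bar>a - c\<bar> < \<epsilon>" if "\<bar>a - u\<bar> \<le> \<epsilon> / 4" "\<bar>u - v\<bar> < \<epsilon> / 4" "\<bar>c - v\<bar> \<le> \<epsilon> / 4" for a c u v :: real
      using that \<open>\<epsilon> > 0\<close> by linarith
    from this[OF diff[OF elim(1)] elim(2)[unfolded dist_real_def] diff] show ?case
      by (simp add: dist_real_def)
  qed
qed

lemma vague_lk_integral_continuous:
  assumes vague: "\<And>f x. Cc_punctured f \<Longrightarrow> ((\<lambda>z. LINT y|\<nu> z. f y) \<longlongrightarrow> (LINT y|\<nu> x. f y)) (at x)"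
    and tight: "\<And>K. compact K \<Longrightarrow> ((\<lambda>R. SUP x\<in>K. emeasure (\<nu> x) (- ball 0 R)) \<longlongrightarrow> 0) at_top"
    and near: "\<And>K. compact K \<Longrightarrow>
      ((\<lambda>r. SUP x\<in>K. \<integral>\<^sup>+ y. ennreal ((norm y)\<^sup>2) * indicator (cball 0 r) y \<partial>\<nu> x) \<longlongrightarrow> 0) (at_right 0)"
  shows "continuous_on UNIV (\<lambda>x. LINT y|\<nu> x. lk_integrand chi \<xi> y)"
proof -
  have "((\<lambda>z. LINT y|\<nu> z. lk_integrand chi \<xi> y) \<longlongrightarrow> (LINT y|\<nu> x. lk_integrand chi \<xi> y)) (at x)" for x
  proof -
    have re: "((\<lambda>z. LINT y|\<nu> z. Re (lk_integrand chi \<xi> y)) \<longlongrightarrow> (LINT y|\<nu> x. Re (lk_integrand chi \<xi> y))) (at x)"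
      using order_trans[OF abs_Re_le_cmod lk_integrand_bound]
      by (intro vague_integral_tendsto[OF vague tight near] continuous_intros lk_integrand_continuous)
    have im: "((\<lambda>z. LINT y|\<nu> z. Im (lk_integrand chi \<xi> y)) \<longlongrightarrow> (LINT y|\<nu> x. Im (lk_integrand chi \<xi> y))) (at x)"
      using order_trans[OF abs_Im_le_cmod lk_integrand_bound]
      by (intro vague_integral_tendsto[OF vague tight near] continuous_intros lk_integrand_continuous)
    note int = levy_truncation.integrable_lk_integrand[OF levy_truncation_nu]
    show ?thesis
      using re im by (simp add: tendsto_complex_iff int)
  qed
  then show ?thesis
    by (simp add: continuous_on_def)
qed

lemma vague_imp_continuous:
  assumes "continuous_on UNIV b"
    and "\<And>f x. Cc_punctured f \<Longrightarrow> ((\<lambda>z. LINT y|\<nu> z. f y) \<longlongrightarrow> (LINT y|\<nu> x. f y)) (at x)"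
    and "\<And>K. compact K \<Longrightarrow> ((\<lambda>R. SUP x\<in>K. emeasure (\<nu> x) (- ball 0 R)) \<longlongrightarrow> 0) at_top"
    and "\<And>K. compact K \<Longrightarrow>
      ((\<lambda>r. SUP x\<in>K. \<integral>\<^sup>+ y. ennreal ((norm y)\<^sup>2) * indicator (cball 0 r) y \<partial>\<nu> x) \<longlongrightarrow> 0) (at_right 0)"
  shows "continuous_on UNIV (\<lambda>x. p x \<xi>)"
  unfolding lk_exponent_def
  using vague_lk_integral_continuous[OF assms(2-4)] assms(1) by (intro continuous_intros) auto

text \<open>Removing p from the integral leaves i times b(x) \<bullet> i, so the imaginary part is a
  drift coordinate. The integral is continuous by the three jump conditions, already derived from
  the same hypothesis.\<close>

lemma continuous_imp_drift_continuous:
  assumes cont: "\<And>\<xi>. continuous_on UNIV (\<lambda>x. p x \<xi>)"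
  shows "continuous_on UNIV b"
proof (subst continuous_on_componentwise, intro ballI)
  fix i :: 'a
  have "continuous_on UNIV (\<lambda>x. LINT y|\<nu> x. lk_integrand chi i y)"
    by (intro vague_lk_integral_continuous continuous_imp_vague continuous_imp_tight
        continuous_imp_no_gaussian_limit cont)
  then have "continuous_on UNIV (\<lambda>x. Im ((LINT y|\<nu> x. lk_integrand chi i y) - p x i))"
    using cont by (intro continuous_intros)
  then show "continuous_on UNIV (\<lambda>x. b x \<bullet> i)"
    by (simp add: lk_exponent_def)
qed

text \<open>Three regions: the Taylor bound for |y| < 1; a Lipschitz bound R |\<xi>| plus the
  compensator's 2 |\<xi>| for 1 \<le> |y| < R; and for |y| \<ge> R the bound 2, because the
  compensator has vanished. Unlike \<open>lk_integrand_bound\<close> this tends to 0 with \<xi>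
  except on the tail.\<close>

lemma lk_integrand_small_frequency:
  assumes "norm \<xi> \<le> 1" and "R \<ge> 2"
  shows "cmod (lk_integrand chi \<xi> y) \<le> (R + 2) * norm \<xi> * min ((norm y)\<^sup>2) 1 + 2 * indicator (- ball 0 R) y"
proof -
  consider "norm y < 1" | "1 \<le> norm y" "norm y < R" | "norm y \<ge> R" by linarith
  then show ?thesis
  proof cases
    case 1
    have "(norm y)\<^sup>2 * (norm \<xi>)\<^sup>2 / 2 \<le> (R + 2) * norm \<xi> * (norm y)\<^sup>2"
    proof -
      have "(norm \<xi>)\<^sup>2 \<le> norm \<xi>"
        using assms(1) by (simp add: power2_eq_square mult_left_le)
      also have "\<dots> \<le> (R + 2) * norm \<xi>"
        using assms(2) mult_right_mono[of 1 "R + 2" "norm \<xi>"] by simp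
      finally have "(norm y)\<^sup>2 * (norm \<xi>)\<^sup>2 \<le> (norm y)\<^sup>2 * ((R + 2) * norm \<xi>)"
        by (intro mult_left_mono) auto
      moreover have "0 \<le> (norm y)\<^sup>2 * (norm \<xi>)\<^sup>2" by simp
      moreover have "(R + 2) * norm \<xi> * (norm y)\<^sup>2 = (norm y)\<^sup>2 * ((R + 2) * norm \<xi>)"
        by (rule mult.commute)
      ultimately show ?thesis by linarith
    qed
    moreover have "min ((norm y)\<^sup>2) 1 = (norm y)\<^sup>2"
      using 1 by (simp add: power_le_one)
    ultimately show ?thesis
      using lk_integrand_small[OF 1, of \<xi>] by (simp add: indicator_def)
  next
    case 2
    have "cmod (1 - iexp (y \<bullet> \<xi>)) \<le> \<bar>y \<bullet> \<xi>\<bar>"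
      using iexp_approx1[of "y \<bullet> \<xi>" 0] by (simp add: norm_minus_commute)
    also have "\<dots> \<le> norm y * norm \<xi>"
      by (rule Cauchy_Schwarz_ineq2)
    also have "\<dots> \<le> R * norm \<xi>"
      using 2 by (intro mult_right_mono) auto
    finally have "cmod (lk_integrand chi \<xi> y) \<le> (R + 2) * norm \<xi>"
      using norm_triangle_ineq[of "1 - iexp (y \<bullet> \<xi>)" "\<i> * complex_of_real ((y \<bullet> \<xi>) * chi y)"]
        lk_integrand_compensator[of y \<xi>]
      unfolding lk_integrand_def by (simp add: distrib_right)
    moreover have "min ((norm y)\<^sup>2) 1 = 1"
      using 2 by (simp add: one_le_power)
    ultimately show ?thesis
      by (simp add: indicator_def)
  next
    case 3
    have "cmod (lk_integrand chi \<xi> y) \<le> 2"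
      using 3 assms(2) norm_triangle_ineq4[of 1 "iexp (y \<bullet> \<xi>)"]
      by (simp add: lk_integrand_def chi_eq_0)
    moreover have "0 \<le> (R + 2) * norm \<xi> * min ((norm y)\<^sup>2) 1"
      using assms(2) by simp
    moreover have "indicator (- ball 0 R) y = (1::real)"
      using 3 by simp
    ultimately show ?thesis
      by simp
  qed
qed

text \<open>Tightness makes the contribution of large jumps small for all \<xi>; everything else is
  linear in |\<xi>| with constants uniform on K.\<close>

lemma continuous_imp_uniform_at_0:
  assumes cont: "\<And>\<xi>. continuous_on UNIV (\<lambda>x. p x \<xi>)" and K: "compact K"
  shows "((\<lambda>\<xi>. SUP x\<in>K. ennreal (cmod (p x \<xi>))) \<longlongrightarrow> 0) (at 0)"
  unfolding tendsto_0_ennreal_iff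
proof (intro allI impI)
  fix \<epsilon> :: real assume "\<epsilon> > 0"
  have "bounded (b ` K)"
    using compact_continuous_image[OF continuous_on_subset[OF continuous_imp_drift_continuous[OF cont]] K]
      compact_imp_bounded by simp
  then obtain B where B: "B > 0" "\<And>x. x \<in> K \<Longrightarrow> norm (b x) \<le> B"
    unfolding bounded_pos by auto
  obtain M where M: "M > 0" "\<And>x. x \<in> K \<Longrightarrow> (LINT y|\<nu> x. min ((norm y)\<^sup>2) 1) \<le> M"
    using uniform_levy_bound[OF K] by blast
  obtain R where R: "R \<ge> 2" "\<And>x. x \<in> K \<Longrightarrow> emeasure (\<nu> x) (- ball 0 R) \<le> ennreal (\<epsilon> / 4)"
    using tight_obtain[OF continuous_imp_tight[OF cont K], of "\<epsilon> / 4"] \<open>\<epsilon> > 0\<close> by auto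
  \<comment> \<open>Total coefficient of |\<xi>|: the drift gives \<open>B\<close>, jumps inside the
    ball give \<open>(R + 2) * M\<close>. The tail uses up \<epsilon> / 2, so |\<xi>| \<le>
    \<epsilon> / (2 D) is enough.\<close>
  define D where "D = B + (R + 2) * M"
  have D: "D > 0" using B(1) M(1) R(1) by (simp add: D_def add_pos_pos)
  have bound: "cmod (p x \<xi>) \<le> \<epsilon>" if x: "x \<in> K" and \<xi>: "norm \<xi> \<le> 1" "norm \<xi> \<le> \<epsilon> / (2 * D)" for x \<xi>
  proof -
    interpret levy_measure "\<nu> x" by (rule levy)
    have fin: "emeasure (\<nu> x) (- ball 0 R) < \<infinity>"
      using R(2)[OF x] by (rule le_less_trans) simp
    then have int: "integrable (\<nu> x) (indicator (- ball 0 R) :: 'a \<Rightarrow> real)"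
      by (intro integrable_real_indicator) auto
    have far: "measure (\<nu> x) (- ball 0 R) \<le> \<epsilon> / 4"
      unfolding measure_def using R(2)[OF x] \<open>\<epsilon> > 0\<close> by (intro enn2real_leI) auto
    have "cmod (LINT y|\<nu> x. lk_integrand chi \<xi> y) \<le>
        (LINT y|\<nu> x. (R + 2) * norm \<xi> * min ((norm y)\<^sup>2) 1 + 2 * indicator (- ball 0 R) y)"
      by (intro norm_integral_le lk_integrand_small_frequency \<xi>(1) R(1) Bochner_Integration.integrable_add
          integrable_mult_right integrable_min int)
    also have "\<dots> = (R + 2) * norm \<xi> * (LINT y|\<nu> x. min ((norm y)\<^sup>2) 1) + 2 * measure (\<nu> x) (- ball 0 R)"
      using int integrable_min by (subst Bochner_Integration.integral_add) auto
    also have "\<dots> \<le> (R + 2) * norm \<xi> * M + 2 * (\<epsilon> / 4)"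
      using R(1) by (intro add_mono mult_left_mono M(2) x far) auto
    finally have 1: "cmod (LINT y|\<nu> x. lk_integrand chi \<xi> y) \<le> (R + 2) * M * norm \<xi> + \<epsilon> / 2"
      by (simp add: mult_ac)
    have "\<bar>b x \<bullet> \<xi>\<bar> \<le> B * norm \<xi>"
      using Cauchy_Schwarz_ineq2[of "b x" \<xi>] mult_right_mono[OF B(2)[OF x], of "norm \<xi>"] by simp
    then have "cmod (p x \<xi>) \<le> B * norm \<xi> + ((R + 2) * M * norm \<xi> + \<epsilon> / 2)"
      using 1 norm_triangle_ineq[of "- \<i> * complex_of_real (b x \<bullet> \<xi>)" "LINT y|\<nu> x. lk_integrand chi \<xi> y"]
      unfolding lk_exponent_def by (simp add: norm_mult)
    also have "\<dots> = D * norm \<xi> + \<epsilon> / 2"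
      by (simp add: D_def algebra_simps)
    also have "\<dots> \<le> \<epsilon>"
      using mult_left_mono[OF \<xi>(2), of D] D by simp
    finally show ?thesis .
  qed
  have "\<forall>\<^sub>F \<xi> in at (0::'a). norm \<xi> < min 1 (\<epsilon> / (2 * D))"
    using D \<open>\<epsilon> > 0\<close> by (auto simp: eventually_at intro!: exI[of _ "min 1 (\<epsilon> / (2 * D))"])
  then show "\<forall>\<^sub>F \<xi> in at 0. (SUP x\<in>K. ennreal (cmod (p x \<xi>))) \<le> ennreal \<epsilon>"
    by eventually_elim (auto intro!: SUP_least ennreal_leI bound)
qed

end

section \<open>The pseudo-differential operator\<close>

text \<open>Written with \<open>1 *\<^sub>R y\<close> so that it matches
  \<open>Cc_infty_affine\<close>.\<close>

lemma fourier_translate: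
  fixes f :: "'a::euclidean_space \<Rightarrow> complex"
  shows "fourier (\<lambda>y. f (1 *\<^sub>R y + t)) \<xi> = iexp (t \<bullet> \<xi>) * fourier f \<xi>"
proof -
  have "(LINT y|lborel. exp (- \<i> * complex_of_real (y \<bullet> \<xi>)) * f (y + t)) =
      (LINT y|lborel. iexp (t \<bullet> \<xi>) * (exp (- \<i> * complex_of_real ((y + t) \<bullet> \<xi>)) * f (y + t)))"
    by (intro Bochner_Integration.integral_cong refl)
      (simp add: inner_add_left algebra_simps exp_diff exp_minus field_simps exp_add)
  also have "\<dots> = (LINT y|lborel. iexp (t \<bullet> \<xi>) * (exp (- \<i> * complex_of_real (y \<bullet> \<xi>)) * f y))"
    by (rule integral_lborel_translate)
  also have "\<dots> = iexp (t \<bullet> \<xi>) * (LINT y|lborel. exp (- \<i> * complex_of_real (y \<bullet> \<xi>)) * f y)"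
    by (rule integral_mult_right_zero)
  finally show ?thesis
    unfolding fourier_def by simp
qed

text \<open>Modulation recentres the transform at \<eta> and dilation rescales it. Negative
  \<open>s\<close> is allowed on purpose: for a real function it produces the complex conjugate of
  the transform.\<close>

lemma fourier_modulate_scale:
  fixes f :: "'a::euclidean_space \<Rightarrow> complex"
  assumes "s \<noteq> 0"
  shows "complex_of_real (\<bar>s\<bar> ^ DIM('a)) * fourier (\<lambda>y. iexp (y \<bullet> \<eta>) * f (s *\<^sub>R y)) (\<eta> + s *\<^sub>R \<zeta>) = fourier f \<zeta>"
proof -
  have "(LINT y|lborel. exp (- \<i> * complex_of_real (y \<bullet> \<zeta>)) * f y) =
      \<bar>s\<bar> ^ DIM('a) *\<^sub>R (LINT y|lborel. exp (- \<i> * complex_of_real ((s *\<^sub>R y) \<bullet> \<zeta>)) * f (s *\<^sub>R y))"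
    using integral_lborel_affine[OF assms, of "\<lambda>y. exp (- \<i> * complex_of_real (y \<bullet> \<zeta>)) * f y" 0] by simp
  also have "(LINT y|lborel. exp (- \<i> * complex_of_real ((s *\<^sub>R y) \<bullet> \<zeta>)) * f (s *\<^sub>R y)) =
      (LINT y|lborel. exp (- \<i> * complex_of_real (y \<bullet> (\<eta> + s *\<^sub>R \<zeta>))) * (iexp (y \<bullet> \<eta>) * f (s *\<^sub>R y)))"
    by (intro Bochner_Integration.integral_cong refl)
      (simp add: inner_add_right algebra_simps exp_diff exp_minus field_simps)
  finally show ?thesis
    unfolding fourier_def by (simp add: scaleR_conv_of_real mult_ac)
qed

lemma fourier_of_real_uminus:
  "fourier (\<lambda>y. complex_of_real (f y)) (- \<xi>) = cnj (fourier (\<lambda>y. complex_of_real (f y)) \<xi>)"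
  unfolding fourier_def by (simp add: exp_cnj flip: Bochner_Integration.integral_cnj)

context truncation
begin

lemma integral_chi_pos: "0 < (LINT y|lborel. chi y)"
proof -
  have "compact_support chi"
    unfolding compact_support_def using chi_eq_0
    by (intro exI[of _ "cball 0 2"]) auto
  then have int: "integrable lborel chi"
    using integrable_compact_support[OF chi_continuous] by blast
  have fin: "emeasure lborel (ball (0::'a) 1) < \<infinity>"
    by (rule emeasure_bounded_finite) simp
  have "0 < measure lborel (ball (0::'a) 1)"
    by (rule content_ball_pos) simp
  also have "\<dots> = (LINT y|lborel. indicator (ball 0 1) (y::'a))"
    by simp
  also have "\<dots> \<le> (LINT y|lborel. chi y)"
    using fin by (intro integral_mono int chi_bounds integrable_real_indicator) auto
  finally show ?thesis .
qed

text \<open>Since \<open>chi\<close> lives on the ball of radius 2, replacing the exponential by 1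
  changes the integral by at most 2 |\<zeta>| times the mass of \<open>chi\<close>, less than the
  mass itself. This gives the kernel |\<chi>^|^2 positive total mass.\<close>

lemma fourier_chi_nonzero:
  assumes \<zeta>: "norm \<zeta> < 1 / 2"
  shows "fourier (\<lambda>y. complex_of_real (chi y)) \<zeta> \<noteq> 0"
proof
  assume "fourier (\<lambda>y. complex_of_real (chi y)) \<zeta> = 0"
  then have 0: "(LINT y|lborel. exp (- \<i> * complex_of_real (y \<bullet> \<zeta>)) * complex_of_real (chi y)) = 0"
    by (simp add: fourier_def)
  have "compact_support chi"
    unfolding compact_support_def using chi_eq_0
    by (intro exI[of _ "cball 0 2"]) auto
  then have int: "integrable lborel chi"
    using integrable_compact_support[OF chi_continuous] by blast
  let ?e = "\<lambda>y. exp (- \<i> * complex_of_real (y \<bullet> \<zeta>))"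
  have inte: "integrable lborel (\<lambda>y. ?e y * complex_of_real (chi y))"
    by (rule Bochner_Integration.integrable_bound[OF int]) (auto simp: norm_mult)
  have "complex_of_real (LINT y|lborel. chi y) = (LINT y|lborel. (1 - ?e y) * complex_of_real (chi y))"
    using 0 int inte by (simp add: left_diff_distrib)
  also have "cmod \<dots> \<le> (LINT y|lborel. 2 * norm \<zeta> * chi y)"
  proof (rule norm_integral_le)
    fix y
    have "cmod (1 - ?e y) \<le> \<bar>y \<bullet> \<zeta>\<bar>"
      using iexp_approx1[of "- (y \<bullet> \<zeta>)" 0] by (simp add: norm_minus_commute)
    also have "\<dots> \<le> norm y * norm \<zeta>"
      by (rule Cauchy_Schwarz_ineq2)
    finally have "cmod ((1 - ?e y) * complex_of_real (chi y)) \<le> norm y * norm \<zeta> * chi y"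
      using chi_nonneg[of y] by (simp add: norm_mult mult_right_mono)
    also have "\<dots> \<le> 2 * norm \<zeta> * chi y"
    proof (cases "norm y \<ge> 2")
      case False
      then show ?thesis
        using chi_nonneg[of y] by (intro mult_right_mono) auto
    qed (simp add: chi_eq_0)
    finally show "cmod ((1 - ?e y) * complex_of_real (chi y)) \<le> 2 * norm \<zeta> * chi y" .
  qed (use int in simp)
  also have "\<dots> = 2 * norm \<zeta> * (LINT y|lborel. chi y)"
    by simp
  also have "\<dots> < 1 * (LINT y|lborel. chi y)"
    using \<zeta> integral_chi_pos by (intro mult_strict_right_mono) auto
  finally show False
    using integral_chi_pos by simp
qed

end

section \<open>Positivity of kernel averages\<close>

lemma (in even_kernel) cnj_transform: "cnj (transform y) = transform y"
proof -
  have "cnj (transform y) = (LINT \<xi>|lborel. iexp (y \<bullet> (- \<xi>)) * k (- \<xi>))"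
    unfolding transform_def Bochner_Integration.integral_cnj[symmetric]
    by (intro Bochner_Integration.integral_cong refl) (simp add: exp_cnj k_even)
  also have "\<dots> = transform y"
    unfolding transform_def by (rule integral_lborel_uminus)
  finally show ?thesis .
qed

lemma (in even_kernel) transform_eq_Re: "transform y = complex_of_real (Re (transform y))"
  using cnj_transform[of y] by (simp add: complex_eq_iff)

lemma (in even_kernel) integrable_kernel: "integrable lborel k"
  using integrable_norm[OF integrable_kernel_iexp[of 0]] by (simp add: k_nonneg)

lemma (in even_kernel) transform_0: "transform 0 = complex_of_real (integral\<^sup>L lborel k)"
  by (simp add: transform_def)

text \<open>The transform of an even nonnegative kernel is real and maximal at 0, so the difference
  is a nonnegative real number.\<close>

lemma (in even_kernel) cmod_transform_diff:
  "cmod (transform 0 - transform y) = Re (transform 0 - transform y)"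
proof -
  have "cmod (transform y) \<le> integral\<^sup>L lborel k"
    unfolding transform_def
    by (rule norm_integral_le[OF integrable_kernel]) (simp add: norm_mult k_nonneg)
  then have "Re (transform y) \<le> Re (transform 0)"
    using complex_Re_le_cmod[of "transform y"] by (simp add: transform_0)
  moreover have "transform 0 - transform y = complex_of_real (Re (transform 0) - Re (transform y))"
    using transform_eq_Re[of 0] transform_eq_Re[of y] by simp
  ultimately show ?thesis
    by (metis Re_complex_of_real abs_of_nonneg diff_ge_0_iff_ge norm_of_real)
qed

text \<open>After averaging, the integrand is a phase times a nonnegative number. Taking the modulus
  inside removes the phase, and at \<eta> = 0 the same step is an equality, so the bound is again an
  average of the exponent.\<close>

lemma (in levy_truncation) kernel_average_bound:
  assumes "even_kernel k"
  shows "cmod (LINT \<xi>|lborel. (lk_exponent chi \<beta> N (\<eta> + s *\<^sub>R \<xi>) - lk_exponent chi \<beta> N \<eta>) * k \<xi>) \<le>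
    cmod (LINT \<xi>|lborel. lk_exponent chi \<beta> N (0 + s *\<^sub>R \<xi>) * k \<xi>)"
proof -
  interpret even_kernel k by fact
  let ?d = "\<lambda>y. transform 0 - transform (s *\<^sub>R y)"
  have 0: "(LINT \<xi>|lborel. lk_exponent chi \<beta> N (0 + s *\<^sub>R \<xi>) * k \<xi>) = (LINT y|N. ?d y)"
    using integral_kernel_lk_exponent[OF assms, of \<beta> 0 s] by simp
  have d: "?d y = complex_of_real (cmod (?d y))" for y
    unfolding cmod_transform_diff
    using transform_eq_Re[of 0] transform_eq_Re[of "s *\<^sub>R y"] by simp
  have "cmod (LINT y|N. iexp (y \<bullet> \<eta>) * ?d y) \<le> (LINT y|N. cmod (iexp (y \<bullet> \<eta>) * ?d y))"
    by simp
  also have "\<dots> = (LINT y|N. cmod (?d y))"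
    by (simp add: norm_mult)
  also have "\<dots> = cmod (complex_of_real (LINT y|N. cmod (?d y)))"
    by (simp add: integral_nonneg_AE)
  also have "complex_of_real (LINT y|N. cmod (?d y)) = (LINT y|N. ?d y)"
    by (subst (2) d) (simp only: integral_complex_of_real)
  finally show ?thesis
    unfolding 0 integral_kernel_lk_exponent[OF assms] .
qed

text \<open>Evenness comes from \<open>f\<close> being real. For integrability one factor is bounded
  and the other carries the weight.\<close>

lemma even_kernel_fourier_square:
  fixes f :: "'a::euclidean_space \<Rightarrow> real"
  assumes f: "Cc_infty (\<lambda>y. complex_of_real (f y))"
  shows "even_kernel (\<lambda>\<xi>. (cmod (fourier (\<lambda>y. complex_of_real (f y)) \<xi>))\<^sup>2)"
proof
  note [measurable] = borel_measurable_fourier[OF f]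
  let ?F = "fourier (\<lambda>y. complex_of_real (f y))"
  show "(\<lambda>\<xi>. (cmod (?F \<xi>))\<^sup>2) \<in> borel_measurable borel"
    by measurable
  show "(cmod (?F (- \<xi>)))\<^sup>2 = (cmod (?F \<xi>))\<^sup>2" for \<xi>
    unfolding fourier_of_real_uminus by simp
  define B where "B = (2 * pi) powr (- real DIM('a)) * (LINT x|lborel. cmod (complex_of_real (f x)))"
  have B: "cmod (?F \<xi>) \<le> B" for \<xi>
    unfolding B_def by (rule fourier_bounded[OF f])
  show "integrable lborel (\<lambda>\<xi>. (1 + (norm \<xi>)\<^sup>2) * (cmod (?F \<xi>))\<^sup>2)"
  proof (rule Bochner_Integration.integrable_bound[OF integrable_mult_right[OF integrable_fourier_weighted[OF f], of B]])
    have "norm ((1 + (norm \<xi>)\<^sup>2) * (cmod (?F \<xi>))\<^sup>2) \<le> norm (B * ((1 + (norm \<xi>)\<^sup>2) * cmod (?F \<xi>)))" for \<xi>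
    proof -
      have "(1 + (norm \<xi>)\<^sup>2) * (cmod (?F \<xi>))\<^sup>2 = cmod (?F \<xi>) * ((1 + (norm \<xi>)\<^sup>2) * cmod (?F \<xi>))"
        by (simp add: power2_eq_square)
      also have "\<dots> \<le> B * ((1 + (norm \<xi>)\<^sup>2) * cmod (?F \<xi>))"
        by (intro mult_right_mono B) auto
      finally show ?thesis
        using order_trans[OF norm_ge_zero B] by (simp add: abs_mult)
    qed
    then show "AE \<xi> in lborel. norm ((1 + (norm \<xi>)\<^sup>2) * (cmod (?F \<xi>))\<^sup>2) \<le> norm (B * ((1 + (norm \<xi>)\<^sup>2) * cmod (?F \<xi>)))"
      by simp
  qed measurable
qed simp

context levy_family
begin

definition pd_operator :: "('a \<Rightarrow> complex) \<Rightarrow> 'a \<Rightarrow> complex" where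
  "pd_operator f x = - (LINT \<xi>|lborel. iexp (x \<bullet> \<xi>) * p x \<xi> * fourier f \<xi>)"

lemma continuous_imp_pd_operator_continuous:
  assumes cont: "\<And>\<xi>. continuous_on UNIV (\<lambda>x. p x \<xi>)" and f: "Cc_infty f"
  shows "continuous_on UNIV (pd_operator f)"
proof (clarsimp simp: continuous_on_sequentially)
  fix X :: "nat \<Rightarrow> 'a" and x assume X: "X \<longlonglongrightarrow> x"
  note [measurable] = borel_measurable_fourier[OF f]
  have "(\<lambda>n. LINT \<xi>|lborel. p (X n) (0 + 1 *\<^sub>R \<xi>) * (iexp (X n \<bullet> \<xi>) * fourier f \<xi>)) \<longlonglongrightarrow>
      (LINT \<xi>|lborel. p x (0 + 1 *\<^sub>R \<xi>) * (iexp (x \<bullet> \<xi>) * fourier f \<xi>))"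
  proof (rule integral_p_tendsto[OF X _ _ _ _ integrable_fourier_weighted[OF f]])
    show "(\<lambda>n. p (X n) \<xi>) \<longlonglongrightarrow> p x \<xi>" for \<xi>
      using cont[of \<xi>] X by (auto simp: continuous_on_sequentially o_def)
    show "(\<lambda>n. iexp (X n \<bullet> \<xi>) * fourier f \<xi>) \<longlonglongrightarrow> iexp (x \<bullet> \<xi>) * fourier f \<xi>" for \<xi>
      by (intro tendsto_intros X)
  qed (auto simp: norm_mult)
  from tendsto_minus[OF this] show "(pd_operator f \<circ> X) \<longlonglongrightarrow> pd_operator f x"
    by (simp add: o_def pd_operator_def mult_ac)
qed

lemma integrable_p_mult_fourier:
  assumes f: "Cc_infty f"
  shows "integrable lborel (\<lambda>\<xi>. p x \<xi> * fourier f \<xi>)"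
proof -
  note [measurable] = borel_measurable_fourier[OF f]
  obtain c where c: "\<And>\<xi>. cmod (p x \<xi>) \<le> c * (1 + (norm \<xi>)\<^sup>2)"
    using locally_bounded[of "{x}"] by auto
  show ?thesis
  proof (rule Bochner_Integration.integrable_bound[OF integrable_mult_right[OF integrable_fourier_weighted[OF f], of c]])
    have "norm (p x \<xi> * fourier f \<xi>) \<le> norm (c * ((1 + (norm \<xi>)\<^sup>2) * cmod (fourier f \<xi>)))" for \<xi>
      using order_trans[OF mult_right_mono[OF c norm_ge_zero] abs_ge_self, of \<xi> "fourier f \<xi>"]
      by (simp only: norm_mult[of "p x \<xi>"] real_norm_def mult.assoc)
    then show "AE \<xi> in lborel. norm (p x \<xi> * fourier f \<xi>) \<le> norm (c * ((1 + (norm \<xi>)\<^sup>2) * cmod (fourier f \<xi>)))"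
      by simp
  qed measurable
qed

text \<open>The operator is applied to the translate of \<open>f\<close> by x + z. Translation by x
  freezes the exponential at the limit point, while z leaves the extra modulation that later builds
  a second Fourier transform.\<close>

lemma pd_operator_imp_fourier_tendsto:
  assumes cont: "\<And>f. Cc_infty f \<Longrightarrow> continuous_on UNIV (pd_operator f)"
    and X: "X \<longlonglongrightarrow> x" and f: "Cc_infty f"
  shows "(\<lambda>n. LINT \<xi>|lborel. p (X n) \<xi> * fourier f \<xi> * iexp (- (z \<bullet> \<xi>))) \<longlonglongrightarrow>
    (LINT \<xi>|lborel. p x \<xi> * fourier f \<xi> * iexp (- (z \<bullet> \<xi>)))"
proof -
  define g where "g = (\<lambda>y. f (1 *\<^sub>R y + (- (x + z))))"
  have g: "Cc_infty g"
    unfolding g_def by (rule Cc_infty_affine[OF f]) simp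
  note [measurable] = borel_measurable_fourier[OF g]
  have fg: "iexp (x \<bullet> \<xi>) * fourier g \<xi> = fourier f \<xi> * iexp (- (z \<bullet> \<xi>))" for \<xi>
  proof -
    have "iexp (x \<bullet> \<xi>) * iexp (- (x + z) \<bullet> \<xi>) = iexp (- (z \<bullet> \<xi>))"
      unfolding exp_add[symmetric] by (simp add: inner_diff_left inner_add_left algebra_simps)
    then show ?thesis
      unfolding g_def fourier_translate by (simp only: mult_ac)
  qed
  have 1: "(\<lambda>n. - pd_operator g (X n)) \<longlonglongrightarrow> - pd_operator g x"
    using cont[OF g] X by (intro tendsto_minus) (auto simp: continuous_on_sequentially o_def)
  \<comment> \<open>Convergence of \<open>p (X n)\<close> is not known here. The integrand tends to
    0 because the bracket does and \<open>p (X n)\<close> is bounded at each frequency.\<close>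
  have 2: "(\<lambda>n. LINT \<xi>|lborel. p (X n) (0 + 1 *\<^sub>R \<xi>) * ((iexp (x \<bullet> \<xi>) - iexp (X n \<bullet> \<xi>)) * fourier g \<xi>)) \<longlonglongrightarrow>
      (LINT \<xi>|(lborel :: 'a measure). 0)"
  proof (rule integral_p_dominated_convergence[OF X, where w="\<lambda>\<xi>. 2 * cmod (fourier g \<xi>)"])
    obtain c where c: "c > 0" "\<And>y \<xi>. y \<in> insert x (range X) \<Longrightarrow> cmod (p y \<xi>) \<le> c * (1 + (norm \<xi>)\<^sup>2)"
      using locally_bounded[OF compact_sequence_with_limit[OF X]] by blast
    fix \<xi> :: 'a
    have "(\<lambda>n. (iexp (x \<bullet> \<xi>) - iexp (X n \<bullet> \<xi>)) * fourier g \<xi>) \<longlonglongrightarrow> (iexp (x \<bullet> \<xi>) - iexp (x \<bullet> \<xi>)) * fourier g \<xi>"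
      by (intro tendsto_intros X)
    then have "(\<lambda>n. (iexp (x \<bullet> \<xi>) - iexp (X n \<bullet> \<xi>)) * fourier g \<xi>) \<longlonglongrightarrow> 0"
      by simp
    moreover have "Bseq (\<lambda>n. p (X n) (0 + 1 *\<^sub>R \<xi>))"
      using c(2) by (intro BseqI'[of _ "c * (1 + (norm \<xi>)\<^sup>2)"]) simp
    ultimately show "(\<lambda>n. p (X n) (0 + 1 *\<^sub>R \<xi>) * ((iexp (x \<bullet> \<xi>) - iexp (X n \<bullet> \<xi>)) * fourier g \<xi>)) \<longlonglongrightarrow> 0"
      using bounded_bilinear.Bfun_prod_Zfun[OF bounded_bilinear_mult] by (simp add: tendsto_Zfun_iff)
    show "cmod ((iexp (x \<bullet> \<xi>) - iexp (X n \<bullet> \<xi>)) * fourier g \<xi>) \<le> 2 * cmod (fourier g \<xi>)" for n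
      unfolding norm_mult using norm_triangle_ineq4[of "iexp (x \<bullet> \<xi>)" "iexp (X n \<bullet> \<xi>)"]
      by (intro mult_right_mono) auto
  next
    show "integrable lborel (\<lambda>\<xi>. (1 + (norm \<xi>)\<^sup>2) * (2 * cmod (fourier g \<xi>)))"
      using integrable_mult_right[OF integrable_fourier_weighted[OF g], of 2] by (simp add: mult_ac)
  qed auto
  have int: "integrable lborel (\<lambda>\<xi>. iexp (u \<bullet> \<xi>) * (p y \<xi> * fourier g \<xi>))" for u y
    by (rule Bochner_Integration.integrable_bound[OF integrable_p_mult_fourier[OF g, of y]]) (auto simp: norm_mult)
  have split: "(LINT \<xi>|lborel. p y \<xi> * fourier f \<xi> * iexp (- (z \<bullet> \<xi>))) =
      - pd_operator g y + (LINT \<xi>|lborel. p y (0 + 1 *\<^sub>R \<xi>) * ((iexp (x \<bullet> \<xi>) - iexp (y \<bullet> \<xi>)) * fourier g \<xi>))" for y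
  proof -
    have "(LINT \<xi>|lborel. p y (0 + 1 *\<^sub>R \<xi>) * ((iexp (x \<bullet> \<xi>) - iexp (y \<bullet> \<xi>)) * fourier g \<xi>)) =
        (LINT \<xi>|lborel. iexp (x \<bullet> \<xi>) * (p y \<xi> * fourier g \<xi>)) - (LINT \<xi>|lborel. iexp (y \<bullet> \<xi>) * (p y \<xi> * fourier g \<xi>))"
      using int[of x y] int[of y y] by (subst Bochner_Integration.integral_diff[symmetric]) (auto simp: algebra_simps)
    moreover have "(LINT \<xi>|lborel. p y \<xi> * fourier f \<xi> * iexp (- (z \<bullet> \<xi>))) = (LINT \<xi>|lborel. iexp (x \<bullet> \<xi>) * (p y \<xi> * fourier g \<xi>))"
      by (intro Bochner_Integration.integral_cong refl) (metis fg mult.assoc mult.commute)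
    ultimately show ?thesis
      by (simp add: pd_operator_def mult.assoc)
  qed
  have "(\<lambda>n. LINT \<xi>|lborel. p (X n) \<xi> * fourier f \<xi> * iexp (- (z \<bullet> \<xi>))) \<longlonglongrightarrow> - pd_operator g x + 0"
    unfolding split using tendsto_add[OF 1 2] by simp
  then show ?thesis
    using split[of x] by simp
qed

text \<open>Multiplying by a second Fourier transform amounts to averaging over translates, so
  the test functions may be products of two Fourier transforms without forming convolutions.\<close>

lemma pd_operator_imp_fourier_product_tendsto:
  assumes cont: "\<And>f. Cc_infty f \<Longrightarrow> continuous_on UNIV (pd_operator f)"
    and X: "X \<longlonglongrightarrow> x" and f: "Cc_infty f" and g: "Cc_infty g"
  shows "(\<lambda>n. LINT \<xi>|lborel. p (X n) \<xi> * (fourier f \<xi> * fourier g \<xi>)) \<longlonglongrightarrow>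
    (LINT \<xi>|lborel. p x \<xi> * (fourier f \<xi> * fourier g \<xi>))"
proof -
  note [measurable] = borel_measurable_fourier[OF f]
  have [measurable]: "g \<in> borel_measurable borel"
    using Cc_infty_continuous[OF g] by (rule borel_measurable_continuous_onI)
  define c0 where "c0 = complex_of_real ((2 * pi) powr (- real DIM('a)))"
  let ?J = "\<lambda>y z. LINT \<xi>|lborel. p y \<xi> * fourier f \<xi> * iexp (- (z \<bullet> \<xi>))"
  note intf = integrable_p_mult_fourier[OF f]
  have eq: "(LINT \<xi>|lborel. p y \<xi> * (fourier f \<xi> * fourier g \<xi>)) = c0 * (LINT z|lborel. g z * ?J y z)" for y
  proof -
    let ?h = "\<lambda>z \<xi>. (p y \<xi> * fourier f \<xi>) * (iexp (- (z \<bullet> \<xi>)) * g z)"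
    have n: "norm (?h z \<xi>) = cmod (g z) * cmod (p y \<xi> * fourier f \<xi>)" for z \<xi>
      by (simp add: norm_mult)
    have h: "integrable (lborel \<Otimes>\<^sub>M lborel) (\<lambda>(z, \<xi>). ?h z \<xi>)"
    proof (rule lborel_pair.Fubini_integrable)
      show "(\<lambda>(z, \<xi>). ?h z \<xi>) \<in> borel_measurable (lborel \<Otimes>\<^sub>M lborel)"
        by measurable
      have "(LINT \<xi>|lborel. norm (?h z \<xi>)) = cmod (g z) * (LINT \<xi>|lborel. cmod (p y \<xi> * fourier f \<xi>))" for z
        unfolding n by (rule integral_mult_right_zero)
      then show "integrable lborel (\<lambda>z. LINT \<xi>|lborel. norm (case (z, \<xi>) of (z, \<xi>) \<Rightarrow> ?h z \<xi>))"
        using Cc_infty_integrable[OF g] by simp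
      have "integrable lborel (?h z)" for z
      proof (rule Bochner_Integration.integrable_bound[OF integrable_mult_right[OF integrable_norm[OF intf[of y]], of "cmod (g z)"]])
        show "AE \<xi> in lborel. norm (?h z \<xi>) \<le> norm (cmod (g z) * cmod (p y \<xi> * fourier f \<xi>))"
          unfolding n real_norm_def by (intro AE_I2 abs_ge_self)
      qed measurable
      then show "AE z in lborel. integrable lborel (\<lambda>\<xi>. case (z, \<xi>) of (z, \<xi>) \<Rightarrow> ?h z \<xi>)"
        by simp
    qed
    have "(LINT \<xi>|lborel. p y \<xi> * (fourier f \<xi> * fourier g \<xi>)) = (LINT \<xi>|lborel. c0 * (LINT z|lborel. ?h z \<xi>))"
    proof (intro Bochner_Integration.integral_cong refl)
      fix \<xi> :: 'a
      have "fourier g \<xi> = c0 * (LINT z|lborel. iexp (- (z \<bullet> \<xi>)) * g z)"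
        by (simp add: fourier_def c0_def)
      moreover define I where "I = (LINT z|lborel. iexp (- (z \<bullet> \<xi>)) * g z)"
      moreover have "(LINT z|lborel. ?h z \<xi>) = p y \<xi> * fourier f \<xi> * I"
        unfolding I_def by (rule integral_mult_right_zero)
      ultimately show "p y \<xi> * (fourier f \<xi> * fourier g \<xi>) = c0 * (LINT z|lborel. ?h z \<xi>)"
        by (simp only: mult_ac)
    qed
    also have "\<dots> = c0 * (LINT \<xi>|lborel. LINT z|lborel. ?h z \<xi>)"
      by (rule integral_mult_right_zero)
    also have "(LINT \<xi>|lborel. LINT z|lborel. ?h z \<xi>) = (LINT z|lborel. LINT \<xi>|lborel. ?h z \<xi>)"
      by (rule lborel_pair.Fubini_integral[OF h])
    also have "\<dots> = (LINT z|lborel. g z * ?J y z)"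
    proof (intro Bochner_Integration.integral_cong refl)
      fix z
      have "(LINT \<xi>|lborel. ?h z \<xi>) = (LINT \<xi>|lborel. g z * (p y \<xi> * fourier f \<xi> * iexp (- (z \<bullet> \<xi>))))"
        by (intro Bochner_Integration.integral_cong refl) (simp only: mult_ac)
      then show "(LINT \<xi>|lborel. ?h z \<xi>) = g z * ?J y z"
        by (simp only: integral_mult_right_zero)
    qed
    finally show ?thesis .
  qed
  obtain c where c: "c > 0" "\<And>y \<xi>. y \<in> insert x (range X) \<Longrightarrow> cmod (p y \<xi>) \<le> c * (1 + (norm \<xi>)\<^sup>2)"
    using locally_bounded[OF compact_sequence_with_limit[OF X]] by blast
  let ?D = "LINT \<xi>|lborel. c * ((1 + (norm \<xi>)\<^sup>2) * cmod (fourier f \<xi>))"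
  have JD: "cmod (?J (X n) z) \<le> ?D" for n z
  proof (rule norm_integral_le)
    fix \<xi> :: 'a
    show "cmod (p (X n) \<xi> * fourier f \<xi> * iexp (- (z \<bullet> \<xi>))) \<le> c * ((1 + (norm \<xi>)\<^sup>2) * cmod (fourier f \<xi>))"
      using mult_right_mono[OF c(2)[of "X n" \<xi>], of "cmod (fourier f \<xi>)"] by (simp add: norm_mult mult.assoc)
  qed (intro integrable_mult_right integrable_fourier_weighted f)
  have "(\<lambda>n. LINT z|lborel. g z * ?J (X n) z) \<longlonglongrightarrow> (LINT z|lborel. g z * ?J x z)"
  proof (rule integral_dominated_convergence[where w="\<lambda>z. cmod (g z) * ?D"])
    show "AE z in lborel. (\<lambda>n. g z * ?J (X n) z) \<longlonglongrightarrow> g z * ?J x z"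
      by (intro AE_I2 tendsto_mult tendsto_const pd_operator_imp_fourier_tendsto[OF cont X f])
    show "AE z in lborel. cmod (g z * ?J (X n) z) \<le> cmod (g z) * ?D" for n
      unfolding norm_mult by (intro AE_I2 mult_left_mono JD) auto
    show "integrable lborel (\<lambda>z. cmod (g z) * ?D)"
      using Cc_infty_integrable[OF g] by simp
  qed measurable
  then show ?thesis
    unfolding eq by (intro tendsto_mult tendsto_const)
qed

text \<open>The order of choices matters: the scale \<open>s\<close> is fixed by the behaviour at
  \<open>x\<close> alone, and for that \<open>s\<close> both the average and its error bound
  converge along the sequence.\<close>

lemma pd_operator_continuous_imp_continuous:
  assumes chi: "Cc_infty chi"
    and cont: "\<And>f. Cc_infty f \<Longrightarrow> continuous_on UNIV (pd_operator f)"
  shows "continuous_on UNIV (\<lambda>x. p x \<eta>)"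
proof (clarsimp simp: continuous_on_sequentially)
  fix X :: "nat \<Rightarrow> 'a" and x assume X: "X \<longlonglongrightarrow> x"
  let ?c = "\<lambda>y. complex_of_real (chi y)"
  have c: "Cc_infty ?c"
    by (rule Cc_infty_bounded_linear[OF bounded_linear_of_real chi])
  define k where "k = (\<lambda>\<xi>. (cmod (fourier ?c \<xi>))\<^sup>2)"
  interpret even_kernel k
    unfolding k_def by (rule even_kernel_fourier_square[OF c])
  have ek: "even_kernel k" ..
  define k0 where "k0 = integral\<^sup>L lborel k"
  have k0: "k0 > 0"
  proof -
    have "k0 \<noteq> 0"
    proof
      assume "k0 = 0"
      then have "AE \<xi> in lborel. k \<xi> = 0"
        using integral_nonneg_eq_0_iff_AE[OF integrable_kernel] k_nonneg by (simp add: k0_def)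
      then have "AE \<xi> in lborel. \<xi> \<notin> ball (0::'a) (1 / 2)"
        by eventually_elim (use fourier_chi_nonzero in \<open>auto simp: k_def\<close>)
      then have "emeasure lborel (ball (0::'a) (1 / 2)) = 0"
        by (subst AE_iff_measurable[symmetric, of _ _ "\<lambda>\<xi>. \<xi> \<notin> ball 0 (1 / 2)"]) auto
      then show False
        using content_ball_pos[of "1 / 2" "0::'a"] by (simp add: measure_def)
    qed
    moreover have "k0 \<ge> 0"
      unfolding k0_def by (rule integral_nonneg_AE) (simp add: k_nonneg)
    ultimately show ?thesis by simp
  qed
  have avg: "(\<lambda>n. LINT \<xi>|lborel. p (X n) (\<eta> + s *\<^sub>R \<xi>) * k \<xi>) \<longlonglongrightarrow> (LINT \<xi>|lborel. p x (\<eta> + s *\<^sub>R \<xi>) * k \<xi>)"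
    if "s > 0" for \<eta> s
  proof -
    \<comment> \<open>Both transforms are recentred at \<eta> and rescaled. The sign flip in
      \<open>g\<close> conjugates the second factor, so after the change of variables the product is
      |\<chi>^|^2 up to a power of \<open>s\<close>.\<close>
    define f where "f = (\<lambda>y. iexp (y \<bullet> \<eta>) * ?c (s *\<^sub>R y))"
    define g where "g = (\<lambda>y. iexp (y \<bullet> \<eta>) * ?c ((- s) *\<^sub>R y))"
    have f: "Cc_infty f"
      using Cc_infty_iexp_mult[OF Cc_infty_affine[OF c, of s 0], of \<eta>] that by (simp add: f_def)
    have g: "Cc_infty g"
      using Cc_infty_iexp_mult[OF Cc_infty_affine[OF c, of "- s" 0], of \<eta>] that by (simp add: g_def)
    let ?S = "complex_of_real (s ^ DIM('a))"
    have fs: "?S * fourier f (\<eta> + s *\<^sub>R \<xi>) = fourier ?c \<xi>" for \<xi>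
      using fourier_modulate_scale[of s \<eta> ?c \<xi>] that by (simp add: f_def)
    have gs: "?S * fourier g (\<eta> + s *\<^sub>R \<xi>) = cnj (fourier ?c \<xi>)" for \<xi>
      using fourier_modulate_scale[of "- s" \<eta> ?c "- \<xi>"] that by (simp add: g_def fourier_of_real_uminus)
    have "(LINT \<xi>|lborel. p y (\<eta> + s *\<^sub>R \<xi>) * k \<xi>) = ?S * (LINT \<xi>|lborel. p y \<xi> * (fourier f \<xi> * fourier g \<xi>))" for y
    proof -
      have "p y (\<eta> + s *\<^sub>R \<xi>) * k \<xi> =
          (?S * ?S) * (p y (\<eta> + s *\<^sub>R \<xi>) * (fourier f (\<eta> + s *\<^sub>R \<xi>) * fourier g (\<eta> + s *\<^sub>R \<xi>)))" for \<xi>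
      proof -
        have "complex_of_real (k \<xi>) = (?S * fourier f (\<eta> + s *\<^sub>R \<xi>)) * (?S * fourier g (\<eta> + s *\<^sub>R \<xi>))"
          unfolding fs gs k_def by (simp only: complex_norm_square)
        then show ?thesis by (simp only: mult_ac)
      qed
      then have "(LINT \<xi>|lborel. p y (\<eta> + s *\<^sub>R \<xi>) * k \<xi>) =
          (?S * ?S) * (LINT \<xi>|lborel. p y (\<eta> + s *\<^sub>R \<xi>) * (fourier f (\<eta> + s *\<^sub>R \<xi>) * fourier g (\<eta> + s *\<^sub>R \<xi>)))"
        by (simp only: integral_mult_right_zero)
      also have "\<dots> = ?S * (LINT \<xi>|lborel. p y \<xi> * (fourier f \<xi> * fourier g \<xi>))"
        using integral_lborel_affine[of s "\<lambda>\<xi>. p y \<xi> * (fourier f \<xi> * fourier g \<xi>)" \<eta>] that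
        by (simp add: scaleR_conv_of_real)
      finally show ?thesis .
    qed
    then show ?thesis
      using pd_operator_imp_fourier_product_tendsto[OF cont X f g] by (simp only: tendsto_mult tendsto_const)
  qed
  have intp: "integrable lborel (\<lambda>\<xi>. p y (\<eta> + s *\<^sub>R \<xi>) * k \<xi>)" for y \<eta> s
  proof -
    obtain c where "\<And>x \<xi>. x \<in> {y} \<Longrightarrow> cmod (p x (\<eta> + s *\<^sub>R \<xi>)) \<le> c * (1 + (norm \<xi>)\<^sup>2)"
      using p_affine_bound[OF compact_sing, of y \<eta> s] by metis
    then show ?thesis
      by (intro integrable_kernel_mult) auto
  qed
  \<comment> \<open>\<open>A\<close> averages p around \<eta>; \<open>T\<close> averages around 0
    and bounds the distance of \<open>A\<close> from k0 p(y, \<eta>).\<close>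
  define A where "A = (\<lambda>s y. LINT \<xi>|lborel. p y (\<eta> + s *\<^sub>R \<xi>) * k \<xi>)"
  define T where "T = (\<lambda>s y. LINT \<xi>|lborel. p y (0 + s *\<^sub>R \<xi>) * k \<xi>)"
  have AT: "cmod (A s y - k0 * p y \<eta>) \<le> cmod (T s y)" for s y
  proof -
    have "A s y - k0 * p y \<eta> = (LINT \<xi>|lborel. (p y (\<eta> + s *\<^sub>R \<xi>) - p y \<eta>) * k \<xi>)"
      unfolding A_def k0_def left_diff_distrib using intp[of y \<eta> s] integrable_kernel
      by (subst Bochner_Integration.integral_diff) auto
    then show ?thesis
      unfolding T_def using levy_truncation.kernel_average_bound[OF levy_truncation_nu ek] by simp
  qed
  have T0: "(\<lambda>m. T (1 / real (Suc m)) x) \<longlonglongrightarrow> 0"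
  proof -
    obtain c where c: "c > 0" "\<And>\<xi>. cmod (p x \<xi>) \<le> c * (1 + (norm \<xi>)\<^sup>2)"
      using locally_bounded[of "{x}"] by auto
    have "(\<lambda>m. LINT \<xi>|lborel. p x (0 + (1 / real (Suc m)) *\<^sub>R \<xi>) * k \<xi>) \<longlonglongrightarrow> (LINT \<xi>|(lborel::'a measure). 0)"
    proof (rule integral_dominated_convergence[where w="\<lambda>\<xi>. c * ((1 + (norm \<xi>)\<^sup>2) * k \<xi>)"])
      have "isCont (p x) 0"
        using levy_truncation.lk_exponent_continuous_at_0[OF levy_truncation_nu] by (simp add: isCont_def)
      moreover have "(\<lambda>m. 0 + (1 / real (Suc m)) *\<^sub>R \<xi>) \<longlonglongrightarrow> 0 + 0 *\<^sub>R \<xi>" for \<xi> :: 'a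
        using LIMSEQ_inverse_real_of_nat by (intro tendsto_intros) (simp add: inverse_eq_divide)
      ultimately have "(\<lambda>m. p x (0 + (1 / real (Suc m)) *\<^sub>R \<xi>)) \<longlonglongrightarrow> p x 0" for \<xi>
        by (intro isCont_tendsto_compose[of 0 "p x"]) auto
      then have "(\<lambda>m. p x (0 + (1 / real (Suc m)) *\<^sub>R \<xi>)) \<longlonglongrightarrow> 0" for \<xi>
        unfolding lk_exponent_0 .
      then show "AE \<xi> in lborel. (\<lambda>m. p x (0 + (1 / real (Suc m)) *\<^sub>R \<xi>) * k \<xi>) \<longlonglongrightarrow> 0"
        by (intro AE_I2 tendsto_mult_left_zero)
      fix m
      have "cmod (p x (0 + (1 / real (Suc m)) *\<^sub>R \<xi>) * k \<xi>) \<le> c * ((1 + (norm \<xi>)\<^sup>2) * k \<xi>)" for \<xi>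
      proof -
        have "norm (0 + (1 / real (Suc m)) *\<^sub>R \<xi>) \<le> norm \<xi>"
          by (simp add: divide_le_eq algebra_simps)
        then have "c * (1 + (norm (0 + (1 / real (Suc m)) *\<^sub>R \<xi>))\<^sup>2) \<le> c * (1 + (norm \<xi>)\<^sup>2)"
          using c(1) by (intro mult_left_mono add_left_mono power_mono) auto
        then have "cmod (p x (0 + (1 / real (Suc m)) *\<^sub>R \<xi>)) * k \<xi> \<le> c * (1 + (norm \<xi>)\<^sup>2) * k \<xi>"
          by (intro mult_right_mono k_nonneg order_trans[OF c(2)])
        then show ?thesis
          by (simp only: norm_mult norm_of_real abs_of_nonneg[OF k_nonneg] mult.assoc)
      qed
      then show "AE \<xi> in lborel. cmod (p x (0 + (1 / real (Suc m)) *\<^sub>R \<xi>) * k \<xi>) \<le> c * ((1 + (norm \<xi>)\<^sup>2) * k \<xi>)"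
        by (intro AE_I2)
    qed (use k_integrable in auto)
    then show ?thesis
      by (simp add: T_def)
  qed
  have "(\<lambda>n. p (X n) \<eta>) \<longlonglongrightarrow> p x \<eta>"
  proof (rule tendstoI)
    fix \<epsilon> :: real assume "\<epsilon> > 0"
    \<comment> \<open>Three errors below \<delta> occur: the change of \<open>A\<close>, and
      \<open>T\<close> at \<open>X n\<close> and at \<open>x\<close>. They add up to less than 4
      \<delta> = k0 \<epsilon>, and k0 is divided out at the end.\<close>
    define \<delta> where "\<delta> = \<epsilon> * k0 / 4"
    have \<delta>: "\<delta> > 0" using \<open>\<epsilon> > 0\<close> k0 by (simp add: \<delta>_def)
    obtain m where m: "cmod (T (1 / real (Suc m)) x) < \<delta>"
      using tendstoD[OF T0 \<delta>] eventually_happens[of _ sequentially] by (auto simp: dist_norm)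
    define s where "s = 1 / real (Suc m)"
    have s: "s > 0" "cmod (T s x) < \<delta>" using m by (auto simp: s_def)
    have A: "(\<lambda>n. A s (X n)) \<longlonglongrightarrow> A s x" and T: "(\<lambda>n. T s (X n)) \<longlonglongrightarrow> T s x"
      unfolding A_def T_def by (intro avg s(1))+
    have "\<forall>\<^sub>F n in sequentially. cmod (A s (X n) - A s x) < \<delta>"
      using tendstoD[OF A \<delta>] by (simp only: dist_norm)
    moreover have "\<forall>\<^sub>F n in sequentially. cmod (T s (X n)) < \<delta>"
      by (rule order_tendstoD(2)[OF tendsto_norm[OF T] s(2)])
    ultimately show "\<forall>\<^sub>F n in sequentially. dist (p (X n) \<eta>) (p x \<eta>) < \<epsilon>"
    proof eventually_elim
      case (elim n)
      have "k0 * p (X n) \<eta> - k0 * p x \<eta> = (A s (X n) - A s x) - (A s (X n) - k0 * p (X n) \<eta>) + (A s x - k0 * p x \<eta>)"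
        by simp
      also have "cmod \<dots> \<le> cmod (A s (X n) - A s x) + cmod (A s (X n) - k0 * p (X n) \<eta>) + cmod (A s x - k0 * p x \<eta>)"
        by (intro order_trans[OF norm_triangle_ineq] add_right_mono norm_triangle_ineq4)
      also have "\<dots> < 4 * \<delta>"
        using elim AT[of s "X n"] AT[of s x] s(2) \<delta> by linarith
      finally have "cmod (k0 * p (X n) \<eta> - k0 * p x \<eta>) < k0 * \<epsilon>"
        by (simp add: \<delta>_def mult_ac)
      then have "k0 * cmod (p (X n) \<eta> - p x \<eta>) < k0 * \<epsilon>"
        using k0 by (simp add: norm_mult flip: right_diff_distrib)
      then show ?case
        using k0 by (simp add: dist_norm)
    qed
  qed
  then show "((\<lambda>x. p x \<eta>) \<circ> X) \<longlonglongrightarrow> p x \<eta>"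
    by (simp add: o_def)
qed

end

text \<open>Comparing (i) with (ii), (iii) and (iv) in turn makes all four equivalent. Suprema are
  taken in \<open>ennreal\<close>, where they exist without a boundedness check and are 0 over the
  empty set, so the limits have their intended meaning for every compact K.\<close>

theorem theoremA1:
  fixes chi :: "'a::euclidean_space \<Rightarrow> real"
    and q0 :: "'a \<Rightarrow> real" and b :: "'a \<Rightarrow> 'a" and \<nu> :: "'a \<Rightarrow> 'a measure"
    and q :: "'a \<Rightarrow> 'a \<Rightarrow> complex"
  assumes chi_smooth: "Cc_infty chi"
    and chi_bounds: "\<forall>y. indicator (ball 0 1) y \<le> chi y \<and> chi y \<le> indicator (ball 0 2) y"
    and nu_sets: "\<forall>x. sets (\<nu> x) = sets borel"
    and nu_zero: "\<forall>x. emeasure (\<nu> x) {0} = 0"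
    and nu_levy: "\<forall>x. (\<integral>\<^sup>+ y. ennreal (min ((norm y)\<^sup>2) 1) \<partial>\<nu> x) < \<infinity>"
    and q0_nonneg: "\<forall>x. q0 x \<ge> 0"
    and q_def: "q = lk_symbol chi q0 b \<nu>"
    and loc_bdd: "\<forall>K. compact K \<longrightarrow>
         (\<exists>c>0. \<forall>x\<in>K. \<forall>\<xi>. cmod (q x \<xi>) \<le> c * (1 + (norm \<xi>)\<^sup>2))"
  shows
   "((\<forall>\<xi>. continuous_on UNIV (\<lambda>x. q x \<xi> - q x 0))
     \<longleftrightarrow> ((\<forall>\<xi>. continuous_on UNIV (\<lambda>x. q x \<xi> - q x 0)) \<and>
          (\<forall>K. compact K \<longrightarrow>
             ((\<lambda>\<xi>. SUP x\<in>K. ennreal (cmod (q x \<xi> - q x 0))) \<longlongrightarrow> 0) (at 0))))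
    \<and> ((\<forall>\<xi>. continuous_on UNIV (\<lambda>x. q x \<xi> - q x 0))
     \<longleftrightarrow> (continuous_on UNIV b \<and>
          (\<forall>f x. Cc_punctured f \<longrightarrow>
             ((\<lambda>z. LINT y|\<nu> z. f y) \<longlongrightarrow> (LINT y|\<nu> x. f y)) (at x)) \<and>
          (\<forall>K. compact K \<longrightarrow>
             ((\<lambda>R. SUP x\<in>K. emeasure (\<nu> x) (- ball 0 R)) \<longlongrightarrow> 0) at_top) \<and>
          (\<forall>K. compact K \<longrightarrow>
             ((\<lambda>r. SUP x\<in>K. \<integral>\<^sup>+ y. ennreal ((norm y)\<^sup>2) * indicator (cball 0 r) y \<partial>\<nu> x)
                \<longlongrightarrow> 0) (at_right 0))))
    \<and> ((\<forall>\<xi>. continuous_on UNIV (\<lambda>x. q x \<xi> - q x 0))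
     \<longleftrightarrow> (\<forall>f. Cc_infty f \<longrightarrow> continuous_on UNIV (pdo q f)))"
proof -
  interpret levy_family chi b \<nu>
  proof
    show "continuous_on UNIV chi"
      by (rule Cc_infty_continuous[OF chi_smooth])
    show "indicator (ball 0 1) y \<le> chi y" "chi y \<le> indicator (ball 0 2) y" for y
      using chi_bounds by simp_all
    show "sets (\<nu> x) = sets borel" "emeasure (\<nu> x) {0} = 0"
      "(\<integral>\<^sup>+ y. ennreal (min ((norm y)\<^sup>2) 1) \<partial>\<nu> x) < \<infinity>" for x
      using nu_sets nu_zero nu_levy by blast+
    fix K :: "'a set" assume "compact K"
    with loc_bdd have "\<exists>c>0. \<forall>x\<in>K. \<forall>\<xi>. cmod (q x \<xi>) \<le> c * (1 + (norm \<xi>)\<^sup>2)"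
      by simp
    then obtain c where c: "c > 0" "\<And>x \<xi>. x \<in> K \<Longrightarrow> cmod (q x \<xi>) \<le> c * (1 + (norm \<xi>)\<^sup>2)"
      by auto
    \<comment> \<open>At \<xi> = 0 the hypothesis bounds q(x, 0) by c, so subtracting it at most
      doubles the constant.\<close>
    have "cmod (lk_exponent chi (b x) (\<nu> x) \<xi>) \<le> (2 * c) * (1 + (norm \<xi>)\<^sup>2)" if "x \<in> K" for x \<xi>
    proof -
      have "cmod (q x \<xi> - q x 0) \<le> c * (1 + (norm \<xi>)\<^sup>2) + c * 1"
        using norm_triangle_ineq4[of "q x \<xi>" "q x 0"] c(2)[OF that, of \<xi>] c(2)[OF that, of 0] by simp
      also have "\<dots> \<le> c * (1 + (norm \<xi>)\<^sup>2) + c * (1 + (norm \<xi>)\<^sup>2)"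
        using c(1) by (intro add_left_mono mult_left_mono) auto
      finally show ?thesis
        by (simp add: q_def lk_symbol_diff)
    qed
    then show "\<exists>c>0. \<forall>x\<in>K. \<forall>\<xi>. cmod (lk_exponent chi (b x) (\<nu> x) \<xi>) \<le> c * (1 + (norm \<xi>)\<^sup>2)"
      using c(1) by (intro exI[of _ "2 * c"]) auto
  qed
  have q: "q x \<xi> - q x 0 = p x \<xi>" for x \<xi>
    by (simp add: q_def lk_symbol_diff)
  have pdo: "pdo q f = pd_operator f" for f
    by (simp add: fun_eq_iff pdo_def pd_operator_def q)
  let ?cont = "\<forall>\<xi>. continuous_on UNIV (\<lambda>x. p x \<xi>)"
  have "?cont \<longleftrightarrow> ?cont \<and> (\<forall>K. compact K \<longrightarrow> ((\<lambda>\<xi>. SUP x\<in>K. ennreal (cmod (p x \<xi>))) \<longlongrightarrow> 0) (at 0))"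
    using continuous_imp_uniform_at_0 by blast
  moreover have "?cont \<longleftrightarrow> (continuous_on UNIV b \<and>
          (\<forall>f x. Cc_punctured f \<longrightarrow>
             ((\<lambda>z. LINT y|\<nu> z. f y) \<longlongrightarrow> (LINT y|\<nu> x. f y)) (at x)) \<and>
          (\<forall>K. compact K \<longrightarrow>
             ((\<lambda>R. SUP x\<in>K. emeasure (\<nu> x) (- ball 0 R)) \<longlongrightarrow> 0) at_top) \<and>
          (\<forall>K. compact K \<longrightarrow>
             ((\<lambda>r. SUP x\<in>K. \<integral>\<^sup>+ y. ennreal ((norm y)\<^sup>2) * indicator (cball 0 r) y \<partial>\<nu> x)
                \<longlongrightarrow> 0) (at_right 0)))" (is "_ \<longleftrightarrow> ?triplet")
  proof
    assume ?cont
    then show ?triplet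
      using continuous_imp_drift_continuous continuous_imp_vague continuous_imp_tight
        continuous_imp_no_gaussian_limit by blast
  next
    assume ?triplet
    then show ?cont
      by (intro allI vague_imp_continuous) auto
  qed
  moreover have "?cont \<longleftrightarrow> (\<forall>f. Cc_infty f \<longrightarrow> continuous_on UNIV (pd_operator f))"
    using continuous_imp_pd_operator_continuous pd_operator_continuous_imp_continuous[OF chi_smooth]
    by blast
  ultimately show ?thesis
    unfolding q pdo by (intro conjI)
qed

end
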